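(* For each label $* \in \{\boldsymbol{A}, \boldsymbol{B}, \boldsymbol{C}, \boldsymbol{D}, \boldsymbol{E}\}$ let $C_*(n)$, $n \in \mathbb{Z}_{\ge 0}$, be the integer sequence $$C_{\boldsymbol{A}}(n) = \sum_{k=0}^n \binom{n}{k}^3, \qquad C_{\boldsymbol{B}}(n) = \sum_{k=0}^{\lfloor n/3 \rfloor} (-1)^k 3^{n-3k} \binom{n}{3k} \frac{(3k)!}{k!^3}, \qquad C_{\boldsymbol{C}}(n) = \sum_{k=0}^n \binom{n}{k}^2 \binom{2k}{k},$$ $$C_{\boldsymbol{D}}(n) = \sum_{k=0}^n \binom{n}{k}^2 \binom{n+k}{k}, \qquad C_{\boldsymbol{E}}(n) = \sum_{k=0}^n \binom{n}{k}\binom{2k}{k}\binom{2(n-k)}{n-k},$$ and let $f_*(\tau) = \sum_{n \ge 1} \gamma_{n,*}\, q^n$ be the newform of weight $3$ and level $N_*$ given by $$f_{\boldsymbol{A}}(\tau) = \frac{\eta(4\tau)^5 \eta(8\tau)^5}{\eta(2\tau)^2\eta(16\tau)^2} \ (N_{\boldsymbol{A}} = 32), \qquad f_{\boldsymbol{B}}(\tau) = f_{\boldsymbol{D}}(\tau) = \eta(4\tau)^6 \ (N_{\boldsymbol{B}} = N_{\boldsymbol{D}} = 16),$$ $$f_{\boldsymbol{C}}(\tau) = \eta(2\tau)^3\eta(6\tau)^3 \ (N_{\boldsymbol{C}} = 12), \qquad f_{\boldsymbol{E}}(\tau) = \eta(\tau)^2\eta(2\tau)\eta(4\tau)\eta(8\tau)^2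 \ (N_{\boldsymbol{E}} = 8).$$ Then, for each $* \in \{\boldsymbol{A}, \boldsymbol{B}, \boldsymbol{C}, \boldsymbol{D}, \boldsymbol{E}\}$ and for all primes $p > 2$, $$C_*\!\left(\tfrac{p-1}{2}\right) \equiv \gamma_{p,*} \pmod{p}.$$
   Context: Here $q = e^{2\pi i \tau}$ with $\tau$ in the upper half-plane, and $\eta(\tau) = q^{1/24}\prod_{n\ge1}(1-q^n)$ is the Dedekind eta function. The $\gamma_{n,*}$ are the Fourier coefficients of $f_*$ (they are integers). *)

theory Defs
  imports "HOL-Analysis.Analysis" "HOL-Computational_Algebra.Primes" "HOL-Number_Theory.Cong"
begin

datatype label = A | B | C | D | E

(* The division in case B is exact: (3k)!/k!^3 is a multinomial coefficient. *)
fun C_seq :: "label \<Rightarrow> nat \<Rightarrow> int" where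
  "C_seq A n = (\<Sum>k=0..n. int (n choose k) ^ 3)"
| "C_seq B n = (\<Sum>k=0..n div 3. (-1) ^ k * 3 ^ (n - 3 * k) * int (n choose (3 * k)) *
                  (fact (3 * k) div fact k ^ 3))"
| "C_seq C n = (\<Sum>k=0..n. int (n choose k) ^ 2 * int ((2 * k) choose k))"
| "C_seq D n = (\<Sum>k=0..n. int (n choose k) ^ 2 * int ((n + k) choose k))"
| "C_seq E n = (\<Sum>k=0..n. int (n choose k) * int ((2 * k) choose k) *
                  int ((2 * (n - k)) choose (n - k)))"

definition to_q :: "complex \<Rightarrow> complex" where
  "to_q \<tau> = exp (2 * of_real pi * \<i> * \<tau>)"

(* q^(1/24) is the branch exp (2 pi i tau / 24).  Only meaningful for Im tau > 0. *)
definition dedekind_eta :: "complex \<Rightarrow> complex" where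
  "dedekind_eta \<tau> =
     exp (2 * of_real pi * \<i> * \<tau> / 24) * (\<Prod>n. 1 - to_q \<tau> ^ Suc n)"

(* These are newforms of weight 3 and levels 32, 16, 12, 16 and 8, respectively. *)
fun f_form :: "label \<Rightarrow> complex \<Rightarrow> complex" where
  "f_form A \<tau> = (dedekind_eta (4 * \<tau>) ^ 5 * dedekind_eta (8 * \<tau>) ^ 5) /
                 (dedekind_eta (2 * \<tau>) ^ 2 * dedekind_eta (16 * \<tau>) ^ 2)"
| "f_form B \<tau> = dedekind_eta (4 * \<tau>) ^ 6"
| "f_form C \<tau> = dedekind_eta (2 * \<tau>) ^ 3 * dedekind_eta (6 * \<tau>) ^ 3"
| "f_form D \<tau> = dedekind_eta (4 * \<tau>) ^ 6"
| "f_form E \<tau> = dedekind_eta \<tau> ^ 2 * dedekind_eta (2 * \<tau>) *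
                 dedekind_eta (4 * \<tau>) * dedekind_eta (8 * \<tau>) ^ 2"

definition has_q_expansion :: "(complex \<Rightarrow> complex) \<Rightarrow> (nat \<Rightarrow> int) \<Rightarrow> bool" where
  "has_q_expansion f c \<longleftrightarrow>
     c 0 = 0 \<and> (\<forall>\<tau>. Im \<tau> > 0 \<longrightarrow> (\<lambda>n. of_int (c n) * to_q \<tau> ^ n) sums f \<tau>)"

(* The Fourier coefficients.  The description operator gives an unspecified value unless the form
   does have a q-expansion with integer coefficients (which is then unique), so integrality
   and convergence are not assumed but have to be established to reason about gamma_coeff. *)
definition gamma_coeff :: "label \<Rightarrow> nat \<Rightarrow> int" where
  "gamma_coeff L = (THE c. has_q_expansion (f_form L) c)"

end

theory Submission
  imports Defs "HOL-Complex_Analysis.Complex_Analysis"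
begin

text \<open>Everything takes place in the ring of power series in \<open>q\<close>.  The common mechanism is
  arithmetic: if \<open>t = q u\<^sup>2\<close> with \<open>u\<close> integral and \<open>q dt/dq = t L\<close>, then substituting
  \<open>q \<rightarrow> q\<^sup>2\<close> and comparing the coefficients of \<open>q^(p-1)\<close> shows that
  the coefficient of index \<open>(p-1)/2\<close> of \<open>u (\<Sum> c(n) t^n) L\<close> is congruent to \<open>c((p-1)/2)\<close>.
  It remains to write the eta quotients in this form, with \<open>\<Sum> c(n) t^n\<close> a modular form of weight one.

  For \<open>E\<close> take \<open>t = q \<psi>(q\<^sup>4)\<^sup>2/\<phi>(q)\<^sup>2\<close> and weight one form \<open>\<phi>\<^sup>2\<close>, for \<open>C\<close> take
  \<open>t = q \<psi>(q\<^sup>3)\<^sup>4/\<psi>(q)\<^sup>4\<close>.  The generating function is the pullback of one hypergeometric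
  function along two different rational maps, and these are related by \<open>q \<rightarrow> q\<^sup>2\<close>.  Hence
  \<open>\<Sum> c(n) t^n\<close> and the weight one form satisfy the same functional equation under
  \<open>q \<rightarrow> q\<^sup>2\<close>, which has only one solution with constant term \<open>1\<close>.  The same uniqueness
  identifies \<open>L\<close>.  The identities between theta functions follow from the triple product and,
  in level six, from the norm over the cube roots of unity of 3-dissections.

  The case \<open>A\<close> is a twist of the case \<open>E\<close>.  For \<open>B\<close> and \<open>D\<close> one uses instead the
  coefficients of a product of two hypergeometric series; the sequences are congruent
  modulo \<open>p\<close> at \<open>n = (p-1)/2\<close> since \<open>(2k choose k)\<close> is then congruent to
  \<open>(-4)^k (n choose k)\<close>.\<close>

section \<open>Integral power series and the Cartier congruence\<close>

unbundle no vec_syntax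

text \<open>Only odd indices matter, so the object to study is the even part \<open>H(q^2)\<close>
  of \<open>f / q\<close>. With \<open>s = q u(q^2)\<close> one has \<open>s^2 = t(q^2)\<close>, and
  \<open>H = u Z L\<close> with \<open>Z = \<Sum> c(n) t^n\<close> is exactly the shape for which
  \<open>H(q^2) dq\<close> equals \<open>\<Sum> c(n) s^(2n) ds\<close>. The weights 0, 1 and 2 of
  \<open>u\<close>, \<open>Z\<close>, \<open>L\<close> add up to 3.

  Transformation laws and dimension formulas are avoided altogether. Their place is taken by one
  polynomial relation between \<open>t(q)\<close> and \<open>t(q^2)\<close> in each level: it makes
  the two rational maps agree, and its derivative relates \<open>L(q)\<close> to
  \<open>L(q^2)\<close>. To prove it, the factors \<open>1 - 4t\<close>, \<open>1 - 8t\<close>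
  (level 8) and \<open>1 - t\<close>, \<open>1 - 9t\<close> (level 6), whose zeros are the singular
  points of the differential equations, are written as theta or eta quotients. In level 6 the
  relation has the shape of the Borweins' \<open>a^3 = b^3 + c^3\<close> taken at
  \<open>q^2\<close>.

  The sequence \<open>B\<close> resists a termwise comparison; it is reached by expanding
  \<open>3 = 4 - 1\<close> and using an identity for the cube of a central binomial
  coefficient.\<close>

definition dil :: "nat \<Rightarrow> complex fps \<Rightarrow> complex fps" where
  "dil m f = f oo fps_X ^ m"

definition sc :: "complex \<Rightarrow> complex fps \<Rightarrow> complex fps" where
  "sc c f = f oo (fps_const c * fps_X)"

lemma dil_add: "dil m (f + g) = dil m f + dil m g"
  and dil_diff: "dil m (f - g) = dil m f - dil m g"
  and dil_uminus: "dil m (- f) = - dil m f"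
  and dil_const [simp]: "dil m (fps_const c) = fps_const c"
  and dil_numeral [simp]: "dil m (numeral k) = numeral k"
  and dil_1 [simp]: "dil m 1 = 1"
  and dil_nth_0 [simp]: "dil m f $ 0 = f $ 0"
  by (simp_all add: dil_def fps_compose_add_distrib fps_compose_sub_distrib fps_compose_uminus)

lemma dil_mult: "m > 0 \<Longrightarrow> dil m (f * g) = dil m f * dil m g"
  and dil_power: "m > 0 \<Longrightarrow> dil m (f ^ n) = dil m f ^ n"
  and dil_inverse: "m > 0 \<Longrightarrow> f $ 0 \<noteq> 0 \<Longrightarrow> dil m (inverse f) = inverse (dil m f)"
  and dil_X: "m > 0 \<Longrightarrow> dil m fps_X = fps_X ^ m"
  by (simp_all add: dil_def fps_compose_mult_distrib fps_compose_power[symmetric] fps_inverse_compose)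

lemma dil_dil: "m > 0 \<Longrightarrow> n > 0 \<Longrightarrow> dil m (dil n f) = dil (m * n) f"
  by (simp add: dil_def fps_compose_assoc[symmetric] fps_compose_power[symmetric] power_mult fps_X_power_compose)

lemma dil_nth: "m > 0 \<Longrightarrow> dil m f $ n = (if m dvd n then f $ (n div m) else 0)"
proof -
  assume m: "m > 0"
  have "dil m f $ n = (\<Sum>i=0..n. f $ i * (if m * i = n then 1 else 0))"
    by (simp add: dil_def fps_compose_nth power_mult[symmetric] fps_X_power_nth eq_commute)
  also have "\<dots> = (\<Sum>i\<in>{0..n} \<inter> {i. m * i = n}. f $ i)"
    by (subst sum.inter_restrict) (auto intro!: sum.cong)
  also have "{0..n} \<inter> {i. m * i = n} = (if m dvd n then {n div m} else {})"
    using m by (auto simp: dvd_def intro!: mult_le_mono1[of 1 m, simplified])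
  finally show ?thesis by auto
qed

lemma sc_add: "sc c (f + g) = sc c f + sc c g"
  and sc_diff: "sc c (f - g) = sc c f - sc c g"
  and sc_const [simp]: "sc c (fps_const d) = fps_const d"
  and sc_numeral [simp]: "sc c (numeral k) = numeral k"
  and sc_1 [simp]: "sc c 1 = 1"
  and sc_mult: "sc c (f * g) = sc c f * sc c g"
  and sc_power: "sc c (f ^ n) = sc c f ^ n"
  and sc_inverse: "f $ 0 \<noteq> 0 \<Longrightarrow> sc c (inverse f) = inverse (sc c f)"
  and sc_nth_0 [simp]: "sc c f $ 0 = f $ 0"
  and sc_X: "sc c fps_X = fps_const c * fps_X"
  by (simp_all add: sc_def fps_compose_add_distrib fps_compose_sub_distrib
     fps_compose_mult_distrib fps_compose_power[symmetric] fps_inverse_compose)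

lemma sc_nth: "sc c f $ n = c ^ n * f $ n"
  by (simp add: sc_def)

text \<open>Congruence modulo \<open>fps_X ^ n\<close>. It replaces convergence: infinite products
  and theta series are compared through finite truncations. The divisibility form gives
  compatibility with products at once.\<close>

definition eqX :: "nat \<Rightarrow> complex fps \<Rightarrow> complex fps \<Rightarrow> bool" where
  "eqX n f g \<longleftrightarrow> fps_X ^ n dvd f - g"

lemma eqX_iff: "eqX n f g \<longleftrightarrow> (\<forall>k<n. f $ k = g $ k)"
proof
  assume "eqX n f g"
  then obtain h where "f - g = fps_X ^ n * h" by (auto simp: eqX_def dvd_def)
  hence "(f - g) $ k = 0" if "k < n" for k using that by (simp add: fps_X_power_mult_nth)
  thus "\<forall>k<n. f $ k = g $ k" by simp
next
  assume *: "\<forall>k<n. f $ k = g $ k"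
  have "f - g = fps_X ^ n * fps_shift n (f - g)"
    by (rule fps_ext) (use * in \<open>auto simp: fps_X_power_mult_nth\<close>)
  thus "eqX n f g" unfolding eqX_def by (metis dvd_triv_left)
qed

lemma eqX_refl [simp]: "eqX n f f"
  and eqX_sym: "eqX n f g \<Longrightarrow> eqX n g f"
  and eqX_trans [trans]: "eqX n f g \<Longrightarrow> eqX n g h \<Longrightarrow> eqX n f h"
  and eqX_mono: "eqX n f g \<Longrightarrow> m \<le> n \<Longrightarrow> eqX m f g"
  by (auto simp: eqX_iff)

lemma eqX_mult: "eqX n f g \<Longrightarrow> eqX n f' g' \<Longrightarrow> eqX n (f * f') (g * g')"
proof -
  assume "eqX n f g" "eqX n f' g'"
  moreover have "f * f' - g * g' = (f - g) * f' + g * (f' - g')" by (simp add: algebra_simps)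
  ultimately show ?thesis unfolding eqX_def by (metis dvd_add dvd_mult dvd_mult2)
qed

lemma eqX_prod: "(\<And>i. i \<in> S \<Longrightarrow> eqX n (f i) (g i)) \<Longrightarrow> eqX n (prod f S) (prod g S)"
  by (induction S rule: infinite_finite_induct) (auto intro: eqX_mult)

lemma eqX_sum: "(\<And>i. i \<in> S \<Longrightarrow> eqX n (f i) (g i)) \<Longrightarrow> eqX n (sum f S) (sum g S)"
  by (induction S rule: infinite_finite_induct) (auto simp: eqX_iff)

lemma eqX_power_mult: "eqX n f g \<Longrightarrow> eqX (m + n) (fps_X ^ m * f) (fps_X ^ m * g)"
  unfolding eqX_def by (metis mult_dvd_mono dvd_refl power_add right_diff_distrib')

lemma eqX_cancel: "eqX n (f * h) (g * h) \<Longrightarrow> h $ 0 \<noteq> 0 \<Longrightarrow> eqX n f g"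
  using eqX_mult[of n "f * h" "g * h" "inverse h" "inverse h"]
  by (simp add: mult.assoc inverse_mult_eq_1')

lemma fps_X_dvd: "f $ 0 = 0 \<Longrightarrow> fps_X dvd (f :: complex fps)"
  using eqX_iff[of 1 f 0] by (simp add: eqX_def)

lemma eqX_imp_eq: "(\<And>n. eqX (Suc n) f g) \<Longrightarrow> f = g"
  unfolding eqX_iff by (metis fps_ext lessI)

section \<open>Power series with integer coefficients\<close>

definition int_fps :: "complex fps \<Rightarrow> bool" where
  "int_fps f \<longleftrightarrow> (\<forall>n. f $ n \<in> \<int>)"

lemma int_fps_1 [intro]: "int_fps 1"
  and int_fps_X [intro]: "int_fps fps_X"
  and int_fps_add [intro]: "int_fps f \<Longrightarrow> int_fps g \<Longrightarrow> int_fps (f + g)"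
  and int_fps_diff [intro]: "int_fps f \<Longrightarrow> int_fps g \<Longrightarrow> int_fps (f - g)"
  and int_fps_mult [intro]: "int_fps f \<Longrightarrow> int_fps g \<Longrightarrow> int_fps (f * g)"
  by (auto simp: int_fps_def fps_mult_nth fps_X_def fps_one_def)

lemma int_fps_power [intro]: "int_fps f \<Longrightarrow> int_fps (f ^ n)"
  by (induction n) auto

lemma int_fps_prod [intro]: "(\<And>i. i \<in> S \<Longrightarrow> int_fps (f i)) \<Longrightarrow> int_fps (prod f S)"
  by (induction S rule: infinite_finite_induct) auto

lemma int_fps_dil [intro]: "int_fps f \<Longrightarrow> m > 0 \<Longrightarrow> int_fps (dil m f)"
  by (simp add: int_fps_def dil_nth)

lemma int_fps_inverse [intro]:
  assumes f: "int_fps f" and f0: "f $ 0 = 1"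
  shows "int_fps (inverse f)"
proof -
  have "inverse f $ n \<in> \<int>" for n
  proof (induction n rule: less_induct)
    case (less n)
    show ?case
    proof (cases "n = 0")
      case False
      have "0 = (f * inverse f) $ n" using False f0 by (simp add: inverse_mult_eq_1')
      also have "\<dots> = inverse f $ n + (\<Sum>i=1..n. f $ i * inverse f $ (n - i))"
        by (simp add: fps_mult_nth sum.atLeast_Suc_atMost f0)
      finally have "inverse f $ n = - (\<Sum>i=1..n. f $ i * inverse f $ (n - i))"
        by (simp add: eq_neg_iff_add_eq_0)
      also have "\<dots> \<in> \<int>"
        using f less by (auto simp: int_fps_def intro!: Ints_minus Ints_sum Ints_mult)
      finally show ?thesis .
    qed (use f0 in simp)
  qed
  thus ?thesis by (simp add: int_fps_def)
qed

text \<open>Modulo \<open>p\<close>, the coefficient of \<open>q^(p-1)\<close> in \<open>s^(2n) s'\<close> vanishes unless \<open>2n + 1 = p\<close>,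
  because \<open>(2n + 1) s^(2n) s'\<close> is the derivative of \<open>s^(2n+1)\<close>.\<close>
lemma coeff_power_deriv_cong:
  fixes s :: "complex fps"
  assumes s: "int_fps s" "s $ 0 = 0" "s $ 1 = 1" and p: "prime p" "odd p"
  shows "\<exists>z. (s ^ (2 * n) * fps_deriv s) $ (p - 1) = of_int z \<and>
             [z = (if 2 * n + 1 = p then 1 else 0)] (mod int p)"
proof -
  define g where "g = s ^ (2 * n) * fps_deriv s"
  have "int_fps g" unfolding g_def using s
    by (intro int_fps_mult int_fps_power) (auto simp: int_fps_def)
  then obtain z where z: "g $ (p - 1) = of_int z"
    by (metis Ints_cases int_fps_def)
  obtain w where w: "(s ^ (2 * n + 1)) $ p = of_int w"
    by (metis Ints_cases int_fps_def int_fps_power s(1))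
  have p0: "p > 0" using p(1) by (simp add: prime_gt_0_nat)
  have "of_nat (2 * n + 1) * g = fps_deriv (s ^ (2 * n + 1))"
    by (simp only: fps_deriv_power g_def diff_add_inverse2 mult_ac fps_of_nat)
  hence "(of_nat (2 * n + 1) * g) $ (p - 1) = fps_deriv (s ^ (2 * n + 1)) $ (p - 1)"
    by (rule arg_cong)
  also have "\<dots> = of_nat p * of_int w"
    unfolding fps_deriv_nth using p0 w by simp
  finally have "(of_nat (2 * n + 1) * g) $ (p - 1) = of_nat p * of_int w" .
  hence "of_nat (2 * n + 1) * of_int z = (of_nat p * of_int w :: complex)"
    using z by (simp only: fps_of_nat[symmetric] fps_mult_left_const_nth)
  hence "of_int (int (2 * n + 1) * z) = (of_int (int p * w) :: complex)"
    by simp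
  hence eq: "int (2 * n + 1) * z = int p * w" by (simp only: of_int_eq_iff)
  consider "2 * n + 1 = p" | "2 * n + 1 < p" | "2 * n + 1 > p" by linarith
  thus ?thesis
  proof cases
    case 1
    obtain v where v: "s = fps_X * v" using fps_X_dvd[OF s(2)] by auto
    hence "v $ 0 = 1" using s(3) by simp
    have "(s ^ p) $ p = 1"
      unfolding v by (simp add: power_mult_distrib fps_X_power_mult_nth fps_power_zeroth \<open>v $ 0 = 1\<close>)
    hence "w = 1" using w unfolding 1 by simp
    hence "z = 1" using eq 1 p0 by auto
    thus ?thesis using 1 z g_def by auto
  next
    case 2
    have "int p dvd int (2 * n + 1) * z" using eq by simp
    moreover have "\<not> int p dvd int (2 * n + 1)"
      using 2 by (metis int_dvd_int_iff nat_dvd_not_less zero_less_Suc Suc_eq_plus1)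
    ultimately have "int p dvd z" using p(1) by (metis prime_dvd_mult_iff prime_nat_int_transfer)
    thus ?thesis using 2 z g_def by (auto simp: cong_0_iff)
  next
    \<comment> \<open>Here \<open>p\<close> may divide \<open>2 * n + 1\<close>, so the derivative
      gives nothing; but \<open>s ^ (2 * n)\<close> starts at order
      \<open>2 * n > p - 1\<close>.\<close>
    case 3
    obtain v where v: "s = fps_X * v" using fps_X_dvd[OF s(2)] by auto
    have "g $ (p - 1) = 0"
      unfolding g_def v using 3 p(2)
      by (auto simp: power_mult_distrib mult.assoc fps_X_power_mult_nth elim!: oddE)
    hence "z = 0" using z by simp
    thus ?thesis using 3 z g_def by auto
  qed
qed

lemma compose_sum_truncate:
  assumes "s $ 0 = 0" "m \<le> M"
  shows "(c oo s) $ m = (\<Sum>n\<le>M. c $ n * (s ^ n) $ m)"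
proof -
  have "(s ^ n) $ m = 0" if "n > m" for n
    using that assms(1) by (simp add: startsby_zero_power_prefix)
  thus ?thesis unfolding fps_compose_nth atMost_atLeast0
    by (intro sum.mono_neutral_left) (use assms(2) in auto)
qed

text \<open>Replacing \<open>q\<close> by \<open>q^2\<close> turns \<open>t\<close> into the square
  of the integral series \<open>s\<close>, and \<open>dil 2 H\<close> into
  \<open>(cs oo s\<^sup>2) * fps_deriv s\<close>. Only the exact differentials of the odd powers
  \<open>s ^ (2 * n + 1)\<close> occur, up to the factors \<open>2 * n + 1\<close>, so modulo
  \<open>p\<close> a single term survives in degree \<open>p - 1\<close>.\<close>

theorem coeff_cong_of_log_deriv:
  fixes u t L H :: "complex fps" and c :: "nat \<Rightarrow> int"
  assumes u: "int_fps u" "u $ 0 = 1"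
    and t: "t = fps_X * u\<^sup>2" and L: "fps_X * fps_deriv t = t * L"
    and H: "H = u * (Abs_fps (\<lambda>n. of_int (c n)) oo t) * L"
    and p: "prime p" "odd p"
    and Hz: "H $ ((p - 1) div 2) = of_int z"
  shows "[c ((p - 1) div 2) = z] (mod int p)"
proof -
  define s where "s = fps_X * dil 2 u"
  define cs where "cs = Abs_fps (\<lambda>n. of_int (c n) :: complex)"
  have s: "int_fps s" "s $ 0 = 0" "s $ 1 = 1"
    using u by (auto simp: s_def intro!: int_fps_mult int_fps_dil)
  have u0: "u \<noteq> 0" using u by auto
  have s2: "s\<^sup>2 = dil 2 t"
    by (simp add: s_def t dil_mult dil_power dil_X power_mult_distrib)
  \<comment> \<open>The 2 from the chain rule for \<open>q -> q^2\<close> cancels the 2 from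
    differentiating a square, so \<open>s\<close> has logarithmic derivative
    \<open>dil 2 L\<close>.\<close>
  have "2 * s * (fps_X * fps_deriv s) = fps_X * fps_deriv (s\<^sup>2)"
    by (simp add: power2_eq_square algebra_simps)
  also have "\<dots> = fps_X * fps_deriv (t oo fps_X\<^sup>2)" by (simp add: s2 dil_def)
  also have "\<dots> = 2 * dil 2 (fps_X * fps_deriv t)"
    by (subst fps_compose_deriv)
      (simp_all add: dil_mult dil_X, simp add: dil_def power2_eq_square algebra_simps)
  also have "\<dots> = 2 * (s\<^sup>2 * dil 2 L)" by (simp add: L dil_mult s2)
  finally have "(2 * s) * (fps_X * fps_deriv s) = (2 * s) * (s * dil 2 L)"
    by (simp add: power2_eq_square algebra_simps)
  moreover have "s \<noteq> 0" using s(3) by auto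
  ultimately have sL: "fps_X * fps_deriv s = s * dil 2 L"
    by (subst (asm) mult_cancel_left) auto
  have t0: "t $ 0 = 0" by (simp add: t)
  have "dil 2 (cs oo t) = cs oo s\<^sup>2"
    by (simp add: s2 dil_def fps_compose_assoc t0)
  hence "fps_X * dil 2 H = (cs oo s\<^sup>2) * (s * dil 2 L)"
    unfolding H by (simp add: dil_mult s_def cs_def algebra_simps)
  also have "\<dots> = fps_X * ((cs oo s\<^sup>2) * fps_deriv s)"
    by (simp only: sL[symmetric] mult_ac)
  finally have HC: "dil 2 H = (cs oo s\<^sup>2) * fps_deriv s" by simp
  define m where "m = (p - 1) div 2"
  have pm: "p = 2 * m + 1" using p(2) by (auto simp: m_def elim!: oddE)
  have "\<exists>z. \<forall>n. (s ^ (2 * n) * fps_deriv s) $ (p - 1) = of_int (z n) \<and>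
             [z n = (if 2 * n + 1 = p then 1 else 0)] (mod int p)"
    using coeff_power_deriv_cong[OF s p] by metis
  then obtain w where w: "\<And>n. (s ^ (2 * n) * fps_deriv s) $ (p - 1) = of_int (w n)"
     "\<And>n. [w n = (if 2 * n + 1 = p then 1 else 0)] (mod int p)" by blast
  have "of_int z = dil 2 H $ (2 * m)" using Hz by (simp add: dil_nth m_def)
  also have "\<dots> = (\<Sum>i\<le>2*m. (\<Sum>n\<le>2*m. cs $ n * ((s\<^sup>2) ^ n) $ i) * fps_deriv s $ (2 * m - i))"
    unfolding HC fps_mult_nth using s(2)
    by (intro sum.cong) (auto simp: atMost_atLeast0 compose_sum_truncate[of _ _ "2*m"] power2_eq_square)
  also have "\<dots> = (\<Sum>n\<le>2*m. cs $ n * (s ^ (2 * n) * fps_deriv s) $ (2 * m))"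
    unfolding fps_mult_nth sum_distrib_right sum_distrib_left atMost_atLeast0
    by (subst sum.swap) (simp add: power_mult mult.assoc)
  also have "\<dots> = of_int (\<Sum>n\<le>2*m. c n * w n)"
    using w(1) by (simp add: cs_def pm)
  finally have "z = (\<Sum>n\<le>2*m. c n * w n)" by (simp only: of_int_eq_iff)
  moreover have "[(\<Sum>n\<le>2*m. c n * w n) = (\<Sum>n\<le>2*m. c n * (if 2 * n + 1 = p then 1 else 0))] (mod int p)"
    by (intro cong_sum cong_mult cong_refl w(2))
  moreover have "(\<Sum>n\<le>2*m. c n * (if 2 * n + 1 = p then 1 else 0)) = (\<Sum>n\<le>2*m. if n = m then c m else 0)"
    by (intro sum.cong) (auto simp: pm)
  ultimately show ?thesis unfolding m_def[symmetric] by (simp add: pm cong_sym)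
qed

text \<open>A coefficient of odd index vanishes and one of even index \<open>n\<close> equals that
  of index \<open>n div 2\<close>; repeated halving brings every positive index down to an odd
  one.\<close>

lemma fps_eq_1_of_dil:
  assumes "dil 2 r = r" "r $ 0 = 1"
  shows "r = (1 :: complex fps)"
proof -
  have "r $ n = 0" if "n > 0" for n
    using that
  proof (induction n rule: less_induct)
    case (less n)
    show ?case using less.IH[of "n div 2"] less.prems
      by (subst assms(1)[symmetric]) (auto simp: dil_nth)
  qed
  thus ?thesis using assms(2) by (intro fps_ext) (auto simp: fps_one_def)
qed

text \<open>The quotient of two solutions is invariant under \<open>q -> q^2\<close>, hence
  constant. This is the identity principle used for modular forms throughout.\<close>

lemma fps_eq_of_dil:
  assumes "f = M * dil 2 f" "g = M * dil 2 g" "f $ 0 = 1" "g $ 0 = 1"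
  shows "f = (g :: complex fps)"
proof -
  have M0: "M $ 0 = 1" using arg_cong[OF assms(1), of "\<lambda>x. x $ 0"] assms(3) by simp
  have i: "h * inverse h = 1" if "h $ 0 = 1" for h :: "complex fps"
    using that by (simp add: inverse_mult_eq_1')
  have "dil 2 (f * inverse g) = dil 2 f * inverse (dil 2 g)"
    using assms(4) by (simp add: dil_mult dil_inverse)
  also have "\<dots> = (M * dil 2 f) * inverse (M * dil 2 g)"
    using i[OF M0] by (simp add: fps_inverse_mult algebra_simps)
  also have "\<dots> = f * inverse g" using assms(1,2) by simp
  finally have "f * inverse g = 1"
    by (rule fps_eq_1_of_dil) (use assms in auto)
  hence "f * (g * inverse g) = g" by (simp add: algebra_simps)
  thus ?thesis using i[OF assms(4)] by simp
qed

section \<open>Euler products\<close>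

text \<open>Encodes the infinite product of the factors \<open>1 - w i * q ^ i\<close>,
  \<open>i > 0\<close>. Factors with \<open>i > n\<close> are 1 modulo \<open>q ^ (n + 1)\<close>,
  so the \<open>n\<close>-th partial product already has the right coefficient of index
  \<open>n\<close>.\<close>

definition eprod :: "(nat \<Rightarrow> complex) \<Rightarrow> complex fps" where
  "eprod w = Abs_fps (\<lambda>n. (\<Prod>i=1..n. 1 - fps_const (w i) * fps_X ^ i) $ n)"

lemma dil_prod: "m > 0 \<Longrightarrow> dil m (prod f S) = (\<Prod>i\<in>S. dil m (f i))"
  by (induction S rule: infinite_finite_induct) (simp_all add: dil_mult)

lemma sc_prod: "sc c (prod f S) = (\<Prod>i\<in>S. sc c (f i))"
  by (induction S rule: infinite_finite_induct) (simp_all add: sc_mult)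

lemma dil_factor: "m > 0 \<Longrightarrow> dil m (1 - fps_const c * fps_X ^ i) = 1 - fps_const c * fps_X ^ (m * i)"
  by (simp only: dil_diff dil_mult dil_const dil_1 dil_power dil_X power_mult)

lemma sc_factor: "sc c (1 - fps_const d * fps_X ^ i) = 1 - fps_const (c ^ i * d) * fps_X ^ i"
  by (simp only: sc_diff sc_mult sc_const sc_1 sc_power sc_X power_mult_distrib fps_const_power
      fps_const_mult[symmetric] mult_ac)

lemma eqX_factor: "n < i \<Longrightarrow> eqX (Suc n) (1 - fps_const c * fps_X ^ i) 1"
  by (auto simp: eqX_iff fps_X_power_nth)

lemma eqX_partial_prod:
  assumes "n \<le> N"
  shows "eqX (Suc n) (\<Prod>i=1..N. 1 - fps_const (w i) * fps_X ^ i) (\<Prod>i=1..n. 1 - fps_const (w i) * fps_X ^ i)"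
proof -
  have "{1..N} = {1..n} \<union> {n<..N}" using assms by auto
  hence "(\<Prod>i=1..N. 1 - fps_const (w i) * fps_X ^ i) =
     (\<Prod>i=1..n. 1 - fps_const (w i) * fps_X ^ i) * (\<Prod>i\<in>{n<..N}. 1 - fps_const (w i) * fps_X ^ i)"
    by (simp only:) (rule prod.union_disjoint, auto)
  moreover have "eqX (Suc n) (\<Prod>i\<in>{n<..N}. 1 - fps_const (w i) * fps_X ^ i) (\<Prod>i\<in>{n<..N}. 1)"
    by (intro eqX_prod eqX_factor) auto
  ultimately show ?thesis
    using eqX_mult[OF eqX_refl, of "Suc n" _ "1" "\<Prod>i=1..n. 1 - fps_const (w i) * fps_X ^ i"] by simp
qed

lemma eqX_eprod:
  assumes "n \<le> N"
  shows "eqX (Suc n) (eprod w) (\<Prod>i=1..N. 1 - fps_const (w i) * fps_X ^ i)"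
  unfolding eqX_iff
proof safe
  fix k assume "k < Suc n"
  hence "eqX (Suc k) (\<Prod>i=1..N. 1 - fps_const (w i) * fps_X ^ i) (\<Prod>i=1..k. 1 - fps_const (w i) * fps_X ^ i)"
    using assms by (intro eqX_partial_prod) auto
  thus "eprod w $ k = (\<Prod>i=1..N. 1 - fps_const (w i) * fps_X ^ i) $ k"
    by (simp add: eqX_iff eprod_def)
qed

lemma eprod_eqI:
  assumes "\<And>n. eqX (Suc n) f (\<Prod>i=1..n. 1 - fps_const (w i) * fps_X ^ i)"
  shows "f = eprod w"
  by (rule eqX_imp_eq) (meson assms eqX_eprod eqX_sym eqX_trans order_refl)

lemma eprod_cong: "(\<And>i. i > 0 \<Longrightarrow> w i = v i) \<Longrightarrow> eprod w = eprod v"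
  unfolding eprod_def by (intro arg_cong[of _ _ Abs_fps] ext arg_cong2[of _ _ _ _ fps_nth] prod.cong) auto

lemma eprod_nth_0 [simp]: "eprod w $ 0 = 1"
  by (simp add: eprod_def)

lemma int_eprod: "(\<And>i. w i \<in> \<int>) \<Longrightarrow> int_fps (eprod w)"
proof -
  assume w: "\<And>i. w i \<in> \<int>"
  have "int_fps (\<Prod>i=1..n. 1 - fps_const (w i) * fps_X ^ i)" for n
    by (intro int_fps_prod int_fps_diff int_fps_1 int_fps_mult int_fps_power int_fps_X)
       (auto simp: int_fps_def w)
  thus ?thesis by (simp add: int_fps_def eprod_def)
qed

text \<open>The hypothesis kills the quadratic term of each product of two factors. This serves to
  split a product by residue classes and to put it together again.\<close>

lemma eprod_mult_disjoint:
  assumes "\<And>i. i > 0 \<Longrightarrow> w i * v i = 0"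
  shows "eprod w * eprod v = eprod (\<lambda>i. w i + v i)"
proof (rule eprod_eqI)
  fix n
  have "(\<Prod>i=1..n. 1 - fps_const (w i) * fps_X ^ i) * (\<Prod>i=1..n. 1 - fps_const (v i) * fps_X ^ i)
     = (\<Prod>i=1..n. 1 - fps_const (w i + v i) * fps_X ^ i)"
    unfolding prod.distrib[symmetric]
  proof (rule prod.cong)
    fix i assume "i \<in> {1..n}"
    hence 0: "fps_const (w i) * fps_const (v i) = 0" using assms by (simp del: mult_eq_0_iff)
    have "(1 - s * z) * (1 - r * z) = 1 - (s + r) * z + s * r * z ^ 2" for s r z :: "complex fps"
      by (simp add: algebra_simps power2_eq_square)
    from this[where s = "fps_const (w i)" and r = "fps_const (v i)" and z = "fps_X ^ i"]
    show "(1 - fps_const (w i) * fps_X ^ i) * (1 - fps_const (v i) * fps_X ^ i) =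
        1 - fps_const (w i + v i) * fps_X ^ i"
      by (simp only: 0 fps_const_add mult_zero_left add_0_right)
  qed simp
  thus "eqX (Suc n) (eprod w * eprod v) (\<Prod>i=1..n. 1 - fps_const (w i + v i) * fps_X ^ i)"
    using eqX_mult[OF eqX_eprod[OF order_refl, of n w] eqX_eprod[OF order_refl, of n v]]
    by (simp only:)
qed

lemma dil_eprod:
  assumes m: "m > 0"
  shows "dil m (eprod w) = eprod (\<lambda>i. if m dvd i then w (i div m) else 0)"
proof (rule eprod_eqI)
  fix n
  define g where "g i = 1 - fps_const (w i) * fps_X ^ i" for i
  have *: "eqX (Suc n) (dil m f) (dil m f')" if "eqX (Suc n) f f'" for f f'
    using that m by (auto simp: eqX_iff dil_nth) (metis div_le_dividend le_less_trans less_Suc_eq_le)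
  have 1: "eqX (Suc n) (dil m (eprod w)) (dil m (\<Prod>i=1..n div m. g i))"
    unfolding eqX_iff
  proof safe
    fix k assume "k < Suc n"
    hence "k div m \<le> n div m" by (simp add: div_le_mono)
    thus "dil m (eprod w) $ k = dil m (\<Prod>i=1..n div m. g i) $ k"
      using eqX_eprod[of "n div m" "n div m" w] m by (simp add: dil_nth eqX_iff g_def)
  qed
  have "dil m (\<Prod>i=1..n div m. g i) = (\<Prod>i=1..n div m. 1 - fps_const (w i) * fps_X ^ (m * i))"
    by (simp only: dil_prod[OF m] dil_factor[OF m] g_def)
  also have "\<dots> = (\<Prod>i | i \<in> {1..n} \<and> m dvd i. 1 - fps_const (w (i div m)) * fps_X ^ i)"
    by (rule prod.reindex_bij_witness[of _ "\<lambda>i. i div m" "\<lambda>i. m * i"])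
      (use m in \<open>auto simp: div_le_mono less_eq_div_iff_mult_less_eq mult.commute elim!: dvdE\<close>)
  also have "\<dots> = (\<Prod>i=1..n. 1 - fps_const (if m dvd i then w (i div m) else 0) * fps_X ^ i)"
    by (rule prod.mono_neutral_cong_left) auto
  finally show "eqX (Suc n) (dil m (eprod w)) (\<Prod>i=1..n. 1 - fps_const (if m dvd i then w (i div m) else 0) * fps_X ^ i)"
    using 1 by simp
qed

lemma sc_eprod: "sc c (eprod w) = eprod (\<lambda>i. c ^ i * w i)"
proof (rule eprod_eqI)
  fix n
  have "sc c (\<Prod>i=1..n. 1 - fps_const (w i) * fps_X ^ i) =
        (\<Prod>i=1..n. 1 - fps_const (c ^ i * w i) * fps_X ^ i)"
    by (simp only: sc_prod sc_factor)
  moreover have "eqX (Suc n) (sc c (eprod w)) (sc c (\<Prod>i=1..n. 1 - fps_const (w i) * fps_X ^ i))"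
    using eqX_eprod[of n n w] by (simp add: eqX_iff sc_nth)
  ultimately show "eqX (Suc n) (sc c (eprod w)) (\<Prod>i=1..n. 1 - fps_const (c ^ i * w i) * fps_X ^ i)"
    by simp
qed

lemma eprod_mult_uminus:
  "eprod w * eprod (\<lambda>i. - w i) = dil 2 (eprod (\<lambda>i. (w i)\<^sup>2))"
proof (rule eqX_imp_eq)
  fix n
  have "eqX (Suc n) (eprod w * eprod (\<lambda>i. - w i))
     ((\<Prod>i=1..n. 1 - fps_const (w i) * fps_X ^ i) * (\<Prod>i=1..n. 1 - fps_const (- w i) * fps_X ^ i))"
    by (intro eqX_mult eqX_eprod) auto
  also have "(\<Prod>i=1..n. 1 - fps_const (w i) * fps_X ^ i) * (\<Prod>i=1..n. 1 - fps_const (- w i) * fps_X ^ i)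
    = dil 2 (\<Prod>i=1..n. 1 - fps_const ((w i)\<^sup>2) * fps_X ^ i)"
    unfolding prod.distrib[symmetric] dil_prod[OF zero_less_numeral] dil_factor[OF zero_less_numeral]
  proof (rule prod.cong)
    fix i
    have "(1 - s * z) * (1 - (- s) * z) = 1 - s ^ 2 * z ^ 2" for s z :: "complex fps"
      by (simp add: algebra_simps power2_eq_square)
    from this[of "fps_const (w i)" "fps_X ^ i"]
    show "(1 - fps_const (w i) * fps_X ^ i) * (1 - fps_const (- w i) * fps_X ^ i) =
        1 - fps_const ((w i)\<^sup>2) * fps_X ^ (2 * i)"
      by (simp only: fps_const_neg fps_const_power power_mult[symmetric] mult.commute[of 2 i])
  qed simp
  also have "eqX (Suc n) \<dots> (dil 2 (eprod (\<lambda>i. (w i)\<^sup>2)))"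
    using eqX_eprod[of n n "\<lambda>i. (w i)\<^sup>2"] by (auto simp: eqX_iff dil_nth elim!: dvdE)
  finally show "eqX (Suc n) (eprod w * eprod (\<lambda>i. - w i)) (dil 2 (eprod (\<lambda>i. (w i)\<^sup>2)))" .
qed

text \<open>The eta function at \<open>k * \<tau>\<close> without its factor
  \<open>q^(k/24)\<close>, as a formal series.\<close>

definition Eu :: "nat \<Rightarrow> complex fps" where
  "Eu k = eprod (\<lambda>i. if k dvd i then 1 else 0)"

lemma Eu_nth_0 [simp]: "Eu k $ 0 = 1"
  by (simp add: Eu_def)

lemma Eu_nonzero [simp]: "Eu k \<noteq> 0"
  by (metis Eu_nth_0 fps_zero_nth zero_neq_one)

lemma int_Eu [intro]: "int_fps (Eu k)"
  unfolding Eu_def by (rule int_eprod) auto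

lemma dil_Eu [simp]:
  assumes "m > 0"
  shows "dil m (Eu k) = Eu (m * k)"
proof -
  have "(if m dvd i then if k dvd i div m then 1 else 0 else 0) = (if m * k dvd i then 1 else 0 :: complex)" for i
    using assms by (auto simp: dvd_div_iff_mult mult.commute dest: dvd_mult_left)
  thus ?thesis unfolding Eu_def dil_eprod[OF assms] by (intro eprod_cong)
qed

lemma eprod_mod_times_Eu:
  "eprod (\<lambda>i. if m dvd i then 0 else 1) * Eu m = Eu 1"
proof -
  have "eprod (\<lambda>i. if m dvd i then 0 else 1) * eprod (\<lambda>i. if m dvd i then 1 else 0) =
    eprod (\<lambda>i. (if m dvd i then 0 else 1) + (if m dvd i then 1 else 0))"
    by (rule eprod_mult_disjoint) simp
  also have "\<dots> = Eu 1" unfolding Eu_def by (rule eprod_cong) simp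
  finally show ?thesis by (simp add: Eu_def)
qed

text \<open>Only the factors of odd index change under \<open>q -> -q\<close>. If \<open>P\<close>
  is their product and \<open>M\<close> its image, then \<open>P * M = dil 2 P\<close>, because
  \<open>(1 - x) * (1 + x) = 1 - x^2\<close>.\<close>

lemma sc_minus1_Eu1: "sc (-1) (Eu 1) * (Eu 1 * Eu 4) = Eu 2 ^ 3"
proof -
  define P where "P = eprod (\<lambda>i. if 2 dvd i then 0 else 1 :: complex)"
  define M where "M = eprod (\<lambda>i. - (if 2 dvd i then 0 else 1 :: complex))"
  have P: "P * Eu 2 = Eu 1" unfolding P_def by (rule eprod_mod_times_Eu)
  have M: "M * Eu 2 = sc (-1) (Eu 1)"
  proof -
    have "M * Eu 2 = eprod (\<lambda>i. - (if 2 dvd i then 0 else 1) + (if 2 dvd i then 1 else 0))"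
      unfolding M_def Eu_def by (rule eprod_mult_disjoint) simp
    also have "\<dots> = sc (-1) (Eu 1)"
      unfolding Eu_def sc_eprod by (rule eprod_cong) simp
    finally show ?thesis .
  qed
  have "P * M = dil 2 P"
    unfolding P_def M_def eprod_mult_uminus
    by (intro arg_cong[of _ _ "dil 2"] eprod_cong) simp
  moreover have "dil 2 P * Eu 4 = Eu 2"
    using arg_cong[OF P, of "dil 2"] by (simp add: dil_mult)
  ultimately have "P * M * Eu 4 = Eu 2" by simp
  hence N: "(P * M * Eu 4) * Eu 2 ^ 2 = Eu 2 ^ 3" by (simp only: power_Suc[symmetric]) simp
  have "sc (-1) (Eu 1) * (Eu 1 * Eu 4) = (M * Eu 2) * ((P * Eu 2) * Eu 4)"
    by (simp only: P M)
  also have "\<dots> = (P * M * Eu 4) * Eu 2 ^ 2" by (simp only: power2_eq_square mult_ac)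
  finally show ?thesis using N by (simp only:)
qed

lemma sc_Eu_dvd: "c ^ k = 1 \<Longrightarrow> sc c (Eu k) = Eu k"
  unfolding Eu_def sc_eprod by (rule eprod_cong) (auto simp: power_mult elim!: dvdE)

lemma cube_root_of_unity: "w ^ 2 + w + 1 = 0 \<Longrightarrow> w ^ 3 = (1 :: 'a :: comm_ring_1)"
proof -
  assume "w ^ 2 + w + 1 = 0"
  moreover have "w ^ 3 - 1 = (w - 1) * (w ^ 2 + w + 1)"
    by (simp add: algebra_simps power2_eq_square power3_eq_cube)
  ultimately show ?thesis by simp
qed

text \<open>A factor \<open>1 - q^i\<close> with 3 not dividing \<open>i\<close> has norm
  \<open>1 - q^(3i)\<close>, while the factors with 3 dividing \<open>i\<close> are fixed and become
  cubes. With \<open>P = Eu k / Eu (3 * k)\<close> the norm of \<open>P\<close> is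
  \<open>dil 3 P\<close>, which brings in \<open>Eu (9 * k)\<close>. The two values of
  \<open>k\<close> are prime to 3.\<close>

lemma Eu_cube_root_norm:
  assumes w: "w ^ 2 + w + 1 = 0" and k: "k = 1 \<or> k = 2"
  shows "Eu k * sc w (Eu k) * sc (w ^ 2) (Eu k) * Eu (9 * k) = Eu (3 * k) ^ 4"
proof -
  have w3: "w ^ 3 = 1" using w by (rule cube_root_of_unity)
  define d where "d i = (if k dvd i \<and> \<not> 3 dvd i then 1 else 0 :: complex)" for i
  define P where "P = eprod d"
  have "3 * k dvd i \<longleftrightarrow> k dvd i \<and> 3 dvd i" for i using k by (elim disjE; simp; presburger)
  moreover have "P * Eu (3 * k) = Eu k"
      if "\<And>i. 3 * k dvd i \<longleftrightarrow> k dvd i \<and> 3 dvd i"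
    proof -
      have "P * Eu (3 * k) = eprod (\<lambda>i. d i + (if 3 * k dvd i then 1 else 0))"
        unfolding P_def Eu_def by (rule eprod_mult_disjoint) (auto simp: d_def that)
      also have "\<dots> = Eu k"
        unfolding Eu_def by (rule eprod_cong) (auto simp: d_def that)
      finally show ?thesis .
    qed
  ultimately have P: "P * Eu (3 * k) = Eu k" by blast
  have Pw: "sc (w ^ j) P * Eu (3 * k) = sc (w ^ j) (Eu k)" for j
  proof -
    have "sc (w ^ j) (Eu (3 * k)) = Eu (3 * k)"
      by (rule sc_Eu_dvd) (metis mult.commute power_mult power_one w3)
    thus "sc (w ^ j) P * Eu (3 * k) = sc (w ^ j) (Eu k)"
      by (simp add: P[symmetric] sc_mult)
  qed
  have "P * sc w P * sc (w ^ 2) P = dil 3 P"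
  proof (rule eqX_imp_eq)
    fix n
    have "eqX (Suc n) (P * sc w P * sc (w ^ 2) P)
       ((\<Prod>i=1..n. 1 - fps_const (d i) * fps_X ^ i) * (\<Prod>i=1..n. 1 - fps_const (w ^ i * d i) * fps_X ^ i)
         * (\<Prod>i=1..n. 1 - fps_const ((w ^ 2) ^ i * d i) * fps_X ^ i))"
      unfolding P_def sc_eprod by (intro eqX_mult eqX_eprod) auto
    also have "(\<Prod>i=1..n. 1 - fps_const (d i) * fps_X ^ i) * (\<Prod>i=1..n. 1 - fps_const (w ^ i * d i) * fps_X ^ i)
         * (\<Prod>i=1..n. 1 - fps_const ((w ^ 2) ^ i * d i) * fps_X ^ i) =
        (\<Prod>i=1..n. 1 - fps_const (d i) * fps_X ^ (3 * i))"
      unfolding prod.distrib[symmetric]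
    proof (rule prod.cong)
      fix i
      show "(1 - fps_const (d i) * fps_X ^ i) * (1 - fps_const (w ^ i * d i) * fps_X ^ i)
         * (1 - fps_const ((w ^ 2) ^ i * d i) * fps_X ^ i) = 1 - fps_const (d i) * fps_X ^ (3 * i)"
      proof (cases "d i = 0")
        case False
        hence "\<not> 3 dvd i" and d1: "d i = 1" by (auto simp: d_def split: if_splits)
        then obtain j where j: "i = 3 * j + 1 \<or> i = 3 * j + 2"
          by (metis add_cancel_right_right dvd_def less_2_cases less_Suc_eq mod_less_divisor mult_div_mod_eq numeral_2_eq_2 numeral_3_eq_3 zero_less_Suc One_nat_def)
        define a where "a = w ^ i"
        have a: "a = w \<or> a = w ^ 2"
          using j by (auto simp: a_def power_add power_mult w3 power2_eq_square)
        have w4: "w ^ 4 = w" using w3 by (simp add: eval_nat_numeral)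
        have e: "1 + a + a ^ 2 = 0" "a * a ^ 2 = 1"
          using a w w3 w4 power_mult[of w 3 2]
          by (auto simp: algebra_simps simp flip: power_mult power_Suc)
        have a2: "(w ^ 2) ^ i = a ^ 2" by (simp add: a_def power_mult[symmetric] mult.commute)
        have c: "1 + fps_const a + fps_const (a ^ 2) = 0" "fps_const a * fps_const (a ^ 2) = 1"
          using e by (simp_all only: fps_const_1_eq_1[symmetric] fps_const_0_eq_0[symmetric] fps_const_add fps_const_mult)
        \<comment> \<open>The coefficients are written through \<open>1 + s + r\<close> and
          \<open>s * r\<close> so that rewriting with the two facts \<open>c\<close> leaves
          \<open>1 - z ^ 3\<close>.\<close>
        have "(1 - z) * (1 - s * z) * (1 - r * z) =
            1 - (1 + s + r) * z + (1 + s + r - 1 + s * r) * z ^ 2 - s * r * z ^ 3" for s r z :: "complex fps"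
          by (simp add: algebra_simps power2_eq_square power3_eq_cube)
        from this[where s = "fps_const a" and r = "fps_const (a ^ 2)" and z = "fps_X ^ i"]
        have "(1 - fps_X ^ i) * (1 - fps_const a * fps_X ^ i) * (1 - fps_const (a ^ 2) * fps_X ^ i) =
            1 - 0 * fps_X ^ i + (0 - 1 + 1) * (fps_X ^ i) ^ 2 - 1 * (fps_X ^ i) ^ 3"
          by (simp only: c)
        also have "\<dots> = 1 - fps_X ^ (3 * i)"
          by (simp only: power_mult[symmetric] mult.commute[of i 3]) simp
        finally show ?thesis
          by (simp only: d1 a2 a_def[symmetric] mult_1_right fps_const_1_eq_1 mult_1_left)
      qed simp
    qed simp
    also have "\<dots> = dil 3 (\<Prod>i=1..n. 1 - fps_const (d i) * fps_X ^ i)"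
      by (simp only: dil_prod[OF zero_less_numeral] dil_factor[OF zero_less_numeral])
    also have "eqX (Suc n) \<dots> (dil 3 P)"
      using eqX_eprod[of n n d] by (auto simp: eqX_iff dil_nth P_def elim!: dvdE)
    finally show "eqX (Suc n) (P * sc w P * sc (w ^ 2) P) (dil 3 P)" .
  qed
  moreover have "dil 3 P * Eu (9 * k) = Eu (3 * k)"
    using arg_cong[OF P, of "dil 3"] by (simp add: dil_mult)
  ultimately have "P * sc w P * sc (w ^ 2) P * Eu (9 * k) = Eu (3 * k)" by simp
  hence N: "(P * sc w P * sc (w ^ 2) P * Eu (9 * k)) * Eu (3 * k) ^ 3 = Eu (3 * k) ^ 4"
    by (simp only: power_Suc[symmetric]) simp
  have "Eu k * sc w (Eu k) * sc (w ^ 2) (Eu k) * Eu (9 * k) =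
     (P * Eu (3 * k)) * (sc w P * Eu (3 * k)) * (sc (w ^ 2) P * Eu (3 * k)) * Eu (9 * k)"
    using P Pw[of 1] Pw[of 2] by (simp only: power_one_right)
  also have "\<dots> = (P * sc w P * sc (w ^ 2) P * Eu (9 * k)) * Eu (3 * k) ^ 3"
    by (simp only: power3_eq_cube mult_ac)
  finally show ?thesis using N by (simp only:)
qed

section \<open>The triple product and theta functions\<close>

text \<open>Triangular numbers continued to negative \<open>j\<close>, where
  \<open>j (j + 1) / 2\<close> is still nonnegative. The exponents
  \<open>r j (j + 1) / 2 + s j (j - 1) / 2\<close> of the triple product thus become natural
  numbers.\<close>

definition tri :: "int \<Rightarrow> nat" where
  "tri j = nat (j * (j + 1) div 2)"

lemma two_tri: "2 * int (tri j) = j * (j + 1)"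
proof -
  have "even (j * (j + 1))" by simp
  moreover have "j * (j + 1) \<ge> 0"
    by (cases "j \<ge> 0") (auto intro: mult_nonneg_nonneg mult_nonpos_nonpos)
  ultimately show ?thesis by (auto simp: tri_def)
qed

lemma tri_step: "int (tri j) = int (tri (j - 1)) + j"
  using two_tri[of j] two_tri[of "j - 1"] by (simp add: algebra_simps)

lemma abs_le_tri_add: "nat \<bar>j\<bar> \<le> tri j + tri (j - 1)"
proof -
  have "2 * (int (tri j) + int (tri (j - 1))) = 2 * (j * j)"
    using two_tri[of j] two_tri[of "j - 1"] by (simp add: algebra_simps)
  moreover have "\<bar>j\<bar> \<le> j * j"
    by (metis abs_mult_self_eq abs_ge_zero int_one_le_iff_zero_less mult_le_cancel_right1 not_le zero_less_abs_iff abs_zero mult_zero_left order_refl)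
  ultimately show ?thesis unfolding nat_le_iff by simp
qed

definition qfac :: "nat \<Rightarrow> nat \<Rightarrow> complex fps" where
  "qfac m n = (\<Prod>i=1..n. 1 - fps_X ^ (m * i))"

text \<open>The reciprocal q-factorial, set to 0 at negative arguments: then the q-binomial
  coefficients vanish outside their range and \<open>qinv_step\<close> holds at 0 too, where the
  factor \<open>1 - q^0\<close> is 0.\<close>

definition qinv :: "nat \<Rightarrow> int \<Rightarrow> complex fps" where
  "qinv m k = (if k < 0 then 0 else inverse (qfac m (nat k)))"

lemma qfac_nth_0: "m > 0 \<Longrightarrow> qfac m n $ 0 = 1"
  unfolding qfac_def by (induction n) (auto simp: fps_X_power_nth)

lemma qfac_Suc: "qfac m (Suc n) = qfac m n * (1 - fps_X ^ (m * Suc n))"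
  by (simp add: qfac_def)

lemma qinv_step:
  assumes m: "m > 0"
  shows "qinv m (int n - 1) = (1 - fps_X ^ (m * n)) * qinv m (int n)"
proof (cases n)
  case (Suc k)
  have a: "qfac m (Suc k) * inverse (qfac m (Suc k)) = 1"
    using qfac_nth_0[OF m] by (simp add: inverse_mult_eq_1')
  have b: "inverse (qfac m k) * qfac m k = 1"
    using qfac_nth_0[OF m] by (simp add: inverse_mult_eq_1)
  have "inverse (qfac m k) = inverse (qfac m k) * (qfac m (Suc k) * inverse (qfac m (Suc k)))"
    by (simp only: a mult_1_right)
  also have "\<dots> = (inverse (qfac m k) * qfac m k) * ((1 - fps_X ^ (m * Suc k)) * inverse (qfac m (Suc k)))"
    by (simp only: qfac_Suc mult_ac)
  finally show ?thesis by (simp only: b mult_1_left) (simp add: Suc qinv_def nat_add_distrib)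
qed (simp add: qinv_def)

lemma qinv_step2:
  assumes m: "m > 0"
  shows "qinv m (int n - 2) = (1 - fps_X ^ (m * (n - 1))) * ((1 - fps_X ^ (m * n)) * qinv m (int n))"
proof (cases n)
  case (Suc k)
  thus ?thesis using qinv_step[OF m, of k] qinv_step[OF m, of n] by simp
qed (simp add: qinv_def)

lemma sum_int_shift:
  fixes F :: "int \<Rightarrow> 'b :: comm_monoid_add"
  assumes "finite J" "\<And>j. F j \<noteq> 0 \<Longrightarrow> j \<in> S" "\<And>j. j \<in> S \<Longrightarrow> j - d \<in> J"
  shows "sum F S = (\<Sum>j\<in>J. F (j + d))"
proof -
  have "S \<subseteq> (\<lambda>j. j + d) ` J"
  proof
    fix j assume "j \<in> S"
    hence "j = (j - d) + d" "j - d \<in> J" using assms(3) by auto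
    thus "j \<in> (\<lambda>j. j + d) ` J" by (rule image_eqI)
  qed
  hence "sum F S = sum F ((\<lambda>j. j + d) ` J)"
    using assms(1,2) by (intro sum.mono_neutral_left) auto
  also have "\<dots> = (\<Sum>j\<in>J. F (j + d))" by (subst sum.reindex) (auto simp: inj_on_def)
  finally show ?thesis .
qed

text \<open>The coefficients are the q-binomials \<open>[2N choose N + j]\<close> in
  \<open>q^m\<close>, and the induction is a q-Pascal rule. The factor \<open>w j\<close> stands for
  \<open>a^j q^(m j (j - 1) / 2)\<close>; since \<open>a\<close> need not be invertible as a power
  series, negative \<open>j\<close> are reached through \<open>b\<close>, and \<open>w\<close> is
  described only by the relations \<open>up\<close> and \<open>dn\<close> between
  neighbours.\<close>

lemma finite_triple_product:
  fixes w :: "int \<Rightarrow> complex fps"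
  assumes m: "m > 0" and ab: "a * b = fps_X ^ m" and w0: "w 0 = 1"
    and up: "\<And>j N. j \<le> int N + 1 \<Longrightarrow> a * fps_X ^ (m * N) * w (j - 1) = fps_X ^ (m * nat (int N + 1 - j)) * w j"
    and dn: "\<And>j N. - j \<le> int N + 1 \<Longrightarrow> b * fps_X ^ (m * N) * w (j + 1) = fps_X ^ (m * nat (int N + 1 + j)) * w j"
  shows "(\<Prod>i<N. (1 + a * fps_X ^ (m * i)) * (1 + b * fps_X ^ (m * i))) =
     (\<Sum>j=-int N..int N. qfac m (2 * N) * qinv m (int N - j) * qinv m (int N + j) * w j)"
proof (induction N)
  case 0
  show ?case by (simp add: qinv_def qfac_def w0)
next
  case (Suc N)
  define c where "c N j = qfac m (2 * N) * qinv m (int N - j) * qinv m (int N + j)" for N j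
  define J where "J = {- int N - 1..int N + 1}"
  define y where "y = (fps_X :: complex fps) ^ (m * (2 * N + 1))"
  have rec: "c (Suc N) j = (1 + y) * c N j + fps_X ^ (m * nat (int N + 1 - j)) * c N (j - 1)
       + fps_X ^ (m * nat (int N + 1 + j)) * c N (j + 1)" if "j \<in> J" for j
  proof -
    define al where "al = nat (int N + 1 - j)"
    define be where "be = nat (int N + 1 + j)"
    have ab': "int al = int N + 1 - j" "int be = int N + 1 + j" "al + be = 2 * N + 2"
      using that by (auto simp: al_def be_def J_def)
    define u u' v v' where "u = (fps_X :: complex fps) ^ (m * al)" and "u' = (fps_X :: complex fps) ^ (m * (al - 1))"
      and "v = (fps_X :: complex fps) ^ (m * be)" and "v' = (fps_X :: complex fps) ^ (m * (be - 1))"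
    define p q where "p = qinv m (int al)" and "q = qinv m (int be)"
    \<comment> \<open>The factor \<open>1 - v\<close> must stay: for \<open>be = 0\<close> the
      truncated exponent \<open>be - 1\<close> gives the wrong power, but then
      \<open>1 - v = 0\<close>. The same holds for \<open>al\<close> below.\<close>
    have 1: "(1 - v) * (u * v') = (1 - v) * y"
    proof (cases be)
      case (Suc k)
      have "al + k = 2 * N + 1" using ab'(3) Suc by simp
      hence "m * al + m * k = m * (2 * N + 1)" by (simp only: distrib_left[symmetric])
      thus ?thesis by (simp add: u_def v'_def y_def Suc power_add[symmetric])
    qed (simp add: v_def)
    have 2: "(1 - u) * (v * u') = (1 - u) * y"
    proof (cases al)
      case (Suc k)
      have "be + k = 2 * N + 1" using ab'(3) Suc by simp
      hence "m * be + m * k = m * (2 * N + 1)" by (simp only: distrib_left[symmetric])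
      thus ?thesis by (simp add: v_def u'_def y_def Suc power_add[symmetric])
    qed (simp add: u_def)
    have 3: "fps_X ^ (m * (2 * N + 2)) = u * v"
      by (simp only: u_def v_def power_add[symmetric] ab'(3)[symmetric] distrib_left)
    have q2: "qfac m (2 * Suc N) = qfac m (2 * N) * (1 - y) * (1 - u * v)"
      using qfac_Suc[of m "2 * N"] qfac_Suc[of m "Suc (2 * N)"] by (simp add: y_def 3[symmetric])
    have sh: "int N - j = int al - 1" "int N + j = int be - 1" "int N - (j + 1) = int al - 2"
      "int N + (j - 1) = int be - 2" "int N - (j - 1) = int al" "int N + (j + 1) = int be"
      "int (Suc N) - j = int al" "int (Suc N) + j = int be"
      using ab' by simp_all
    have i1: "qinv m (int N - j) = (1 - u) * p" "qinv m (int N + j) = (1 - v) * q"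
      using qinv_step[OF m, of al] qinv_step[OF m, of be] by (simp_all only: u_def v_def p_def q_def sh)
    have i2: "qinv m (int N - (j + 1)) = (1 - u') * ((1 - u) * p)" "qinv m (int N + (j - 1)) = (1 - v') * ((1 - v) * q)"
      using qinv_step2[OF m, of al] qinv_step2[OF m, of be]
      by (simp_all only: u_def v_def u'_def v'_def p_def q_def sh)
    have i3: "qinv m (int N - (j - 1)) = p" "qinv m (int N + (j + 1)) = q"
      "qinv m (int (Suc N) - j) = p" "qinv m (int (Suc N) + j) = q"
      by (simp_all only: p_def q_def sh)
    have "(1 - y) * (1 - u * v) = (1 + y) * ((1 - u) * (1 - v)) + (u * (1 - v) - (1 - v) * y) + (v * (1 - u) - (1 - u) * y)"
      by (simp add: algebra_simps)
    also have "\<dots> = (1 + y) * ((1 - u) * (1 - v)) + u * ((1 - v') * (1 - v)) + v * ((1 - u') * (1 - u))"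
      by (simp only: 1[symmetric] 2[symmetric]) (simp add: algebra_simps)
    finally have main: "(1 - y) * (1 - u * v) = \<dots>" .
    have "c (Suc N) j = qfac m (2 * N) * ((1 - y) * (1 - u * v)) * p * q"
      unfolding c_def q2 i3 by (simp only: mult_ac)
    also have "\<dots> = (1 + y) * (qfac m (2 * N) * ((1 - u) * p) * ((1 - v) * q))
       + u * (qfac m (2 * N) * p * ((1 - v') * ((1 - v) * q)))
       + v * (qfac m (2 * N) * ((1 - u') * ((1 - u) * p)) * q)"
      by (simp only: main distrib_left distrib_right mult_ac)
    finally show ?thesis
      unfolding c_def i1 i2 i3(1,2) al_def[symmetric] be_def[symmetric] u_def[symmetric] v_def[symmetric] .
  qed
  have c0: "c N j = 0" if "j < - int N \<or> j > int N" for j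
    using that by (auto simp: c_def qinv_def)
  have "(\<Prod>i<Suc N. (1 + a * fps_X ^ (m * i)) * (1 + b * fps_X ^ (m * i))) =
     (\<Sum>j=-int N..int N. c N j * w j) * ((1 + a * fps_X ^ (m * N)) * (1 + b * fps_X ^ (m * N)))"
    using Suc by (simp add: c_def)
  also have "(1 + a * fps_X ^ (m * N)) * (1 + b * fps_X ^ (m * N)) =
     (1 + (a * b) * fps_X ^ (m * N + m * N)) + a * fps_X ^ (m * N) + b * fps_X ^ (m * N)"
    by (simp add: algebra_simps power_add)
  also have "(a * b) * fps_X ^ (m * N + m * N) = y"
    by (simp add: ab y_def algebra_simps power_add[symmetric])
  also have "(\<Sum>j=-int N..int N. c N j * w j) * ((1 + y) + a * fps_X ^ (m * N) + b * fps_X ^ (m * N)) =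
     (\<Sum>j=-int N..int N. (1 + y) * c N j * w j) + (\<Sum>j=-int N..int N. c N j * (a * fps_X ^ (m * N) * w j))
      + (\<Sum>j=-int N..int N. c N j * (b * fps_X ^ (m * N) * w j))"
    unfolding sum.distrib[symmetric] sum_distrib_right
    by (intro sum.cong refl) (simp only: distrib_left distrib_right mult_1_left mult_1_right mult_ac add_ac)
  also have "(\<Sum>j=-int N..int N. (1 + y) * c N j * w j) = (\<Sum>j\<in>J. (1 + y) * c N j * w j)"
    by (rule sum.mono_neutral_left) (auto simp: J_def c0)
  also have "(\<Sum>j=-int N..int N. c N j * (a * fps_X ^ (m * N) * w j)) =
     (\<Sum>j\<in>J. c N (j - 1) * (a * fps_X ^ (m * N) * w (j - 1)))"
    using sum_int_shift[of J "\<lambda>j. c N j * (a * fps_X ^ (m * N) * w j)" "{- int N..int N}" "-1"]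
    by (simp add: J_def) (meson c0 not_le)
  also have "\<dots> = (\<Sum>j\<in>J. fps_X ^ (m * nat (int N + 1 - j)) * c N (j - 1) * w j)"
  proof (intro sum.cong refl, goal_cases)
    case (1 j)
    show ?case by (subst up) (use 1 in \<open>auto simp: J_def mult_ac\<close>)
  qed
  also have "(\<Sum>j=-int N..int N. c N j * (b * fps_X ^ (m * N) * w j)) =
     (\<Sum>j\<in>J. c N (j + 1) * (b * fps_X ^ (m * N) * w (j + 1)))"
    using sum_int_shift[of J "\<lambda>j. c N j * (b * fps_X ^ (m * N) * w j)" "{- int N..int N}" "1"]
    by (simp add: J_def) (meson c0 not_le)
  also have "\<dots> = (\<Sum>j\<in>J. fps_X ^ (m * nat (int N + 1 + j)) * c N (j + 1) * w j)"
  proof (intro sum.cong refl, goal_cases)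
    case (1 j)
    show ?case by (subst dn) (use 1 in \<open>auto simp: J_def mult_ac\<close>)
  qed
  also have "(\<Sum>j\<in>J. (1 + y) * c N j * w j) + (\<Sum>j\<in>J. fps_X ^ (m * nat (int N + 1 - j)) * c N (j - 1) * w j)
      + (\<Sum>j\<in>J. fps_X ^ (m * nat (int N + 1 + j)) * c N (j + 1) * w j) = (\<Sum>j\<in>J. c (Suc N) j * w j)"
    unfolding sum.distrib[symmetric] by (intro sum.cong refl) (simp only: rec distrib_right)
  finally have "(\<Prod>i<Suc N. (1 + a * fps_X ^ (m * i)) * (1 + b * fps_X ^ (m * i))) = (\<Sum>j\<in>J. c (Suc N) j * w j)" .
  moreover have "J = {- int (Suc N)..int (Suc N)}" by (auto simp: J_def)
  ultimately show ?case by (simp only: c_def)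
qed

lemma eqX_dil: "m > 0 \<Longrightarrow> eqX n f g \<Longrightarrow> eqX n (dil m f) (dil m g)"
  by (auto simp: eqX_iff dil_nth) (metis div_le_dividend le_less_trans)

lemma eqX_qfac:
  assumes m: "m > 0" and "n \<le> N"
  shows "eqX (Suc n) (qfac m N) (Eu m)"
proof -
  have "eqX (Suc n) (Eu 1) (\<Prod>i=1..N. 1 - fps_const 1 * fps_X ^ i)"
    using eqX_eprod[OF assms(2), of "\<lambda>_. 1"] by (simp add: Eu_def)
  hence "eqX (Suc n) (dil m (Eu 1)) (dil m (\<Prod>i=1..N. 1 - fps_const 1 * fps_X ^ i))"
    by (rule eqX_dil[OF m])
  moreover have "dil m (\<Prod>i=1..N. 1 - fps_const 1 * fps_X ^ i) = qfac m N"
    by (simp only: dil_prod[OF m] dil_factor[OF m] qfac_def) simp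
  ultimately show ?thesis using m by (simp add: eqX_sym)
qed

text \<open>All q-factorials involved agree with \<open>Eu m\<close> at least up to order
  \<open>N - |j|\<close>, so the q-binomial tends to \<open>1 / Eu m\<close>. The order is recorded
  because in the triple product the error is shifted by \<open>q^(e j)\<close> with
  \<open>e j\<close> at least \<open>|j|\<close>, which restores the full order
  \<open>N\<close>.\<close>

lemma eqX_binomial_limit:
  assumes m: "m > 0" and j: "\<bar>j\<bar> \<le> int N"
  shows "eqX (Suc (nat (int N - \<bar>j\<bar>))) (Eu m * (qfac m (2 * N) * qinv m (int N - j) * qinv m (int N + j))) 1"
proof -
  define k where "k = nat (int N - \<bar>j\<bar>)"
  define p q where "p = qfac m (nat (int N - j))" and "q = qfac m (nat (int N + j))"
  have i: "inverse p * p = 1" "inverse q * q = 1"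
    using qfac_nth_0[OF m] by (auto simp: p_def q_def inverse_mult_eq_1)
  have g: "qinv m (int N - j) = inverse p" "qinv m (int N + j) = inverse q"
    using j by (auto simp: qinv_def p_def q_def)
  have "eqX (Suc k) (Eu m * qfac m (2 * N)) (Eu m * Eu m)"
    by (intro eqX_mult eqX_refl eqX_qfac m) (use j in \<open>auto simp: k_def\<close>)
  also have "eqX (Suc k) (Eu m * Eu m) (p * q)"
    unfolding p_def q_def by (intro eqX_mult eqX_sym[OF eqX_qfac] m) (use j in \<open>auto simp: k_def\<close>)
  finally have "eqX (Suc k) (Eu m * qfac m (2 * N)) (p * q)" .
  moreover have "(Eu m * (qfac m (2 * N) * inverse p * inverse q)) * (p * q) =
      (Eu m * qfac m (2 * N)) * (inverse p * p) * (inverse q * q)"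
    by (simp only: mult_ac)
  ultimately have "eqX (Suc k) ((Eu m * (qfac m (2 * N) * inverse p * inverse q)) * (p * q)) (1 * (p * q))"
    by (simp only: i mult_1_left mult_1_right)
  hence "eqX (Suc k) (Eu m * (qfac m (2 * N) * inverse p * inverse q)) 1"
    by (rule eqX_cancel) (simp add: p_def q_def qfac_nth_0[OF m])
  thus ?thesis by (simp only: g k_def)
qed

text \<open>The series of the terms \<open>\<sigma> j * q ^ e j\<close> over all integers
  \<open>j\<close>. A sum over an infinite set is 0 by convention, so this is meaningful only if
  every fibre of \<open>e\<close> is finite.\<close>

definition theta :: "(int \<Rightarrow> nat) \<Rightarrow> (int \<Rightarrow> complex) \<Rightarrow> complex fps" where
  "theta e \<sigma> = Abs_fps (\<lambda>n. \<Sum>j | e j = n. \<sigma> j)"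

lemma eqX_theta:
  assumes e: "\<And>j. nat \<bar>j\<bar> \<le> e j"
  shows "eqX (Suc N) (theta e \<sigma>) (\<Sum>j=-int N..int N. fps_const (\<sigma> j) * fps_X ^ e j)"
  unfolding eqX_iff
proof safe
  fix n assume n: "n < Suc N"
  have "(\<Sum>j=-int N..int N. fps_const (\<sigma> j) * fps_X ^ e j) $ n = (\<Sum>j=-int N..int N. if e j = n then \<sigma> j else 0)"
    unfolding fps_sum_nth by (intro sum.cong) (auto simp: fps_X_power_nth)
  also have "\<dots> = (\<Sum>j\<in>{j \<in> {-int N..int N}. e j = n}. \<sigma> j)"
    by (subst sum.inter_filter) auto
  also have "{j \<in> {-int N..int N}. e j = n} = {j. e j = n}"
  proof safe
    fix j assume "n = e j"
    thus "j \<in> {-int N..int N}" using e[of j] n by auto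
  qed
  finally show "theta e \<sigma> $ n = (\<Sum>j=-int N..int N. fps_const (\<sigma> j) * fps_X ^ e j) $ n"
    by (simp add: theta_def)
qed

lemma eqX_residue_product:
  assumes "0 < r" "r < m"
  shows "eqX (Suc N) (eprod (\<lambda>i. if i mod m = r then - d else 0)) (\<Prod>i<N. 1 + fps_const d * fps_X ^ r * fps_X ^ (m * i))"
proof -
  have "eqX (Suc N) (eprod (\<lambda>i. if i mod m = r then - d else 0))
      (\<Prod>i=1..m * N. 1 - fps_const (if i mod m = r then - d else 0) * fps_X ^ i)"
    using assms by (intro eqX_eprod) auto
  also have "(\<Prod>i=1..m * N. 1 - fps_const (if i mod m = r then - d else 0) * fps_X ^ i) =
      (\<Prod>i\<in>{i\<in>{1..m * N}. i mod m = r}. 1 + fps_const d * fps_X ^ i)"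
    by (rule prod.mono_neutral_cong_right) (auto simp flip: fps_const_neg)
  also have "\<dots> = (\<Prod>i<N. 1 + fps_const d * fps_X ^ r * fps_X ^ (m * i))"
  proof (rule prod.reindex_bij_witness[of _ "\<lambda>i. m * i + r" "\<lambda>i. i div m"])
    fix i assume i: "i \<in> {i \<in> {1..m * N}. i mod m = r}"
    show "m * (i div m) + r = i" using i mult_div_mod_eq[of m i] by auto
    have "i \<noteq> m * N" using i assms by auto
    hence "i < N * m" using i by (auto simp: mult.commute)
    thus "i div m \<in> {..<N}" using assms by (simp add: div_less_iff_less_mult)
    show "1 + fps_const d * fps_X ^ r * fps_X ^ (m * (i div m)) = 1 + fps_const d * fps_X ^ i"
      using i mult_div_mod_eq[of m i] by (auto simp: mult.assoc power_add[symmetric] add.commute)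
  next
    fix i assume i: "i \<in> {..<N}"
    show "(m * i + r) div m = i" using assms by simp
    have "m * i + r \<le> m * Suc i" using assms by simp
    also have "\<dots> \<le> m * N" using i by (intro mult_le_mono2) auto
    finally show "m * i + r \<in> {i \<in> {1..m * N}. i mod m = r}" using assms by auto
  qed
  finally show ?thesis .
qed

text \<open>Jacobi's identity for \<open>a = \<delta> q^r\<close> and
  \<open>b = \<delta> q^s\<close>, the limit of \<open>finite_triple_product\<close>. With
  \<open>\<delta> ^ 2 = 1\<close> the sign \<open>\<delta>^j\<close> depends only on
  \<open>|j|\<close>. The residue classes \<open>r\<close> and \<open>s\<close> stay separate
  factors, so that \<open>r = s\<close>, where they coincide, is covered.\<close>

theorem triple_product:
  fixes \<delta> :: complex
  assumes r: "r > 0" and s: "s > 0" and m_def: "m = r + s" and \<delta>: "\<delta> ^ 2 = 1"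
  shows "theta (\<lambda>j. r * tri j + s * tri (j - 1)) (\<lambda>j. \<delta> ^ nat \<bar>j\<bar>) =
     eprod (\<lambda>i. if i mod m = r then - \<delta> else 0) * eprod (\<lambda>i. if i mod m = s then - \<delta> else 0) * Eu m"
proof (rule eqX_imp_eq)
  fix N
  define e where "e j = r * tri j + s * tri (j - 1)" for j
  define w where "w j = fps_const (\<delta> ^ nat \<bar>j\<bar>) * fps_X ^ e j" for j
  have m: "m > 0" using r by (simp add: m_def)
  have e: "nat \<bar>j\<bar> \<le> e j" for j
  proof -
    have "tri j + tri (j - 1) \<le> e j" unfolding e_def using r s by (intro add_mono) auto
    thus ?thesis using abs_le_tri_add[of j] by linarith
  qed
  have \<delta>_shift: "\<delta> * \<delta> ^ nat \<bar>i\<bar> = \<delta> ^ nat \<bar>j\<bar>" if "i = j - 1 \<or> i = j + 1" for i j :: int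
  proof -
    have "nat \<bar>j\<bar> = Suc (nat \<bar>i\<bar>) \<or> nat \<bar>i\<bar> = Suc (nat \<bar>j\<bar>)" using that by linarith
    moreover have "\<delta> * \<delta> = 1" using \<delta> by (simp add: power2_eq_square)
    ultimately show ?thesis by (auto simp flip: mult.assoc)
  qed
  have fp: "(\<Prod>i<N. (1 + fps_const \<delta> * fps_X ^ r * fps_X ^ (m * i)) * (1 + fps_const \<delta> * fps_X ^ s * fps_X ^ (m * i))) =
     (\<Sum>j=-int N..int N. qfac m (2 * N) * qinv m (int N - j) * qinv m (int N + j) * w j)" for N
  proof (rule finite_triple_product[OF m])
    show "fps_const \<delta> * fps_X ^ r * (fps_const \<delta> * fps_X ^ s) = fps_X ^ m"
    proof -
      have "fps_const \<delta> * fps_const \<delta> = 1" using \<delta> by (simp add: power2_eq_square)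
      hence "(fps_const \<delta> * fps_const \<delta>) * (fps_X ^ r * fps_X ^ s) = fps_X ^ m"
        by (simp only: m_def power_add mult_1_left)
      thus ?thesis by (simp only: mult_ac)
    qed
    show "w 0 = 1" by (simp add: w_def e_def tri_def)
  next
    fix j :: int and N :: nat assume j: "j \<le> int N + 1"
    have t: "int (tri (j - 1)) = int (tri (j - 2)) + j - 1" "int (tri j) = int (tri (j - 2)) + 2 * j - 1"
      using tri_step[of j] tri_step[of "j - 1"] by simp_all
    have "int (r + m * N + e (j - 1)) = int (m * nat (int N + 1 - j) + e j)"
      using j by (simp add: m_def e_def algebra_simps t)
    hence E: "r + m * N + e (j - 1) = m * nat (int N + 1 - j) + e j" by linarith
    have "fps_const \<delta> * fps_X ^ r * fps_X ^ (m * N) * w (j - 1) =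
       (fps_const \<delta> * fps_const (\<delta> ^ nat \<bar>j - 1\<bar>)) * fps_X ^ (r + m * N + e (j - 1))"
      by (simp only: w_def power_add mult_ac)
    also have "\<dots> = fps_X ^ (m * nat (int N + 1 - j)) * w j"
      unfolding E by (simp only: w_def power_add mult_ac fps_const_mult \<delta>_shift[OF disjI1[OF refl]])
    finally show "fps_const \<delta> * fps_X ^ r * fps_X ^ (m * N) * w (j - 1) = fps_X ^ (m * nat (int N + 1 - j)) * w j" .
  next
    fix j :: int and N :: nat assume j: "- j \<le> int N + 1"
    have t: "int (tri j) = int (tri (j - 1)) + j" "int (tri (1 + j)) = int (tri (j - 1)) + 2 * j + 1"
      using tri_step[of j] tri_step[of "1 + j"] by simp_all
    have "int (s + m * N + e (j + 1)) = int (m * nat (int N + 1 + j) + e j)"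
      using j by (simp add: m_def e_def algebra_simps t)
    hence E: "s + m * N + e (j + 1) = m * nat (int N + 1 + j) + e j" by linarith
    have "fps_const \<delta> * fps_X ^ s * fps_X ^ (m * N) * w (j + 1) =
       (fps_const \<delta> * fps_const (\<delta> ^ nat \<bar>j + 1\<bar>)) * fps_X ^ (s + m * N + e (j + 1))"
      by (simp only: w_def power_add mult_ac)
    also have "\<dots> = fps_X ^ (m * nat (int N + 1 + j)) * w j"
      unfolding E by (simp only: w_def power_add mult_ac fps_const_mult \<delta>_shift[OF disjI2[OF refl]])
    finally show "fps_const \<delta> * fps_X ^ s * fps_X ^ (m * N) * w (j + 1) = fps_X ^ (m * nat (int N + 1 + j)) * w j" .
  qed
  have "eqX (Suc N) (eprod (\<lambda>i. if i mod m = r then - \<delta> else 0) * eprod (\<lambda>i. if i mod m = s then - \<delta> else 0) * Eu m)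
     ((\<Prod>i<N. 1 + fps_const \<delta> * fps_X ^ r * fps_X ^ (m * i)) * (\<Prod>i<N. 1 + fps_const \<delta> * fps_X ^ s * fps_X ^ (m * i)) * Eu m)"
    using r s by (intro eqX_mult eqX_residue_product eqX_refl) (auto simp: m_def)
  also have "(\<Prod>i<N. 1 + fps_const \<delta> * fps_X ^ r * fps_X ^ (m * i)) * (\<Prod>i<N. 1 + fps_const \<delta> * fps_X ^ s * fps_X ^ (m * i)) * Eu m =
     (\<Sum>j=-int N..int N. fps_const (\<delta> ^ nat \<bar>j\<bar>) * (fps_X ^ e j *
        (Eu m * (qfac m (2 * N) * qinv m (int N - j) * qinv m (int N + j)))))"
    unfolding prod.distrib[symmetric] fp sum_distrib_right w_def by (intro sum.cong refl) (simp only: mult_ac)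
  also have "eqX (Suc N) \<dots> (\<Sum>j=-int N..int N. fps_const (\<delta> ^ nat \<bar>j\<bar>) * (fps_X ^ e j * 1))"
  proof (rule eqX_sum, rule eqX_mult[OF eqX_refl])
    fix j assume j: "j \<in> {- int N..int N}"
    hence "\<bar>j\<bar> \<le> int N" by auto
    from eqX_power_mult[OF eqX_binomial_limit[OF m this], of "e j"]
    show "eqX (Suc N) (fps_X ^ e j * (Eu m * (qfac m (2 * N) * qinv m (int N - j) * qinv m (int N + j)))) (fps_X ^ e j * 1)"
      by (rule eqX_mono) (use e[of j] j in auto)
  qed
  also have "(\<Sum>j=-int N..int N. fps_const (\<delta> ^ nat \<bar>j\<bar>) * (fps_X ^ e j * 1)) =
      (\<Sum>j=-int N..int N. fps_const (\<delta> ^ nat \<bar>j\<bar>) * fps_X ^ e j)" by simp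
  also have "eqX (Suc N) \<dots> (theta e (\<lambda>j. \<delta> ^ nat \<bar>j\<bar>))"
    by (rule eqX_sym[OF eqX_theta[OF e]])
  finally show "eqX (Suc N) (theta (\<lambda>j. r * tri j + s * tri (j - 1)) (\<lambda>j. \<delta> ^ nat \<bar>j\<bar>))
     (eprod (\<lambda>i. if i mod m = r then - \<delta> else 0) * eprod (\<lambda>i. if i mod m = s then - \<delta> else 0) * Eu m)"
    unfolding e_def by (rule eqX_sym)
qed

text \<open>The exponents of \<open>\<psi>\<close> are \<open>2 j\<^sup>2 - j\<close>, which run through the triangular numbers once as \<open>j\<close>
  runs through the integers.  The factors \<open>1\<close> match the left-hand side of \<open>triple_product\<close>.\<close>
definition \<phi> :: "complex fps" where "\<phi> = theta (\<lambda>j. 1 * tri j + 1 * tri (j - 1)) (\<lambda>j. 1 ^ nat \<bar>j\<bar>)"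
definition \<phi>m :: "complex fps" where "\<phi>m = theta (\<lambda>j. 1 * tri j + 1 * tri (j - 1)) (\<lambda>j. (-1) ^ nat \<bar>j\<bar>)"
definition \<psi> :: "complex fps" where "\<psi> = theta (\<lambda>j. 1 * tri j + 3 * tri (j - 1)) (\<lambda>j. 1 ^ nat \<bar>j\<bar>)"
text \<open>The exponents of \<open>\<alpha>\<close> are \<open>(3 j^2 - j) / 2\<close>, those of
  \<open>\<omega>\<close> are \<open>3 j^2 - 2 j\<close>. These two series are the new pieces in the
  dissections of \<open>\<psi>\<close> and \<open>\<phi>m\<close> modulo 3.\<close>

definition \<alpha> :: "complex fps" where "\<alpha> = theta (\<lambda>j. 1 * tri j + 2 * tri (j - 1)) (\<lambda>j. 1 ^ nat \<bar>j\<bar>)"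
definition \<omega> :: "complex fps" where "\<omega> = theta (\<lambda>j. 1 * tri j + 5 * tri (j - 1)) (\<lambda>j. (-1) ^ nat \<bar>j\<bar>)"

definition odd_prod :: "complex fps" where
  "odd_prod = eprod (\<lambda>i. if 2 dvd i then 0 else 1)"
definition odd_prod' :: "complex fps" where
  "odd_prod' = eprod (\<lambda>i. - (if 2 dvd i then 0 else 1))"

lemma odd_prod: "odd_prod * Eu 2 = Eu 1"
  unfolding odd_prod_def by (rule eprod_mod_times_Eu)

lemma odd_prod': "odd_prod' * (Eu 1 * Eu 4) = Eu 2 ^ 2"
proof -
  have "odd_prod * odd_prod' = dil 2 odd_prod"
    unfolding odd_prod_def odd_prod'_def eprod_mult_uminus
    by (intro arg_cong[of _ _ "dil 2"] eprod_cong) simp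
  moreover have "dil 2 odd_prod * Eu 4 = Eu 2"
    using arg_cong[OF odd_prod, of "dil 2"] by (simp add: dil_mult)
  ultimately have "odd_prod * odd_prod' * Eu 4 * Eu 2 = Eu 2 ^ 2"
    by (simp add: power2_eq_square)
  thus ?thesis by (simp only: odd_prod[symmetric] mult_ac)
qed

lemma phi_odd_prod: "\<phi> = odd_prod' ^ 2 * Eu 2"
proof -
  have "eprod (\<lambda>i. if i mod 2 = 1 then - 1 else 0) = odd_prod'"
    unfolding odd_prod'_def by (rule eprod_cong) (simp add: odd_iff_mod_2_eq_one)
  with triple_product[of 1 1 2 1] show ?thesis by (simp add: \<phi>_def power2_eq_square)
qed

lemma phi_prod: "\<phi> * (Eu 1 ^ 2 * Eu 4 ^ 2) = Eu 2 ^ 5"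
proof -
  have "\<phi> * (Eu 1 ^ 2 * Eu 4 ^ 2) = (odd_prod' * (Eu 1 * Eu 4)) ^ 2 * Eu 2"
    unfolding phi_odd_prod by (simp only: power_mult_distrib mult_ac)
  also have "\<dots> = Eu 2 ^ 5" unfolding odd_prod' by (simp flip: power_mult power_Suc2)
  finally show ?thesis .
qed

lemma phim_prod: "\<phi>m * Eu 2 = Eu 1 ^ 2"
proof -
  have "eprod (\<lambda>i. if i mod 2 = 1 then - (- 1) else 0) = odd_prod"
    unfolding odd_prod_def by (rule eprod_cong) (simp add: odd_iff_mod_2_eq_one)
  with triple_product[of 1 1 2 "-1"] have p: "\<phi>m = odd_prod ^ 2 * Eu 2" by (simp add: \<phi>m_def power2_eq_square)
  show ?thesis unfolding p odd_prod[symmetric] by (simp only: power2_eq_square mult_ac)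
qed

lemma psi_prod: "\<psi> * Eu 1 = Eu 2 ^ 2"
proof -
  have "eprod (\<lambda>i. if i mod 4 = 1 then - 1 else 0) * eprod (\<lambda>i. if i mod 4 = 3 then - 1 else 0) =
     eprod (\<lambda>i. (if i mod 4 = 1 then - 1 else 0) + (if i mod 4 = 3 then - 1 else 0))"
    by (rule eprod_mult_disjoint) simp
  also have "\<dots> = odd_prod'"
    unfolding odd_prod'_def by (rule eprod_cong) (auto; presburger)
  finally have "\<psi> = odd_prod' * Eu 4"
    using triple_product[of 1 3 4 1] by (simp add: \<psi>_def)
  hence "\<psi> * Eu 1 = odd_prod' * (Eu 1 * Eu 4)" by (simp add: mult_ac)
  thus ?thesis by (simp only: odd_prod')
qed

lemma alpha_prod: "\<alpha> * (Eu 1 * Eu 6) = Eu 2 * Eu 3 ^ 2"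
proof -
  define T where "T = eprod (\<lambda>i. if 3 dvd i then 0 else 1 :: complex)"
  define U where "U = eprod (\<lambda>i. - (if 3 dvd i then 0 else 1 :: complex))"
  have T: "T * Eu 3 = Eu 1" unfolding T_def by (rule eprod_mod_times_Eu)
  have T2: "dil 2 T * Eu 6 = Eu 2" using arg_cong[OF T, of "dil 2"] by (simp add: dil_mult)
  have TU: "T * U = dil 2 T"
    unfolding T_def U_def eprod_mult_uminus by (intro arg_cong[of _ _ "dil 2"] eprod_cong) simp
  have "eprod (\<lambda>i. if i mod 3 = 1 then - 1 else 0) * eprod (\<lambda>i. if i mod 3 = 2 then - 1 else 0) =
     eprod (\<lambda>i. (if i mod 3 = 1 then - 1 else 0) + (if i mod 3 = 2 then - 1 else 0))"
    by (rule eprod_mult_disjoint) simp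
  also have "\<dots> = U"
    unfolding U_def by (rule eprod_cong) (auto; presburger)
  finally have al: "\<alpha> = U * Eu 3"
    using triple_product[of 1 2 3 1] by (simp add: \<alpha>_def)
  have "\<alpha> * (Eu 1 * Eu 6) = (T * U) * Eu 6 * Eu 3 ^ 2"
    unfolding al T[symmetric] by (simp only: power2_eq_square mult_ac)
  thus ?thesis by (simp only: TU T2)
qed

lemma omega_prod: "\<omega> * (Eu 2 * Eu 3) = Eu 1 * Eu 6 ^ 2"
proof -
  define U where "U = eprod (\<lambda>i. if 2 dvd i \<or> 3 dvd i then 0 else 1 :: complex)"
  have O3: "dil 3 odd_prod * Eu 6 = Eu 3" using arg_cong[OF odd_prod, of "dil 3"] by (simp add: dil_mult)
  have "U * dil 3 odd_prod = eprod (\<lambda>i. (if 2 dvd i \<or> 3 dvd i then 0 else 1) + (if 3 dvd i then (if 2 dvd i div 3 then 0 else 1) else 0))"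
    unfolding U_def odd_prod_def dil_eprod[OF zero_less_numeral] by (rule eprod_mult_disjoint) simp
  also have "\<dots> = odd_prod" unfolding odd_prod_def by (rule eprod_cong) (auto; presburger)
  finally have UO: "U * dil 3 odd_prod = odd_prod" .
  have "eprod (\<lambda>i. if i mod 6 = 1 then - (- 1) else 0) * eprod (\<lambda>i. if i mod 6 = 5 then - (- 1) else 0) =
     eprod (\<lambda>i. (if i mod 6 = 1 then - (- 1) else 0) + (if i mod 6 = 5 then - (- 1) else 0))"
    by (rule eprod_mult_disjoint) simp
  also have "\<dots> = U"
    unfolding U_def by (rule eprod_cong) (auto; presburger)
  finally have om: "\<omega> = U * Eu 6"
    using triple_product[of 1 5 6 "-1"] by (simp add: \<omega>_def)
  have "\<omega> * (Eu 2 * Eu 3) = (U * dil 3 odd_prod) * Eu 2 * Eu 6 ^ 2"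
    unfolding om O3[symmetric] by (simp only: power2_eq_square mult_ac)
  thus ?thesis by (simp only: UO odd_prod)
qed

section \<open>Dissections of theta series by residue classes of the summation index\<close>

lemma theta_multisect:
  assumes fin: "\<And>n. finite {j. e j = n}" and d: "d > 0"
  shows "theta e \<sigma> = (\<Sum>k<d. theta (\<lambda>j. e (int d * j + int k)) (\<lambda>j. \<sigma> (int d * j + int k)))"
proof (rule fps_ext)
  fix n
  define f where "f k = (\<lambda>j. int d * j + int k)" for k
  have inj: "inj (f k)" for k using d by (auto simp: f_def inj_on_def)
  have finj: "finite {j. e (f k j) = n}" for k
    using finite_vimageI[OF fin[of n] inj[of k]] by (simp add: vimage_def)
  have "{j. e j = n} = (\<Union>k\<in>{..<d}. f k ` {j. e (f k j) = n})"
  proof safe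
    fix j
    have "j = f (nat (j mod int d)) (j div int d)" "nat (j mod int d) < d"
      using d by (auto simp: f_def nat_less_iff)
    thus "j \<in> (\<Union>k\<in>{..<d}. f k ` {i. e (f k i) = e j})" by (intro UN_I[of "nat (j mod int d)"]) auto
  qed
  hence "(\<Sum>j | e j = n. \<sigma> j) = (\<Sum>j\<in>(\<Union>k\<in>{..<d}. f k ` {j. e (f k j) = n}). \<sigma> j)" by simp
  also have "\<dots> = (\<Sum>k<d. \<Sum>j\<in>f k ` {j. e (f k j) = n}. \<sigma> j)"
  proof (rule sum.UNION_disjoint)
    have "k = k'" if "f k i = f k' i'" "k < d" "k' < d" for k k' i i'
    proof -
      have "f k i mod int d = int k" "f k' i' mod int d = int k'"
        using that(2,3) by (simp_all add: f_def)
      thus ?thesis using that(1) by simp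
    qed
    thus "\<forall>i\<in>{..<d}. \<forall>j\<in>{..<d}. i \<noteq> j \<longrightarrow> f i ` {x. e (f i x) = n} \<inter> f j ` {x. e (f j x) = n} = {}"
      by blast
  qed (auto simp: finj)
  also have "\<dots> = (\<Sum>k<d. \<Sum>j | e (f k j) = n. \<sigma> (f k j))"
    by (rule sum.cong[OF refl]) (simp add: sum.reindex inj_on_subset[OF inj])
  finally show "theta e \<sigma> $ n = (\<Sum>k<d. theta (\<lambda>j. e (int d * j + int k)) (\<lambda>j. \<sigma> (int d * j + int k))) $ n"
    by (simp add: theta_def fps_sum_nth f_def)
qed

lemma theta_affine:
  assumes m: "m > 0" and k: "bij k" and e: "\<And>j. e' j = c + m * e (k j)" and \<sigma>: "\<And>j. \<sigma>' j = d * \<sigma> (k j)"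
  shows "theta e' \<sigma>' = fps_const d * fps_X ^ c * dil m (theta e \<sigma>)"
proof (rule fps_ext)
  fix n
  have "theta e' \<sigma>' $ n = d * (\<Sum>j | e' j = n. \<sigma> (k j))"
    by (simp add: theta_def \<sigma> sum_distrib_left)
  also have "(\<Sum>j | e' j = n. \<sigma> (k j)) = (\<Sum>j | c + m * e j = n. \<sigma> j)"
    by (rule sum.reindex_bij_witness[of _ "inv_into UNIV k" k]) (use k e in \<open>auto simp: bij_def surj_f_inv_f\<close>)
  also have "\<dots> = (if n < c then 0 else dil m (theta e \<sigma>) $ (n - c))"
  proof (cases "n < c")
    case False
    have "{j. c + m * e j = n} = (if m dvd n - c then {j. e j = (n - c) div m} else {})"
      using False m by (auto simp: dvd_def)
    thus ?thesis using False m by (simp add: dil_nth theta_def)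
  qed auto
  finally show "theta e' \<sigma>' $ n = (fps_const d * fps_X ^ c * dil m (theta e \<sigma>)) $ n"
    by (simp add: mult.assoc fps_X_power_mult_nth)
qed

lemma finite_theta_fibre:
  assumes "r > 0" "s > 0"
  shows "finite {j. r * tri j + s * tri (j - 1) = n}"
proof (rule finite_subset)
  show "{j. r * tri j + s * tri (j - 1) = n} \<subseteq> {- int n..int n}"
  proof safe
    fix j
    have "tri j + tri (j - 1) \<le> r * tri j + s * tri (j - 1)" using assms by (intro add_mono) auto
    hence "nat \<bar>j\<bar> \<le> r * tri j + s * tri (j - 1)"
      using abs_le_tri_add[of j] by linarith
    thus "j \<in> {- int (r * tri j + s * tri (j - 1))..int (r * tri j + s * tri (j - 1))}"
      unfolding nat_le_iff atLeastAtMost_iff by linarith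
  qed
qed simp

lemma bij_int_reflect: "bij (\<lambda>j. c - j :: int)"
  by (rule bij_betw_byWitness[of _ "\<lambda>j. c - j"]) auto

lemma bij_int_shift: "bij (\<lambda>j. j + c :: int)"
  by (rule bij_betw_byWitness[of _ "\<lambda>j. j - c"]) auto

lemma minus_one_power_int: "(- 1 :: complex) ^ nat \<bar>j\<bar> = (if even j then 1 else - 1)"
  by (simp add: even_nat_iff minus_one_power_iff)

lemma two_int_eq_iff: "2 * int a = 2 * int b \<Longrightarrow> a = b"
  by simp

text \<open>Exponents are compared after doubling, which clears the halves hidden in
  \<open>tri\<close> and leaves polynomial identities over the integers.\<close>

lemma theta_affine_reflect:
  assumes "m > 0" and e: "\<And>j. 2 * int (e' j) = 2 * int (c + m * e (b - j))" and "\<And>j. \<sigma>' j = d * \<sigma> (b - j)"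
  shows "theta e' \<sigma>' = fps_const d * fps_X ^ c * dil m (theta e \<sigma>)"
proof (rule theta_affine[OF assms(1) bij_int_reflect[of b]])
  show "e' j = c + m * e (b - j)" for j using e[of j] by (rule two_int_eq_iff)
qed (rule assms)

lemma theta_affine_shift:
  assumes "m > 0" and e: "\<And>j. 2 * int (e' j) = 2 * int (c + m * e (j + b))" and "\<And>j. \<sigma>' j = d * \<sigma> (j + b)"
  shows "theta e' \<sigma>' = fps_const d * fps_X ^ c * dil m (theta e \<sigma>)"
proof (rule theta_affine[OF assms(1) bij_int_shift[of b]])
  show "e' j = c + m * e (j + b)" for j using e[of j] by (rule two_int_eq_iff)
qed (rule assms)

lemma two_tri_combination:
  "2 * int (c + m * (r * tri i + s * tri (i - 1))) = 2 * int c + int m * (int r * (i * (i + 1)) + int s * ((i - 1) * i))"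
  "2 * int (r * tri i + s * tri (i - 1)) = int r * (i * (i + 1)) + int s * ((i - 1) * i)"
proof -
  have "int r * (2 * int (tri i)) + int s * (2 * int (tri (i - 1))) = int r * (i * (i + 1)) + int s * ((i - 1) * i)"
    by (simp only: two_tri diff_add_cancel)
  moreover have "2 * int (c + m * (r * tri i + s * tri (i - 1))) =
     2 * int c + int m * (int r * (2 * int (tri i)) + int s * (2 * int (tri (i - 1))))"
    by (simp add: algebra_simps)
  moreover have "2 * int (r * tri i + s * tri (i - 1)) = int r * (2 * int (tri i)) + int s * (2 * int (tri (i - 1)))"
    by (simp add: algebra_simps)
  ultimately show "2 * int (c + m * (r * tri i + s * tri (i - 1))) = 2 * int c + int m * (int r * (i * (i + 1)) + int s * ((i - 1) * i))"
    "2 * int (r * tri i + s * tri (i - 1)) = int r * (i * (i + 1)) + int s * ((i - 1) * i)"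
    by simp_all
qed

text \<open>Even \<open>j\<close> give the exponents \<open>4 i^2\<close>. For odd \<open>j\<close>
  one has \<open>j^2 = 1 + 8 T\<close> with \<open>T\<close> triangular, and each of the classes 1
  and 3 modulo 4 meets every triangular number once, hence the factor 2. The split is modulo 4
  because \<open>\<psi>\<close> is summed over all integers.\<close>

lemma phi_dissect: "\<phi> = dil 4 \<phi> + 2 * fps_X * dil 8 \<psi>"
proof -
  define e where "e j = 1 * tri j + 1 * tri (j - 1)" for j
  define \<sigma> where "\<sigma> j = (1 :: complex) ^ nat \<bar>j\<bar>" for j :: int
  define T where "T d c = theta (\<lambda>j. e (d * j + c)) (\<lambda>j. \<sigma> (d * j + c))" for d c
  have fin: "finite {j. e j = n}" for n unfolding e_def by (rule finite_theta_fibre) auto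
  have "\<phi> = T 4 0 + T 4 1 + T 4 2 + T 4 3"
    unfolding \<phi>_def e_def[symmetric] \<sigma>_def[symmetric] T_def
    by (subst theta_multisect[OF fin, of 4]) (simp_all add: eval_nat_numeral add.assoc)
  note p4 = this
  have p: "\<phi> = T 2 0 + T 2 1"
    unfolding \<phi>_def e_def[symmetric] \<sigma>_def[symmetric] T_def
    by (subst theta_multisect[OF fin, of 2]) (simp_all add: eval_nat_numeral add.assoc)
  note p4
  moreover have "T 4 0 = fps_const 1 * fps_X ^ 0 * dil 4 (T 2 0)" unfolding T_def
    by (rule theta_affine_shift[of 4 _ 0 _ 0])
       (simp_all only: e_def two_tri_combination, simp_all add: \<sigma>_def algebra_simps)
  moreover have "T 4 2 = fps_const 1 * fps_X ^ 0 * dil 4 (T 2 1)" unfolding T_def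
    by (rule theta_affine_shift[of 4 _ 0 _ 0])
       (simp_all only: e_def two_tri_combination, simp_all add: \<sigma>_def algebra_simps)
  moreover have "T 4 1 = fps_const 1 * fps_X ^ 1 * dil 8 \<psi>" unfolding T_def \<psi>_def
    by (rule theta_affine_reflect[of 8 _ 1 _ 0])
       (simp_all only: e_def two_tri_combination, simp_all add: \<sigma>_def algebra_simps)
  moreover have "T 4 3 = fps_const 1 * fps_X ^ 1 * dil 8 \<psi>" unfolding T_def \<psi>_def
    by (rule theta_affine_shift[of 8 _ 1 _ 1])
       (simp_all only: e_def two_tri_combination, simp_all add: \<sigma>_def algebra_simps)
  ultimately have "\<phi> = dil 4 (T 2 0 + T 2 1) + 2 * fps_X * dil 8 \<psi>" by (simp add: dil_add algebra_simps)
  thus ?thesis by (simp only: p[symmetric])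
qed

text \<open>For \<open>j = 3 i + 1\<close> the exponent \<open>2 j^2 - j\<close> is
  \<open>1 + 9 (2 i^2 + i)\<close>, which gives the second term; the classes 0 and 2 supply the even
  and the odd half of \<open>dil 3 \<alpha>\<close>.\<close>

lemma psi_dissect: "\<psi> = dil 3 \<alpha> + fps_X * dil 9 \<psi>"
proof -
  define e where "e j = 1 * tri j + 3 * tri (j - 1)" for j
  define \<sigma> where "\<sigma> j = (1 :: complex) ^ nat \<bar>j\<bar>" for j :: int
  define a where "a j = 1 * tri j + 2 * tri (j - 1)" for j
  define T where "T d c = theta (\<lambda>j. e (d * j + c)) (\<lambda>j. \<sigma> (d * j + c))" for d c
  define U where "U d c = theta (\<lambda>j. a (d * j + c)) (\<lambda>j. \<sigma> (d * j + c))" for d c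
  have fin: "finite {j. e j = n}" "finite {j. a j = n}" for n
    unfolding e_def a_def by (rule finite_theta_fibre; simp)+
  have "\<psi> = T 3 0 + T 3 1 + T 3 2"
    unfolding \<psi>_def e_def[symmetric] \<sigma>_def[symmetric] T_def
    by (subst theta_multisect[OF fin(1), of 3]) (simp_all add: eval_nat_numeral add.assoc)
  note p3 = this
  have p: "\<alpha> = U 2 0 + U 2 1"
    unfolding \<alpha>_def a_def[symmetric] \<sigma>_def[symmetric] U_def
    by (subst theta_multisect[OF fin(2), of 2]) (simp_all add: eval_nat_numeral add.assoc)
  note p3
  moreover have "T 3 0 = fps_const 1 * fps_X ^ 0 * dil 3 (U 2 0)" unfolding T_def U_def
    by (rule theta_affine_shift[of 3 _ 0 _ 0])
       (simp_all only: e_def a_def two_tri_combination, simp_all add: \<sigma>_def algebra_simps)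
  moreover have "T 3 2 = fps_const 1 * fps_X ^ 0 * dil 3 (U 2 1)" unfolding T_def U_def
    by (rule theta_affine_reflect[of 3 _ 0 _ "-1"])
       (simp_all only: e_def a_def two_tri_combination, simp_all add: \<sigma>_def algebra_simps)
  moreover have "T 3 1 = fps_const 1 * fps_X ^ 1 * dil 9 \<psi>" unfolding T_def \<psi>_def
    by (rule theta_affine_reflect[of 9 _ 1 _ 0])
       (simp_all only: e_def two_tri_combination, simp_all add: \<sigma>_def algebra_simps)
  ultimately have "\<psi> = dil 3 (U 2 0 + U 2 1) + fps_X * dil 9 \<psi>" by (simp add: dil_add algebra_simps)
  thus ?thesis by (simp only: p[symmetric])
qed

text \<open>Multiples of 3 give \<open>9 i^2\<close>; both other classes give
  \<open>1 + 3 (3 i^2 - 2 i)\<close> up to reflection or shift of \<open>i\<close>, with the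
  opposite sign.\<close>

lemma phim_dissect: "\<phi>m = dil 9 \<phi>m - 2 * fps_X * dil 3 \<omega>"
proof -
  define e where "e j = 1 * tri j + 1 * tri (j - 1)" for j
  define \<sigma> where "\<sigma> j = (-1 :: complex) ^ nat \<bar>j\<bar>" for j :: int
  define T where "T d c = theta (\<lambda>j. e (d * j + c)) (\<lambda>j. \<sigma> (d * j + c))" for d c
  have fin: "finite {j. e j = n}" for n unfolding e_def by (rule finite_theta_fibre) auto
  have "\<phi>m = T 3 0 + T 3 1 + T 3 2"
    unfolding \<phi>m_def e_def[symmetric] \<sigma>_def[symmetric] T_def
    by (subst theta_multisect[OF fin, of 3]) (simp_all add: eval_nat_numeral add.assoc)
  moreover have "T 3 0 = fps_const 1 * fps_X ^ 0 * dil 9 \<phi>m" unfolding T_def \<phi>m_def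
    by (rule theta_affine_shift[of 9 _ 0 _ 0])
       (simp_all only: e_def two_tri_combination \<sigma>_def minus_one_power_int, simp_all add: algebra_simps)
  moreover have "T 3 1 = fps_const (-1) * fps_X ^ 1 * dil 3 \<omega>" unfolding T_def \<omega>_def
    by (rule theta_affine_reflect[of 3 _ 1 _ 0])
       (simp_all only: e_def two_tri_combination \<sigma>_def minus_one_power_int, simp_all add: algebra_simps)
  moreover have "T 3 2 = fps_const (-1) * fps_X ^ 1 * dil 3 \<omega>" unfolding T_def \<omega>_def
    by (rule theta_affine_shift[of 3 _ 1 _ 1])
       (simp_all only: e_def two_tri_combination \<sigma>_def minus_one_power_int, simp_all add: algebra_simps)
  moreover have "fps_const (- 1 :: complex) = - 1" by (simp flip: fps_const_neg)
  ultimately show ?thesis by (simp add: algebra_simps)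
qed

section \<open>Differential equations of the generating functions\<close>

definition \<theta> :: "complex fps \<Rightarrow> complex fps" where "\<theta> f = fps_X * fps_deriv f"

lemma \<theta>_nth: "\<theta> f $ n = of_nat n * f $ n"
  by (cases n) (simp_all add: \<theta>_def)

lemma \<theta>_add: "\<theta> (f + g) = \<theta> f + \<theta> g"
  and \<theta>_mult: "\<theta> (f * g) = \<theta> f * g + f * \<theta> g"
  and \<theta>_numeral [simp]: "\<theta> (numeral k) = 0"
  and \<theta>_0 [simp]: "\<theta> 0 = 0"
  by (simp_all add: \<theta>_def algebra_simps)

text \<open>The Apery-like recurrence
  \<open>(n+1)^2 c(n+1) = (a n^2 + a n + b) c(n) - d n^2 c(n-1)\<close>, shifted by one, with its
  case \<open>n = 0\<close> as a separate clause. For \<open>d = 0\<close> it is the two-term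
  recurrence of a hypergeometric series.\<close>

definition apery_rec :: "complex \<Rightarrow> complex \<Rightarrow> complex \<Rightarrow> (nat \<Rightarrow> complex) \<Rightarrow> bool" where
  "apery_rec a b d c \<longleftrightarrow> c 1 = b * c 0 \<and> (\<forall>n. of_nat (n + 2) ^ 2 * c (n + 2) =
     (a * of_nat (n + 1) ^ 2 + a * of_nat (n + 1) + b) * c (n + 1) - d * of_nat (n + 1) ^ 2 * c n)"

text \<open>This is \<open>\<theta>^2 - a x (\<theta>^2 + \<theta>) - b x + d x^2 (\<theta> +
  1)^2\<close> with \<open>\<theta> = x d/dx\<close>, divided by \<open>x\<close> and written with
  ordinary derivatives.\<close>

definition apery_ode :: "complex \<Rightarrow> complex \<Rightarrow> complex \<Rightarrow> complex fps \<Rightarrow> bool" where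
  "apery_ode a b d G \<longleftrightarrow>
     fps_X * (1 - fps_const a * fps_X + fps_const d * fps_X ^ 2) * fps_deriv (fps_deriv G)
     + (1 - fps_const (2 * a) * fps_X + fps_const (3 * d) * fps_X ^ 2) * fps_deriv G
     - (fps_const b - fps_const d * fps_X) * G = 0"

lemma apery_ode_coeff:
  fixes a b d :: complex and G :: "complex fps"
  defines "R \<equiv> fps_X * (1 - fps_const a * fps_X + fps_const d * fps_X ^ 2) * fps_deriv (fps_deriv G)
     + (1 - fps_const (2 * a) * fps_X + fps_const (3 * d) * fps_X ^ 2) * fps_deriv G
     - (fps_const b - fps_const d * fps_X) * G"
  shows "R $ 0 = G $ 1 - b * G $ 0"
    and "R $ Suc n = of_nat (n + 2) ^ 2 * G $ (n + 2) -
     (a * of_nat (n + 1) ^ 2 + a * of_nat (n + 1) + b) * G $ (n + 1) + d * of_nat (n + 1) ^ 2 * G $ n"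
proof -
  define D1 where "D1 = fps_deriv G"
  define D2 where "D2 = fps_deriv (fps_deriv G)"
  have R: "R = fps_X * D2 - fps_const a * (fps_X * (fps_X * D2)) + fps_const d * (fps_X * (fps_X * (fps_X * D2)))
     + D1 - fps_const (2 * a) * (fps_X * D1) + fps_const (3 * d) * (fps_X * (fps_X * D1)) - fps_const b * G
     + fps_const d * (fps_X * G)"
    unfolding R_def D1_def D2_def by (simp add: algebra_simps power2_eq_square)
  have X: "(fps_X * f) $ 0 = 0" "(fps_X * f) $ Suc k = f $ k" for f :: "complex fps" and k by simp_all
  show "R $ 0 = G $ 1 - b * G $ 0"
    unfolding R by (simp add: D1_def)
  show "R $ Suc n = of_nat (n + 2) ^ 2 * G $ (n + 2) -
     (a * of_nat (n + 1) ^ 2 + a * of_nat (n + 1) + b) * G $ (n + 1) + d * of_nat (n + 1) ^ 2 * G $ n"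
  proof (cases n)
    case 0
    thus ?thesis unfolding R D1_def D2_def
      by (simp add: X algebra_simps numeral_2_eq_2)
  next
    case (Suc m)
    thus ?thesis unfolding R D1_def D2_def
      by (cases m) (simp_all add: X algebra_simps power2_eq_square numeral_3_eq_3)
  qed
qed

lemma apery_ode_iff: "apery_ode a b d G \<longleftrightarrow> apery_rec a b d (fps_nth G)"
proof -
  define R where "R = fps_X * (1 - fps_const a * fps_X + fps_const d * fps_X ^ 2) * fps_deriv (fps_deriv G)
     + (1 - fps_const (2 * a) * fps_X + fps_const (3 * d) * fps_X ^ 2) * fps_deriv G
     - (fps_const b - fps_const d * fps_X) * G"
  have "R = 0 \<longleftrightarrow> R $ 0 = 0 \<and> (\<forall>n. R $ Suc n = 0)"
    unfolding fps_eq_iff by (metis fps_zero_nth not0_implies_Suc)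
  also have "\<dots> \<longleftrightarrow> apery_rec a b d (fps_nth G)"
    unfolding R_def apery_ode_coeff apery_rec_def by (simp only: right_minus_eq) (simp add: algebra_simps)
  finally show ?thesis by (simp add: apery_ode_def R_def)
qed

lemma apery_rec_unique:
  assumes "apery_rec a b d c" "apery_rec a b d c'" "c 0 = c' 0"
  shows "c n = c' n"
proof (induction n rule: less_induct)
  case (less n)
  show ?case
  proof (cases n rule: nat.exhaust)
    case (Suc m)
    show ?thesis
    proof (cases m)
      case 0
      thus ?thesis using assms Suc by (simp add: apery_rec_def)
    next
      case (Suc k)
      have n: "n = k + 2" using Suc \<open>n = Suc m\<close> by simp
      have IH: "c (k + 1) = c' (k + 1)" "c k = c' k" by (rule less.IH; simp add: n)+
      have "of_nat (k + 2) ^ 2 * c (k + 2) = of_nat (k + 2) ^ 2 * c' (k + 2)"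
        using assms(1,2) by (simp only: apery_rec_def IH)
      moreover have "(of_nat (k + 2) :: complex) ^ 2 \<noteq> 0" by (simp del: of_nat_add of_nat_Suc)
      ultimately show ?thesis unfolding n by (subst (asm) mult_cancel_left) blast
    qed
  qed (use assms in simp)
qed

lemma apery_ode_unique: "apery_ode a b d f \<Longrightarrow> apery_ode a b d g \<Longrightarrow> f $ 0 = g $ 0 \<Longrightarrow> f = g"
  unfolding apery_ode_iff by (rule fps_ext) (rule apery_rec_unique)

text \<open>The operator of \<open>apery_ode a b d\<close> applied to \<open>i * (f oo h)\<close> is a combination of the
  composites of \<open>f\<close> and its derivatives with \<open>h\<close>; \<open>e2\<close>, \<open>e1\<close> and \<open>e0\<close> say that its
  coefficients are \<open>\<mu>\<close> times those of the equation of \<open>f\<close>.\<close>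
lemma apery_ode_compose:
  fixes f h i :: "complex fps"
  assumes f: "apery_ode k c 0 f" and h0: "h $ 0 = 0"
    and e2: "fps_X * (1 - fps_const a * fps_X + fps_const d * fps_X ^ 2) * i * fps_deriv h ^ 2 = \<mu> * (h * (1 - fps_const k * h))"
    and e1: "fps_X * (1 - fps_const a * fps_X + fps_const d * fps_X ^ 2) * (2 * fps_deriv i * fps_deriv h + i * fps_deriv (fps_deriv h))
       + (1 - fps_const (2 * a) * fps_X + fps_const (3 * d) * fps_X ^ 2) * i * fps_deriv h = \<mu> * (1 - fps_const (2 * k) * h)"
    and e0: "fps_X * (1 - fps_const a * fps_X + fps_const d * fps_X ^ 2) * fps_deriv (fps_deriv i)
       + (1 - fps_const (2 * a) * fps_X + fps_const (3 * d) * fps_X ^ 2) * fps_deriv i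
       - (fps_const b - fps_const d * fps_X) * i = - \<mu> * fps_const c"
  shows "apery_ode a b d (i * (f oo h))"
proof -
  define u where "u = f oo h"
  define v where "v = fps_deriv f oo h"
  define w where "w = fps_deriv (fps_deriv f) oo h"
  have "(fps_X * (1 - fps_const k * fps_X) * fps_deriv (fps_deriv f)
     + (1 - fps_const (2 * k) * fps_X) * fps_deriv f - fps_const c * f) oo h = 0"
    using f by (simp add: apery_ode_def)
  hence hyp: "h * (1 - fps_const k * h) * w + (1 - fps_const (2 * k) * h) * v - fps_const c * u = 0"
    using h0 by (simp add: fps_compose_add_distrib fps_compose_sub_distrib fps_compose_mult_distrib u_def v_def w_def)
  have du: "fps_deriv u = v * fps_deriv h" and dv: "fps_deriv v = w * fps_deriv h"
    unfolding u_def v_def w_def by (rule fps_compose_deriv[OF h0])+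
  define P2 where "P2 = fps_X * (1 - fps_const a * fps_X + fps_const d * fps_X ^ 2)"
  define P1 where "P1 = 1 - fps_const (2 * a) * fps_X + fps_const (3 * d) * fps_X ^ 2"
  define P0 where "P0 = fps_const b - fps_const d * fps_X"
  have "P2 * fps_deriv (fps_deriv (i * u)) + P1 * fps_deriv (i * u) - P0 * (i * u) =
     (P2 * i * fps_deriv h ^ 2) * w
     + (P2 * (2 * fps_deriv i * fps_deriv h + i * fps_deriv (fps_deriv h)) + P1 * i * fps_deriv h) * v
     + (P2 * fps_deriv (fps_deriv i) + P1 * fps_deriv i - P0 * i) * u"
    by (simp add: du dv algebra_simps power2_eq_square)
  also have "\<dots> = \<mu> * (h * (1 - fps_const k * h) * w + (1 - fps_const (2 * k) * h) * v - fps_const c * u)"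
    unfolding P2_def P1_def P0_def e2 e1 e0 by (simp add: algebra_simps)
  also have "\<dots> = 0" unfolding hyp by simp
  finally show ?thesis by (simp only: apery_ode_def P2_def P1_def P0_def u_def)
qed

text \<open>\<open>F2\<close> and \<open>F3\<close> are the hypergeometric series
  \<open>2F1(1/2, 1/2; 1; 16 x)\<close> and \<open>2F1(1/3, 2/3; 1; 27 x)\<close>; the scaling makes
  the coefficients integers.\<close>

definition F2 :: "complex fps" where "F2 = Abs_fps (\<lambda>n. of_nat ((2 * n) choose n) ^ 2)"
definition F3 :: "complex fps" where "F3 = Abs_fps (\<lambda>n. of_nat ((2 * n) choose n) * of_nat ((3 * n) choose n))"
definition gen :: "label \<Rightarrow> complex fps" where "gen L = Abs_fps (\<lambda>n. of_int (C_seq L n))"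

lemma gen_nth: "fps_nth (gen L) = (\<lambda>n. of_int (C_seq L n))"
  by (rule ext) (simp add: gen_def del: C_seq.simps)

lemma central_binomial_fact: "of_nat ((2 * n) choose n) = (fact (2 * n) / fact n ^ 2 :: 'a :: field_char_0)"
proof -
  have "2 * n - n = n" by simp
  thus ?thesis using binomial_fact[of n "2 * n", where 'a = 'a] by (simp add: power2_eq_square)
qed

lemma trinomial_fact:
  "of_nat ((2 * n) choose n) * of_nat ((3 * n) choose n) = (fact (3 * n) / fact n ^ 3 :: 'a :: field_char_0)"
proof -
  have "3 * n - n = 2 * n" by simp
  thus ?thesis using binomial_fact[of n "3 * n", where 'a = 'a]
    by (simp add: central_binomial_fact power2_eq_square power3_eq_cube)
qed

lemma fact_double_Suc: "fact (2 * (n + 1)) = (2 * of_nat n + 2) * (2 * of_nat n + 1) * (fact (2 * n) :: 'a :: field_char_0)"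
proof -
  have "2 * (n + 1) = Suc (Suc (2 * n))" by simp
  hence "fact (2 * (n + 1)) = (of_nat (Suc (Suc (2 * n))) * (of_nat (Suc (2 * n)) * fact (2 * n)) :: 'a)"
    by (simp only: fact_Suc)
  thus ?thesis by (simp add: mult.assoc add.commute)
qed

lemma fact_triple_Suc: "fact (3 * (n + 1)) =
    (3 * of_nat n + 3) * (3 * of_nat n + 2) * (3 * of_nat n + 1) * (fact (3 * n) :: 'a :: field_char_0)"
proof -
  have "3 * (n + 1) = Suc (Suc (Suc (3 * n)))" by simp
  hence "fact (3 * (n + 1)) = (of_nat (Suc (Suc (Suc (3 * n)))) * (of_nat (Suc (Suc (3 * n))) * (of_nat (Suc (3 * n)) * fact (3 * n))) :: 'a)"
    by (simp only: fact_Suc)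
  thus ?thesis by (simp add: mult.assoc add.commute)
qed

lemma central_binomial_Suc:
  "of_nat (n + 1) * of_nat ((2 * (n + 1)) choose (n + 1)) = 2 * (2 * of_nat n + 1) * (of_nat ((2 * n) choose n) :: 'a :: field_char_0)"
proof -
  define N :: 'a where "N = of_nat n"
  define f :: 'a where "f = fact n"
  define g :: 'a where "g = fact (2 * n)"
  have nz: "N + 1 \<noteq> 0" "f \<noteq> 0"
    using of_nat_neq_0[of n, where 'a = 'a] by (simp_all add: N_def f_def add.commute)
  have 1: "fact (2 * (n + 1)) = (2 * N + 2) * (2 * N + 1) * g" "fact (n + 1) = (N + 1) * f" "of_nat (n + 1) = N + 1"
    by (simp_all only: fact_double_Suc N_def g_def) (simp_all add: f_def add.commute)
  have "(N + 1) * ((2 * N + 2) * (2 * N + 1) * g / ((N + 1) * f) ^ 2) = 2 * (2 * N + 1) * (g / f ^ 2)"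
    using nz by (simp add: divide_simps) (simp add: algebra_simps power2_eq_square)
  thus ?thesis
    unfolding central_binomial_fact 1 by (simp only: N_def f_def g_def)
qed

lemma trinomial_Suc:
  "of_nat (n + 1) ^ 2 * (of_nat ((2 * (n + 1)) choose (n + 1)) * of_nat ((3 * (n + 1)) choose (n + 1)))
    = 3 * (3 * of_nat n + 1) * (3 * of_nat n + 2) * (of_nat ((2 * n) choose n) * of_nat ((3 * n) choose n) :: 'a :: field_char_0)"
proof -
  define N :: 'a where "N = of_nat n"
  define f :: 'a where "f = fact n"
  define g :: 'a where "g = fact (3 * n)"
  have nz: "N + 1 \<noteq> 0" "f \<noteq> 0"
    using of_nat_neq_0[of n, where 'a = 'a] by (simp_all add: N_def f_def add.commute)
  have 1: "fact (3 * (n + 1)) = (3 * N + 3) * (3 * N + 2) * (3 * N + 1) * g" "fact (n + 1) = (N + 1) * f" "of_nat (n + 1) = N + 1"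
    by (simp_all only: fact_triple_Suc N_def g_def) (simp_all add: f_def add.commute)
  have "(N + 1) ^ 2 * ((3 * N + 3) * (3 * N + 2) * (3 * N + 1) * g / ((N + 1) * f) ^ 3) = 3 * (3 * N + 1) * (3 * N + 2) * (g / f ^ 3)"
    using nz by (simp add: divide_simps) (simp add: algebra_simps power2_eq_square power3_eq_cube)
  thus ?thesis
    unfolding trinomial_fact 1 by (simp only: N_def f_def g_def)
qed

lemma apery_F2: "apery_ode 16 4 0 F2"
proof -
  have rec: "of_nat (n + 1) ^ 2 * F2 $ (n + 1) = (16 * of_nat n ^ 2 + 16 * of_nat n + 4) * F2 $ n" for n
  proof -
    have "of_nat (n + 1) ^ 2 * F2 $ (n + 1) = (of_nat (n + 1) * of_nat ((2 * (n + 1)) choose (n + 1))) ^ 2"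
      by (simp add: F2_def power_mult_distrib)
    also have "\<dots> = (16 * of_nat n ^ 2 + 16 * of_nat n + 4) * F2 $ n"
      unfolding central_binomial_Suc F2_def by (simp add: algebra_simps power2_eq_square)
    finally show ?thesis .
  qed
  show ?thesis unfolding apery_ode_iff apery_rec_def
    using rec[of 0] rec[of "Suc _"] by (simp add: add.commute)
qed

lemma apery_F3: "apery_ode 27 6 0 F3"
proof -
  have rec: "of_nat (n + 1) ^ 2 * F3 $ (n + 1) = (27 * of_nat n ^ 2 + 27 * of_nat n + 6) * F3 $ n" for n
    using trinomial_Suc[of n, where 'a = complex] by (simp add: F3_def algebra_simps power2_eq_square)
  show ?thesis unfolding apery_ode_iff apery_rec_def
    using rec[of 0] rec[of "Suc _"] by (simp add: add.commute)
qed

text \<open>The exponential generating function of \<open>C_seq E\<close> is the square of a solution of a second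
  order equation, which turns into a recurrence for \<open>C_seq E\<close> itself.\<close>
lemma apery_gen_E: "apery_ode 12 4 32 (gen E)"
proof -
  define P where "P = Abs_fps (\<lambda>k. of_nat ((2 * k) choose k) / fact k :: complex)"
  define c where "c = \<theta> (\<theta> P)"
  have c: "c = fps_X * (4 * \<theta> P + 2 * P)"
  proof (rule fps_ext)
    fix n
    show "c $ n = (fps_X * (4 * \<theta> P + 2 * P)) $ n"
    proof (cases n)
      case (Suc k)
      have k: "(1 + of_nat k :: complex) \<noteq> 0" by (metis of_nat_Suc of_nat_neq_0)
      have "c $ n = of_nat (k + 1) * (of_nat (k + 1) * of_nat ((2 * (k + 1)) choose (k + 1))) / fact (k + 1)"
        by (simp add: c_def \<theta>_nth P_def Suc)
      also have "\<dots> = 2 * (2 * of_nat k + 1) * of_nat ((2 * k) choose k) / fact k"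
        unfolding central_binomial_Suc using k by (simp add: divide_simps)
      also have "\<dots> = (fps_X * (4 * \<theta> P + 2 * P)) $ n"
        by (simp add: Suc \<theta>_nth P_def numeral_fps_const algebra_simps add_divide_distrib)
      finally show ?thesis .
    qed (simp add: c_def \<theta>_nth)
  qed
  define Y where "Y = P * P"
  have X: "\<theta> (fps_X * f) = fps_X * (f + \<theta> f)" and num: "\<theta> (numeral k * f) = numeral k * \<theta> f" for f k
    by (simp_all add: \<theta>_def algebra_simps)
  have c': "\<theta> (\<theta> P) = c" by (simp add: c_def)
  have dc: "\<theta> c = c + fps_X * (4 * c + 2 * \<theta> P)"
  proof -
    have "\<theta> c = fps_X * (4 * \<theta> P + 2 * P) + fps_X * (4 * c + 2 * \<theta> P)"
      by (subst c) (simp only: X \<theta>_add num c' distrib_left add_ac)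
    thus ?thesis by (simp only: c[symmetric])
  qed
  \<comment> \<open>\<open>Y\<close> is the symmetric square of a solution of a second order
    equation and so satisfies one of third order; \<open>c\<close> and \<open>dc\<close> eliminate
    the higher derivatives of \<open>P\<close>.\<close>
  have "\<theta> (\<theta> (\<theta> Y)) = 6 * \<theta> P * c + 2 * P * \<theta> c"
    by (simp add: Y_def \<theta>_mult \<theta>_add c' algebra_simps)
  also have "\<dots> = fps_X * (12 * \<theta> (\<theta> Y) + 12 * \<theta> Y + 4 * Y) - 32 * (fps_X * (fps_X * (\<theta> Y + Y)))"
  proof -
    have "6 * b * c + 2 * a * (c + x * (4 * c + 2 * b)) =
        x * (12 * (c * a + b * b + (b * b + a * c)) + 12 * (b * a + a * b) + 4 * (a * a))
        - 32 * (x * (x * (b * a + a * b + a * a)))" if "c = x * (4 * b + 2 * a)" for a b c x :: "complex fps"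
      unfolding that by (simp add: algebra_simps)
    from this[OF c] show ?thesis unfolding dc Y_def \<theta>_mult \<theta>_add c' .
  qed
  finally have ode: "\<theta> (\<theta> (\<theta> Y)) = \<dots>" .
  have Y: "Y $ n = of_int (C_seq E n) / fact n" for n
  proof -
    have "of_int (C_seq E n) / fact n = (\<Sum>k=0..n. of_nat (n choose k) * of_nat ((2 * k) choose k) * of_nat ((2 * (n - k)) choose (n - k)) / (fact n :: complex))"
      by (simp add: sum_divide_distrib)
    also have "\<dots> = (\<Sum>k=0..n. P $ k * P $ (n - k))"
    proof (intro sum.cong refl)
      fix k assume "k \<in> {0..n}"
      hence "(of_nat (n choose k) :: complex) = fact n / (fact k * fact (n - k))"
        by (intro binomial_fact) simp
      thus "of_nat (n choose k) * of_nat ((2 * k) choose k) * of_nat ((2 * (n - k)) choose (n - k)) / (fact n :: complex)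
          = P $ k * P $ (n - k)" by (simp add: P_def)
    qed
    finally show ?thesis by (simp add: Y_def fps_mult_nth)
  qed
  have "of_nat (n + 2) ^ 3 * Y $ (n + 2) = (12 * of_nat (n + 1) ^ 2 + 12 * of_nat (n + 1) + 4) * Y $ (n + 1)
     - 32 * of_nat (n + 1) * Y $ n" for n
    using arg_cong[OF ode, of "\<lambda>f. f $ (n + 2)"]
    by (simp add: \<theta>_nth numeral_fps_const algebra_simps power2_eq_square power3_eq_cube)
  hence "of_nat (n + 2) ^ 3 * (of_int (C_seq E (n + 2)) / fact (n + 2)) = (12 * of_nat (n + 1) ^ 2 + 12 * of_nat (n + 1) + 4) *
     (of_int (C_seq E (n + 1)) / fact (n + 1)) - 32 * of_nat (n + 1) * (of_int (C_seq E n) / fact n :: complex)" for n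
    unfolding Y .
  note rec = this
  have "apery_rec 12 4 32 (\<lambda>n. of_int (C_seq E n))"
    unfolding apery_rec_def
  proof (intro conjI allI)
    fix n
    define N :: complex where "N = of_nat n"
    have nz: "N + 1 \<noteq> 0" "N + 2 \<noteq> 0"
      using of_nat_neq_0[of n, where 'a = complex] of_nat_neq_0[of "Suc n", where 'a = complex]
      by (simp_all add: N_def add.commute)
    have f: "fact (n + 1) = (N + 1) * fact n" "fact (n + 2) = (N + 2) * (N + 1) * (fact n :: complex)"
      by (simp_all add: N_def algebra_simps)
    define x y z :: complex where "x = of_int (C_seq E (n + 2))" and "y = of_int (C_seq E (n + 1))" and "z = of_int (C_seq E n)"
    have fn: "(fact n :: complex) \<noteq> 0" by simp
    have "(N + 2) ^ 3 * (x / ((N + 2) * (N + 1) * fact n)) = (12 * (N + 1) ^ 2 + 12 * (N + 1) + 4) * (y / ((N + 1) * fact n))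
        - 32 * (N + 1) * (z / fact n)"
      using rec[of n] unfolding f x_def y_def z_def by (simp add: N_def algebra_simps del: C_seq.simps)
    also have "(N + 2) ^ 3 * (x / ((N + 2) * (N + 1) * fact n)) = (N + 2) ^ 2 * x / ((N + 1) * fact n)"
      using nz fn by (simp add: power3_eq_cube power2_eq_square)
    also have "(12 * (N + 1) ^ 2 + 12 * (N + 1) + 4) * (y / ((N + 1) * fact n)) - 32 * (N + 1) * (z / fact n) =
      ((12 * (N + 1) ^ 2 + 12 * (N + 1) + 4) * y - 32 * (N + 1) ^ 2 * z) / ((N + 1) * fact n)"
      using nz fn by (simp add: divide_simps) (simp add: algebra_simps power2_eq_square)
    finally have "(N + 2) ^ 2 * x = (12 * (N + 1) ^ 2 + 12 * (N + 1) + 4) * y - 32 * (N + 1) ^ 2 * z"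
      using nz fn by simp
    moreover have "N + 2 = of_nat (n + 2)" "N + 1 = of_nat (n + 1)" by (simp_all add: N_def)
    ultimately show "of_nat (n + 2) ^ 2 * of_int (C_seq E (n + 2)) =
      (12 * of_nat (n + 1) ^ 2 + 12 * of_nat (n + 1) + 4) * of_int (C_seq E (n + 1)) - 32 * of_nat (n + 1) ^ 2 * (of_int (C_seq E n) :: complex)"
      by (simp only: x_def y_def z_def)
  qed simp
  thus ?thesis by (simp only: apery_ode_iff gen_nth)
qed

text \<open>Zeilberger's algorithm provides the certificate \<open>G\<close> in the proof.\<close>
lemma apery_rec_C:
  "of_nat (n + 2) ^ 2 * of_int (C_seq C (n + 2)) =
    (10 * of_nat (n + 1) ^ 2 + 10 * of_nat (n + 1) + 3) * of_int (C_seq C (n + 1)) - 9 * of_nat (n + 1) ^ 2 * (of_int (C_seq C n) :: complex)"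
proof -
  define m where "m = n + 1"
  define b where "b j k = (of_nat (j choose k) :: complex)" for j k
  \<comment> \<open>The neighbour \<open>m choose (k - 1)\<close>, put to 0 at \<open>k = 0\<close>,
    where subtraction on \<open>nat\<close> would give the wrong entry.\<close>
  define u where "u k = (if k = 0 then 0 else b m (k - 1))" for k
  define c where "c k = (of_nat ((2 * k) choose k) :: complex)" for k
  define N :: complex where "N = of_nat (n + 2)"
  define G where "G k = of_nat k * (3 * of_nat k - 4 * N) * u k ^ 2 * c k" for k
  have S: "of_int (C_seq C j) = (\<Sum>k<K. b j k ^ 2 * c k)" if "j < K" for j K
  proof -
    have "of_int (C_seq C j) = (\<Sum>k=0..j. b j k ^ 2 * c k)" by (simp add: b_def c_def)
    also have "\<dots> = (\<Sum>k<K. b j k ^ 2 * c k)"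
      using that by (intro sum.mono_neutral_left) (auto simp: b_def)
    finally show ?thesis .
  qed
  have tele: "N ^ 2 * (b (n + 2) k ^ 2 * c k) - (10 * (N - 1) ^ 2 + 10 * (N - 1) + 3) * (b m k ^ 2 * c k)
     + 9 * (N - 1) ^ 2 * (b n k ^ 2 * c k) = G (Suc k) - G k" for k
  proof -
    define K :: complex where "K = of_nat k"
    have 1: "b (n + 2) k = b m k + u k" by (cases k) (simp_all add: b_def u_def m_def)
    have 2: "(N - 1) * b n k = (N - 1 - K) * b m k"
    proof (cases "k \<le> m")
      case True
      have "(m - k) * (m choose k) = m * (n choose k)"
        using binomial_absorb_comp[of m k] by (simp add: m_def)
      hence "of_nat (m - k) * b m k = of_nat m * b n k" unfolding b_def by (metis of_nat_mult)
      thus ?thesis using True by (simp add: of_nat_diff N_def m_def K_def)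
    qed (simp add: b_def m_def binomial_eq_0)
    have 3: "K * b m k = (N - K) * u k"
    proof (cases k)
      case (Suc j)
      show ?thesis
      proof (cases "j \<le> m")
        case True
        have "Suc j * (m choose Suc j) = (m - j) * (m choose j)"
          by (simp only: binomial_absorption binomial_absorb_comp)
        hence "of_nat (Suc j) * b m (Suc j) = of_nat (m - j) * b m j" unfolding b_def by (metis of_nat_mult)
        thus ?thesis using True Suc by (simp add: of_nat_diff N_def m_def K_def u_def)
      qed (simp add: b_def m_def Suc u_def binomial_eq_0)
    qed (simp add: K_def u_def)
    have 4: "(K + 1) * c (Suc k) = 2 * (2 * K + 1) * c k"
      using central_binomial_Suc[of k, where 'a = complex] by (simp add: c_def K_def algebra_simps)
    have "G (Suc k) = ((K + 1) * c (Suc k)) * (3 * (K + 1) - 4 * N) * b m k ^ 2"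
      by (simp add: G_def u_def K_def algebra_simps)
    also have "\<dots> = 2 * (2 * K + 1) * (3 * (K + 1) - 4 * N) * b m k ^ 2 * c k" unfolding 4 by (simp add: algebra_simps)
    finally have G1: "G (Suc k) = \<dots>" .
    \<comment> \<open>All three rows of binomials are expressed by \<open>b m k\<close> and
      \<open>u k\<close>. The defect of the certificate is then a multiple of the linear relation
      \<open>3\<close> between them.\<close>
    have "(N ^ 2 * (b m k + u k) ^ 2 - (10 * (N - 1) ^ 2 + 10 * (N - 1) + 3) * b m k ^ 2 + 9 * ((N - 1 - K) * b m k) ^ 2)
       - (2 * (2 * K + 1) * (3 * (K + 1) - 4 * N) * b m k ^ 2 - K * (3 * K - 4 * N) * u k ^ 2) =
       (K * b m k - (N - K) * u k) * ((- 2 * N - 3 * K) * b m k + (3 * K - N) * u k)"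
      by algebra
    also have "\<dots> = 0" using 3 by simp
    finally have "N ^ 2 * (b m k + u k) ^ 2 - (10 * (N - 1) ^ 2 + 10 * (N - 1) + 3) * b m k ^ 2 + 9 * ((N - 1) * b n k) ^ 2
       = 2 * (2 * K + 1) * (3 * (K + 1) - 4 * N) * b m k ^ 2 - K * (3 * K - 4 * N) * u k ^ 2"
      unfolding 2 by simp
    hence "(N ^ 2 * (b m k + u k) ^ 2 - (10 * (N - 1) ^ 2 + 10 * (N - 1) + 3) * b m k ^ 2 + 9 * ((N - 1) * b n k) ^ 2) * c k
       = (2 * (2 * K + 1) * (3 * (K + 1) - 4 * N) * b m k ^ 2 - K * (3 * K - 4 * N) * u k ^ 2) * c k"
      by simp
    thus ?thesis unfolding 1 G1 unfolding G_def K_def[symmetric] by algebra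
  qed
  have S1: "of_int (C_seq C (n + 2)) = (\<Sum>k<n+4. b (n + 2) k ^ 2 * c k)"
    and S2: "of_int (C_seq C m) = (\<Sum>k<n+4. b m k ^ 2 * c k)"
    and S3: "of_int (C_seq C n) = (\<Sum>k<n+4. b n k ^ 2 * c k)"
    by (rule S; simp add: m_def)+
  have "N ^ 2 * of_int (C_seq C (n + 2)) - (10 * (N - 1) ^ 2 + 10 * (N - 1) + 3) * of_int (C_seq C m)
     + 9 * (N - 1) ^ 2 * of_int (C_seq C n) = (\<Sum>k<n+4. G (Suc k) - G k)"
    unfolding S1 S2 S3
    by (simp only: sum_distrib_left sum_subtractf[symmetric] sum.distrib[symmetric] tele)
  also have "\<dots> = G (n + 4) - G 0" by (rule sum_lessThan_telescope)
  also have "\<dots> = 0" by (simp add: G_def u_def b_def m_def)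
  finally have "N ^ 2 * of_int (C_seq C (n + 2)) = (10 * (N - 1) ^ 2 + 10 * (N - 1) + 3) * of_int (C_seq C m) - 9 * (N - 1) ^ 2 * of_int (C_seq C n)"
    by (simp add: algebra_simps)
  moreover have "N - 1 = of_nat (n + 1)" by (simp add: N_def)
  ultimately show ?thesis by (simp only: N_def m_def)
qed

lemma apery_gen_C: "apery_ode 10 3 9 (gen C)"
proof -
  have "of_int (C_seq C 1) = (3 * of_int (C_seq C 0) :: complex)" by simp
  thus ?thesis using apery_rec_C by (simp add: apery_ode_iff apery_rec_def gen_nth del: C_seq.simps)
qed

section \<open>Two pullbacks of a hypergeometric series for each of the sequences E and C\<close>

lemma fps_const_numeral_mult:
  "fps_const (numeral n) = (numeral n :: complex fps)"
  "fps_const (2 * numeral n) = (2 * numeral n :: complex fps)"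
  "fps_const (3 * numeral n) = (3 * numeral n :: complex fps)"
  by (simp_all add: numeral_fps_const)

lemma linear_inverse:
  fixes c :: complex
  defines "i \<equiv> inverse (1 - fps_const c * fps_X)"
  shows "i * (1 - fps_const c * fps_X) = 1" "fps_deriv i = fps_const c * i ^ 2" "i $ 0 = 1"
proof -
  show "i * (1 - fps_const c * fps_X) = 1"
    unfolding i_def by (rule inverse_mult_eq_1) simp
  show "fps_deriv i = fps_const c * i ^ 2" "i $ 0 = 1"
    unfolding i_def by (simp_all add: fps_inverse_deriv)
qed

lemma F2_nth_0 [simp]: "F2 $ 0 = 1" and F3_nth_0 [simp]: "F3 $ 0 = 1"
  by (simp_all add: F2_def F3_def)

lemma gen_nth_0 [simp]: "gen L $ 0 = 1"
  by (cases L) (simp_all add: gen_nth)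

text \<open>For \<open>h = x (1 - 4 x)\<close> one has \<open>1 - 16 h = (1 - 8 x)^2\<close>, so the
  singular points 0 and 1/16 of \<open>F2\<close> are pulled back to the singular points 0, 1/4 and
  1/8 of the equation of \<open>gen E\<close>, and \<open>apery_ode_unique\<close> applies.\<close>

lemma gen_E_compose1: "gen E = F2 oo (fps_X * (1 - 4 * fps_X))"
proof -
  define h :: "complex fps" where "h = fps_X * (1 - 4 * fps_X)"
  have h': "fps_deriv h = 1 - 8 * fps_X" by (simp add: h_def algebra_simps)
  have "apery_ode 12 4 32 (1 * (F2 oo h))"
    \<comment> \<open>\<open>\<mu>\<close> is read off from \<open>e0\<close>, which for
      \<open>i = 1\<close> says \<open>4 - 32 x = 4 \<mu>\<close>.\<close>
    by (rule apery_ode_compose[OF apery_F2, where \<mu> = "1 - 8 * fps_X"])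
       (simp_all add: h_def h' fps_deriv_power numeral_fps_const[symmetric] algebra_simps power2_eq_square)
  hence "apery_ode 12 4 32 (F2 oo h)" by simp
  from apery_ode_unique[OF apery_gen_E this] show ?thesis by (simp add: h_def)
qed

text \<open>A second map to the same series, now with a double zero at 0, where
  \<open>1 - 16 h = (1 - 8 x) / (1 - 4 x)^2\<close>. Equating the first map at \<open>t(q^2)\<close>
  with this one at \<open>t(q)\<close> is the modular equation \<open>t8_modular\<close>.\<close>

lemma gen_E_compose2:
  "gen E = inverse (1 - 4 * fps_X) * (F2 oo (fps_X ^ 2 * inverse (1 - 4 * fps_X) ^ 2))"
proof -
  define x :: "complex fps" where "x = fps_X"
  define i :: "complex fps" where "i = inverse (1 - 4 * fps_X)"
  have i: "i * (1 - 4 * x) = 1" "fps_deriv i = 4 * i ^ 2" "i $ 0 = 1"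
    using linear_inverse[of 4] by (simp_all add: i_def x_def numeral_fps_const)
  define h where "h = x ^ 2 * i ^ 2"
  have x': "fps_deriv x = 1" by (simp add: x_def)
  have "fps_deriv h = 2 * x * i ^ 2 + x ^ 2 * (2 * i * (4 * i ^ 2))"
    by (simp add: h_def power2_eq_square x' i(2) algebra_simps)
  also have "\<dots> = 2 * x * i ^ 3" using i(1) by algebra
  finally have h': "fps_deriv h = 2 * x * i ^ 3" .
  have h'': "fps_deriv (2 * x * i ^ 3) = 2 * i ^ 3 + 24 * x * i ^ 4"
    by (simp add: power3_eq_cube power2_eq_square x' i(2) algebra_simps eval_nat_numeral)
  have i'': "fps_deriv (4 * i ^ 2) = 32 * i ^ 3"
    by (simp add: power3_eq_cube power2_eq_square i(2) algebra_simps)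
  have h16: "1 - 16 * h = (1 - 8 * x) * i ^ 2"
    unfolding h_def using i(1) by algebra
  have "apery_ode 12 4 32 (i * (F2 oo h))"
  proof (rule apery_ode_compose[OF apery_F2, where \<mu> = "4 * x * i ^ 2"], goal_cases)
    case 2
    show ?case unfolding h' x_def[symmetric] fps_const_numeral_mult h16 unfolding h_def  using i(1) by algebra
  next
    case 3
    show ?case unfolding h'' h' i(2) x_def[symmetric] fps_const_numeral_mult unfolding h_def  using i(1) by algebra
  next
    case 4
    show ?case unfolding i'' i(2) x_def[symmetric] fps_const_numeral_mult  using i(1) by algebra
  qed (simp add: h_def x_def)
  from apery_ode_unique[OF apery_gen_E this] show ?thesis by (simp add: i(3) h_def x_def i_def)
qed

text \<open>Here \<open>1 - 27 h = (1 - 9 x)^2 / (1 + 3 x)^3\<close>, which places the singularities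
  at the zeros of \<open>x (1 - x) (1 - 9 x)\<close>, as the equation of \<open>gen C\<close>
  requires.\<close>

lemma gen_C_compose1:
  "gen C = inverse (1 + 3 * fps_X) * (F3 oo (fps_X * (1 - fps_X) ^ 2 * inverse (1 + 3 * fps_X) ^ 3))"
proof -
  define x :: "complex fps" where "x = fps_X"
  define i :: "complex fps" where "i = inverse (1 + 3 * fps_X)"
  have i: "i * (1 + 3 * x) = 1" "fps_deriv i = - 3 * i ^ 2" "i $ 0 = 1"
    using linear_inverse[of "-3"] by (simp_all add: i_def x_def numeral_fps_const flip: fps_const_neg)
  define h where "h = x * (1 - x) ^ 2 * i ^ 3"
  have x': "fps_deriv x = 1" by (simp add: x_def)
  have "fps_deriv h = (1 - x) ^ 2 * i ^ 3 - 2 * x * (1 - x) * i ^ 3 + x * (1 - x) ^ 2 * (3 * i ^ 2 * (- 3 * i ^ 2))"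
    by (simp add: h_def power2_eq_square power3_eq_cube x' i(2) algebra_simps)
  also have "\<dots> = (1 - x) * (1 - 9 * x) * i ^ 4" using i(1) by algebra
  finally have h': "fps_deriv h = (1 - x) * (1 - 9 * x) * i ^ 4" .
  have i4: "fps_deriv (i ^ 4) = - 12 * i ^ 5"
    by (simp add: fps_deriv_power i(2) numeral_fps_const[symmetric] eval_nat_numeral algebra_simps)
  have h'': "fps_deriv ((1 - x) * (1 - 9 * x) * i ^ 4) = (18 * x - 10) * i ^ 4 - 12 * (1 - x) * (1 - 9 * x) * i ^ 5"
    by (simp add: i4 x' algebra_simps)
  have i'': "fps_deriv (- 3 * i ^ 2) = 18 * i ^ 3"
    by (simp add: power3_eq_cube power2_eq_square i(2) algebra_simps)
  have h27: "1 - 27 * h = (1 - 9 * x) ^ 2 * i ^ 3"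
    unfolding h_def using i(1) by algebra
  have "apery_ode 10 3 9 (i * (F3 oo h))"
  proof (rule apery_ode_compose[OF apery_F3, where \<mu> = "(1 - x) * (1 - 9 * x) * i ^ 3"], goal_cases)
    case 2
    show ?case unfolding h' x_def[symmetric] fps_const_numeral_mult h27 unfolding h_def
      by algebra
  next
    case 3
    show ?case unfolding h'' h' i(2) x_def[symmetric] fps_const_numeral_mult unfolding h_def  using i(1) by algebra
  next
    case 4
    show ?case unfolding i'' i(2) x_def[symmetric] fps_const_numeral_mult  using i(1) by algebra
  qed (simp add: h_def x_def)
  from apery_ode_unique[OF apery_gen_C this] show ?thesis by (simp add: i(3) h_def x_def i_def)
qed

text \<open>Here \<open>1 - 27 h = (1 - 9 x) / (1 - 3 x)^3\<close>. The double zero of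
  \<open>h\<close> at 0 again makes this map the partner at \<open>q\<close> of the previous one at
  \<open>q^2\<close>; see \<open>t6_modular\<close>.\<close>

lemma gen_C_compose2:
  "gen C = inverse (1 - 3 * fps_X) * (F3 oo (fps_X ^ 2 * (1 - fps_X) * inverse (1 - 3 * fps_X) ^ 3))"
proof -
  define x :: "complex fps" where "x = fps_X"
  define i :: "complex fps" where "i = inverse (1 - 3 * fps_X)"
  have i: "i * (1 - 3 * x) = 1" "fps_deriv i = 3 * i ^ 2" "i $ 0 = 1"
    using linear_inverse[of 3] by (simp_all add: i_def x_def numeral_fps_const)
  define h where "h = x ^ 2 * (1 - x) * i ^ 3"
  have x': "fps_deriv x = 1" by (simp add: x_def)
  have "fps_deriv h = 2 * x * (1 - x) * i ^ 3 - x ^ 2 * i ^ 3 + x ^ 2 * (1 - x) * (3 * i ^ 2 * (3 * i ^ 2))"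
    by (simp add: h_def power2_eq_square power3_eq_cube x' i(2) algebra_simps)
  also have "\<dots> = 2 * x * i ^ 4" using i(1) by algebra
  finally have h': "fps_deriv h = 2 * x * i ^ 4" .
  have i4: "fps_deriv (i ^ 4) = 12 * i ^ 5"
    by (simp add: fps_deriv_power i(2) numeral_fps_const[symmetric] eval_nat_numeral algebra_simps)
  have h'': "fps_deriv (2 * x * i ^ 4) = 2 * i ^ 4 + 24 * x * i ^ 5"
    by (simp add: i4 x' algebra_simps)
  have i'': "fps_deriv (3 * i ^ 2) = 18 * i ^ 3"
    by (simp add: power3_eq_cube power2_eq_square i(2) algebra_simps)
  have h27: "1 - 27 * h = (1 - 9 * x) * i ^ 3"
    unfolding h_def using i(1) by algebra
  have "apery_ode 10 3 9 (i * (F3 oo h))"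
  proof (rule apery_ode_compose[OF apery_F3, where \<mu> = "4 * x * i ^ 3"], goal_cases)
    case 2
    show ?case unfolding h' x_def[symmetric] fps_const_numeral_mult h27 unfolding h_def
      by algebra
  next
    case 3
    show ?case unfolding h'' h' i(2) x_def[symmetric] fps_const_numeral_mult unfolding h_def  using i(1) by algebra
  next
    case 4
    show ?case unfolding i'' i(2) x_def[symmetric] fps_const_numeral_mult  using i(1) by algebra
  qed (simp add: h_def x_def)
  from apery_ode_unique[OF apery_gen_C this] show ?thesis by (simp add: i(3) h_def x_def i_def)
qed

section \<open>Logarithmic derivatives and comparison of series under q -> q^2\<close>

lemma \<theta>_diff: "\<theta> (f - g) = \<theta> f - \<theta> g"
  and \<theta>_1 [simp]: "\<theta> 1 = 0"
  by (simp_all add: \<theta>_def algebra_simps)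

lemma \<theta>_power2: "\<theta> (f ^ 2) = 2 * f * \<theta> f"
  by (simp add: power2_eq_square \<theta>_mult algebra_simps)

lemma \<theta>_power3: "\<theta> (f ^ 3) = 3 * f ^ 2 * \<theta> f"
  by (simp add: power3_eq_cube power2_eq_square \<theta>_mult algebra_simps)

lemma \<theta>_dil2: "\<theta> (dil 2 f) = 2 * dil 2 (\<theta> f)"
  by (rule fps_ext) (auto simp: \<theta>_nth dil_nth numeral_fps_const elim!: dvdE)

lemma log_deriv_exists:
  assumes "v $ 0 = 1"
  shows "\<exists>L. \<theta> (fps_X * v) = fps_X * v * L \<and> L $ 0 = 1"
proof (intro exI[of _ "1 + \<theta> v * inverse v"] conjI)
  have v: "v * inverse v = 1" using assms by (simp add: inverse_mult_eq_1')
  have "\<theta> (fps_X * v) = fps_X * v + fps_X * \<theta> v"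
    by (simp add: \<theta>_def algebra_simps)
  also have "\<dots> = fps_X * v + fps_X * \<theta> v * (v * inverse v)" by (simp add: v)
  also have "\<dots> = fps_X * v * (1 + \<theta> v * inverse v)" by (simp add: algebra_simps)
  finally show "\<theta> (fps_X * v) = fps_X * v * (1 + \<theta> v * inverse v)" .
  show "(1 + \<theta> v * inverse v) $ 0 = 1" by (simp add: \<theta>_nth)
qed

lemma fps_eq_of_dil':
  assumes "f * a = b * dil 2 f" "g * a = b * dil 2 g" "a $ 0 = 1" "f $ 0 = 1" "g $ 0 = 1"
  shows "f = (g :: complex fps)"
proof -
  have a: "a * inverse a = 1" using assms(3) by (simp add: inverse_mult_eq_1')
  have "h = (b * inverse a) * dil 2 h" if "h * a = b * dil 2 h" for h
  proof -
    have "h = (h * a) * inverse a" by (simp add: mult.assoc a)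
    thus ?thesis unfolding that by (simp only: mult_ac)
  qed
  from fps_eq_of_dil[OF this[OF assms(1)] this[OF assms(2)] assms(4,5)] show ?thesis .
qed

lemma dil_inj:
  assumes "m > 0" "dil m f = dil m g"
  shows "f = g"
proof (rule fps_ext)
  fix n
  show "f $ n = g $ n"
    using arg_cong[OF assms(2), of "\<lambda>h. h $ (m * n)"] assms(1) by (simp add: dil_nth)
qed

lemma dil_compose: "m > 0 \<Longrightarrow> t $ 0 = 0 \<Longrightarrow> dil m (f oo t) = f oo dil m t"
  by (simp add: dil_def fps_compose_assoc)

lemma sc_dil: "c ^ m = 1 \<Longrightarrow> m > 0 \<Longrightarrow> sc c (dil m f) = dil m f"
  by (rule fps_ext) (auto simp: sc_nth dil_nth power_mult elim!: dvdE)

lemma sc_minus1_twice: "sc (-1) (sc (-1) f) = f"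
  by (rule fps_ext) (simp add: sc_nth flip: mult.assoc power_add)

lemma int_theta: "(\<And>j. \<sigma> j \<in> \<int>) \<Longrightarrow> int_fps (theta e \<sigma>)"
  by (simp add: int_fps_def theta_def Ints_sum)

lemma int_phi: "int_fps \<phi>" "int_fps \<phi>m" "int_fps \<psi>"
  unfolding \<phi>_def \<phi>m_def \<psi>_def by (rule int_theta; simp)+

lemma phi_0 [simp]: "\<phi> $ 0 = 1" "\<phi>m $ 0 = 1" "\<psi> $ 0 = 1"
  using arg_cong[OF phi_prod, of "\<lambda>f. f $ 0"] arg_cong[OF phim_prod, of "\<lambda>f. f $ 0"]
    arg_cong[OF psi_prod, of "\<lambda>f. f $ 0"] by (simp_all add: fps_power_zeroth)

lemma fps_nonzeroI: "f $ 0 = (1 :: complex) \<Longrightarrow> f \<noteq> 0"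
  by auto

section \<open>Level 8\<close>

lemma dil_products:
  "dil 2 \<phi> * (Eu 2 ^ 2 * Eu 8 ^ 2) = Eu 4 ^ 5" "dil 2 \<phi>m * Eu 4 = Eu 2 ^ 2" "dil 4 \<psi> * Eu 4 = Eu 8 ^ 2"
  using arg_cong[OF phi_prod, of "dil 2"] arg_cong[OF phim_prod, of "dil 2"] arg_cong[OF psi_prod, of "dil 4"]
  by (simp_all add: dil_mult dil_power)

lemma phi_times_phim: "\<phi> * \<phi>m = dil 2 \<phi>m ^ 2"
proof -
  have "(\<phi> * \<phi>m) * (Eu 1 ^ 2 * Eu 4 ^ 2 * Eu 2) = (\<phi> * (Eu 1 ^ 2 * Eu 4 ^ 2)) * (\<phi>m * Eu 2)"
    by (simp only: mult_ac)
  also have "\<dots> = (dil 2 \<phi>m * Eu 4) ^ 2 * (Eu 1 ^ 2 * Eu 2)"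
    unfolding phi_prod phim_prod dil_products by algebra
  also have "\<dots> = dil 2 \<phi>m ^ 2 * (Eu 1 ^ 2 * Eu 4 ^ 2 * Eu 2)"
    by (simp only: mult_ac power_mult_distrib)
  finally show ?thesis by simp
qed

lemma sc_phi: "sc (-1) \<phi> = \<phi>m"
proof -
  define s where "s = sc (-1) (Eu 1)"
  have s: "s * (Eu 1 * Eu 4) = Eu 2 ^ 3" unfolding s_def by (rule sc_minus1_Eu1)
  have s0: "s \<noteq> 0" by (rule fps_nonzeroI) (simp add: s_def)
  have 1: "sc (-1) \<phi> * (s ^ 2 * Eu 4 ^ 2) = Eu 2 ^ 5"
    using arg_cong[OF phi_prod, of "sc (-1)"]
    by (simp add: sc_mult sc_power sc_Eu_dvd s_def)
  have "sc (-1) \<phi> * (s ^ 2 * Eu 4 ^ 2 * (Eu 1 ^ 2 * Eu 2)) = (sc (-1) \<phi> * (s ^ 2 * Eu 4 ^ 2)) * (Eu 1 ^ 2 * Eu 2)"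
    by (simp only: mult_ac)
  also have "\<dots> = (\<phi>m * Eu 2) * (s * (Eu 1 * Eu 4)) ^ 2"
    unfolding 1 phim_prod s by algebra
  also have "\<dots> = \<phi>m * (s ^ 2 * Eu 4 ^ 2 * (Eu 1 ^ 2 * Eu 2))"
    by (simp only: mult_ac power_mult_distrib)
  finally show ?thesis using s0 by simp
qed

lemma phim_dissect2: "\<phi>m = dil 4 \<phi> - 2 * fps_X * dil 8 \<psi>"
proof -
  have "sc (-1) fps_X = - fps_X" by (simp add: sc_X flip: fps_const_neg)
  moreover have "sc (-1) \<phi> = sc (-1) (dil 4 \<phi> + 2 * fps_X * dil 8 \<psi>)" by (simp flip: phi_dissect)
  ultimately show ?thesis by (simp add: sc_phi sc_add sc_mult sc_dil)
qed

text \<open>Multiplying the dissections of \<open>\<phi>(q)\<close> and \<open>\<phi>(-q)\<close>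
  gives \<open>\<phi>(q^4)^2 - 4 q^2 \<psi>(q^8)^2\<close>, while the product formulas give
  \<open>\<phi>(-q^2)^2\<close>. Both are series in \<open>q^2\<close>.\<close>

lemma phim_square: "\<phi>m ^ 2 = dil 2 \<phi> ^ 2 - 4 * fps_X * dil 4 \<psi> ^ 2"
proof (rule dil_inj[of 2, OF zero_less_numeral])
  have "\<phi> * \<phi>m = (dil 4 \<phi> + 2 * fps_X * dil 8 \<psi>) * (dil 4 \<phi> - 2 * fps_X * dil 8 \<psi>)"
    by (simp flip: phi_dissect phim_dissect2)
  thus "dil 2 (\<phi>m ^ 2) = dil 2 (dil 2 \<phi> ^ 2 - 4 * fps_X * dil 4 \<psi> ^ 2)"
    unfolding phi_times_phim
    by (simp add: dil_power dil_diff dil_mult dil_dil dil_X) (simp add: algebra_simps power2_eq_square)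
qed

lemma phi_square: "\<phi> ^ 2 = dil 2 \<phi> ^ 2 + 4 * fps_X * dil 4 \<psi> ^ 2"
proof -
  have X: "sc (-1) fps_X = - fps_X" by (simp add: sc_X flip: fps_const_neg)
  have m: "sc (-1) \<phi>m = \<phi>" using sc_minus1_twice[of \<phi>] by (simp add: sc_phi)
  show ?thesis using arg_cong[OF phim_square, of "sc (-1)"]
    by (simp add: sc_power sc_diff sc_mult sc_dil X m)
qed

definition t8 :: "complex fps" where "t8 = fps_X * (dil 4 \<psi> * inverse \<phi>) ^ 2"

lemma phi_inverse: "\<phi> * inverse \<phi> = 1"
  by (rule inverse_mult_eq_1') simp

lemma t8_0 [simp]: "t8 $ 0 = 0"
  by (simp add: t8_def)

lemma t8_phi: "t8 * \<phi> ^ 2 = fps_X * dil 4 \<psi> ^ 2"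
proof -
  have "t8 * \<phi> ^ 2 = fps_X * dil 4 \<psi> ^ 2 * (\<phi> * inverse \<phi>) ^ 2"
    by (simp add: t8_def power_mult_distrib mult_ac)
  thus ?thesis by (simp add: phi_inverse)
qed

text \<open>With \<open>t8_8\<close>, this writes the factors \<open>1 - 4x\<close> and
  \<open>1 - 8x\<close> of the leading coefficient \<open>1 - 12x + 32x^2\<close> of the equation of
  \<open>gen E\<close> as theta quotients.\<close>

lemma t8_4: "(1 - 4 * t8) * \<phi> ^ 2 = dil 2 (\<phi> ^ 2)"
  unfolding dil_power[OF zero_less_numeral] using t8_phi phi_square by algebra

lemma t8_8: "(1 - 8 * t8) * \<phi> ^ 2 = \<phi>m ^ 2"
  using t8_phi phi_square phim_square by algebra

lemma t8_dil_8: "(1 - 8 * dil 2 t8) * dil 2 (\<phi> ^ 2) = \<phi> * \<phi>m"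
proof -
  have "(1 - 8 * dil 2 t8) * dil 2 (\<phi> ^ 2) = dil 2 (\<phi>m ^ 2)"
    using arg_cong[OF t8_8, of "dil 2"] by (simp add: dil_mult dil_diff)
  thus ?thesis by (simp add: dil_power phi_times_phim)
qed

text \<open>Since \<open>16 T (1 - 4 T) = 1 - (1 - 8 T)^2\<close>, the left-hand side is a
  difference of squares that the theta quotients express by \<open>t8\<close>; what remains is
  \<open>(1 - 4 t)^2 - (1 - 8 t) = 16 t^2\<close>.\<close>

lemma t8_modular: "dil 2 t8 * (1 - 4 * dil 2 t8) * (1 - 4 * t8) ^ 2 = t8 ^ 2"
proof -
  define T where "T = dil 2 t8"
  define Z2 where "Z2 = dil 2 (\<phi> ^ 2)"
  have "(16 * \<phi> ^ 4) * (T * (1 - 4 * T) * (1 - 4 * t8) ^ 2) = ((1 - 4 * t8) * \<phi> ^ 2) ^ 2 * (16 * (T * (1 - 4 * T)))"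
    by algebra
  also have "\<dots> = Z2 ^ 2 - ((1 - 8 * T) * Z2) ^ 2"
    unfolding t8_4 Z2_def[symmetric] by algebra
  also have "\<dots> = ((1 - 4 * t8) * \<phi> ^ 2) ^ 2 - \<phi> ^ 2 * ((1 - 8 * t8) * \<phi> ^ 2)"
    unfolding T_def Z2_def t8_dil_8 t8_4 t8_8 by algebra
  also have "\<dots> = (16 * \<phi> ^ 4) * t8 ^ 2" by algebra
  finally have "(16 * \<phi> ^ 4) * (T * (1 - 4 * T) * (1 - 4 * t8) ^ 2) = (16 * \<phi> ^ 4) * t8 ^ 2" .
  moreover have "16 * \<phi> ^ 4 \<noteq> 0" using fps_nonzeroI[OF phi_0(1)] by simp
  ultimately show ?thesis unfolding T_def by (subst (asm) mult_cancel_left) blast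
qed

text \<open>Differentiating \<open>t8_modular\<close> yields
  \<open>L (1 - 4 T) = (1 - 4 t) (1 - 8 T) L(q^2)\<close>. The theta quotients show that the product
  \<open>L0\<close> on the right satisfies the same equation.\<close>

lemma t8_log_deriv: "\<theta> t8 = t8 * (\<phi>m ^ 2 * dil 2 (\<phi> ^ 2))"
proof -
  obtain L where L: "\<theta> t8 = t8 * L" "L $ 0 = 1"
    using log_deriv_exists[of "(dil 4 \<psi> * inverse \<phi>) ^ 2"] by (auto simp: t8_def fps_power_zeroth)
  define T where "T = dil 2 t8"
  define L2 where "L2 = dil 2 L"
  have T: "\<theta> T = 2 * T * L2" unfolding T_def \<theta>_dil2 L by (simp add: dil_mult L2_def)
  have T0: "T \<noteq> 0" "(1 - 4 * t8) \<noteq> 0"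
  proof -
    have "t8 \<noteq> 0" using t8_phi phi_0 fps_nonzeroI[of "dil 4 \<psi>"] by auto
    thus "T \<noteq> 0" unfolding T_def using dil_inj[of 2 t8 0] by (auto simp: dil_def)
    show "(1 - 4 * t8) \<noteq> 0" by (rule fps_nonzeroI) simp
  qed
  have m: "T * (1 - 4 * T) * (1 - 4 * t8) ^ 2 = t8 ^ 2"
    unfolding T_def by (rule t8_modular)
  have "\<theta> (T * (1 - 4 * T) * (1 - 4 * t8) ^ 2) = \<theta> (t8 ^ 2)" by (simp only: m)
  hence d: "(2 * T * L2 * (1 - 4 * T) + T * (- (4 * (2 * T * L2)))) * (1 - 4 * t8) ^ 2 +
      T * (1 - 4 * T) * (2 * (1 - 4 * t8) * (- (4 * (t8 * L)))) = 2 * t8 * (t8 * L)"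
    by (simp only: \<theta>_mult \<theta>_diff \<theta>_power2 \<theta>_1 \<theta>_numeral L(1) T diff_0 mult_zero_left add_0_left)
  \<comment> \<open>By \<open>m\<close> the term in \<open>t8 ^ 2\<close> becomes a multiple of
    \<open>T * (1 - 4 * T)\<close>; the two terms in \<open>L\<close> then combine by
    \<open>(1 - 4 t) + 4 t = 1\<close>.\<close>
  have "(2 * T * (1 - 4 * t8) ^ 2) * (L * (1 - 4 * T)) = (2 * T * (1 - 4 * t8) ^ 2) * (((1 - 4 * t8) * (1 - 8 * T)) * L2)"
    using m d by algebra
  hence LT: "L * (1 - 4 * T) = ((1 - 4 * t8) * (1 - 8 * T)) * L2"
    using T0 by (subst (asm) mult_cancel_left) auto
  define L0 where "L0 = \<phi>m ^ 2 * dil 2 (\<phi> ^ 2)"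
  have t2: "(1 - 4 * T) * dil 2 (\<phi> ^ 2) = dil 4 (\<phi> ^ 2)"
    using arg_cong[OF t8_4, of "dil 2"] by (simp add: dil_mult dil_diff T_def dil_dil)
  have "dil 2 L0 = (\<phi> * \<phi>m) * dil 4 (\<phi> ^ 2)"
    by (simp add: L0_def dil_mult dil_dil dil_power phi_times_phim)
  moreover have "dil 2 (\<phi> ^ 2) * (L0 * (1 - 4 * T)) = dil 2 (\<phi> ^ 2) * (((1 - 4 * t8) * (1 - 8 * T)) * ((\<phi> * \<phi>m) * dil 4 (\<phi> ^ 2)))"
  proof -
    have "z2 * (m ^ 2 * z2 * (1 - 4 * r)) = z2 * (((1 - 4 * t) * (1 - 8 * r)) * ((f * m) * z4))"
      if "(1 - 4 * r) * z2 = z4" "(1 - 4 * t) * f ^ 2 = z2" "(1 - 8 * r) * z2 = f * m" for r t f m z2 z4 :: "complex fps"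
    proof -
      have "z2 * (((1 - 4 * t) * (1 - 8 * r)) * ((f * m) * z4)) = ((1 - 8 * r) * z2) * ((1 - 4 * t) * f * m * z4)"
        by (simp only: mult_ac)
      also have "\<dots> = ((1 - 4 * t) * f ^ 2) * m ^ 2 * z4"
        unfolding that(3) by (simp only: power2_eq_square mult_ac)
      also have "\<dots> = z2 * (m ^ 2 * z2 * (1 - 4 * r))"
        unfolding that(2) that(1)[symmetric] by (simp only: mult_ac)
      finally show ?thesis ..
    qed
    from this[OF t2 t8_4 t8_dil_8[folded T_def]] show ?thesis by (simp only: L0_def)
  qed
  moreover have "dil 2 (\<phi> ^ 2) \<noteq> 0" by (rule fps_nonzeroI) (simp add: fps_power_zeroth)
  ultimately have L0T: "L0 * (1 - 4 * T) = ((1 - 4 * t8) * (1 - 8 * T)) * dil 2 L0"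
    by simp
  have "L = L0"
    by (rule fps_eq_of_dil'[OF LT[unfolded L2_def] L0T]) (simp_all add: T_def L L0_def fps_power_zeroth)
  thus ?thesis using L(1) by (simp add: L0_def)
qed

lemma compose_gen_E1: "t $ 0 = 0 \<Longrightarrow> gen E oo t = F2 oo (t * (1 - 4 * t))"
  unfolding gen_E_compose1
  by (subst fps_compose_assoc[symmetric]) (simp_all add: fps_compose_mult_distrib fps_compose_sub_distrib)

lemma compose_gen_E2:
  "t $ 0 = 0 \<Longrightarrow> gen E oo t = inverse (1 - 4 * t) * (F2 oo (t ^ 2 * inverse (1 - 4 * t) ^ 2))"
  unfolding gen_E_compose2
  by (simp add: fps_compose_mult_distrib fps_compose_assoc[symmetric] fps_compose_sub_distrib
     fps_inverse_compose fps_compose_power[symmetric] power2_eq_square)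

text \<open>By \<open>t8_modular\<close> the argument of \<open>F2\<close> in
  \<open>compose_gen_E1\<close> at \<open>q^2\<close> is that in \<open>compose_gen_E2\<close> at
  \<open>q\<close>, so \<open>gen E oo t8\<close> acquires the functional equation that
  \<open>t8_4\<close> states for \<open>\<phi> ^ 2\<close>.\<close>

lemma gen_E_t8: "gen E oo t8 = \<phi> ^ 2"
proof -
  define i where "i = inverse (1 - 4 * t8)"
  have i: "(1 - 4 * t8) * i = 1" unfolding i_def by (rule inverse_mult_eq_1') simp
  have "dil 2 (gen E oo t8) = F2 oo (dil 2 t8 * (1 - 4 * dil 2 t8))"
    by (simp add: dil_compose compose_gen_E1 dil_mult dil_diff)
  also have "dil 2 t8 * (1 - 4 * dil 2 t8) = dil 2 t8 * (1 - 4 * dil 2 t8) * ((1 - 4 * t8) * i) ^ 2"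
    by (simp add: i)
  also have "\<dots> = t8 ^ 2 * i ^ 2"
    unfolding t8_modular[symmetric] by (simp only: power_mult_distrib mult_ac)
  finally have d: "dil 2 (gen E oo t8) = F2 oo (t8 ^ 2 * i ^ 2)" .
  have "(gen E oo t8) * (1 - 4 * t8) = ((1 - 4 * t8) * i) * (F2 oo (t8 ^ 2 * i ^ 2))"
    by (simp add: compose_gen_E2 i_def mult_ac)
  hence "(gen E oo t8) * (1 - 4 * t8) = 1 * dil 2 (gen E oo t8)" by (simp only: d i)
  moreover have "\<phi> ^ 2 * (1 - 4 * t8) = 1 * dil 2 (\<phi> ^ 2)" using t8_4 by (simp add: mult_ac)
  ultimately show ?thesis
    by (rule fps_eq_of_dil') (simp_all add: fps_power_zeroth)
qed

text \<open>\<open>H\<close> is the even half of \<open>f_E / q\<close>, see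
  \<open>gamma_E_odd\<close>. It equals
  \<open>u Z L = \<psi>(q^4) \<phi>(q) \<phi>(-q)^2 \<phi>(q^2)^2\<close>.\<close>

theorem eta_quotient_cong_E:
  assumes H: "H * (Eu 2 * Eu 8 ^ 2) = Eu 1 ^ 2 * Eu 4 ^ 7" and p: "prime p" "odd p"
    and z: "H $ ((p - 1) div 2) = of_int z"
  shows "[C_seq E ((p - 1) div 2) = z] (mod int p)"
proof (rule coeff_cong_of_log_deriv[OF _ _ t8_def _ _ p z])
  show "int_fps (dil 4 \<psi> * inverse \<phi>)"
    by (intro int_fps_mult int_fps_dil int_fps_inverse int_phi) simp_all
  show "fps_X * fps_deriv t8 = t8 * (\<phi>m ^ 2 * dil 2 (\<phi> ^ 2))"
    using t8_log_deriv by (simp add: \<theta>_def)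
  have "dil 4 \<psi> * inverse \<phi> * (gen E oo t8) * (\<phi>m ^ 2 * dil 2 (\<phi> ^ 2)) =
    (\<phi> * inverse \<phi>) * (dil 4 \<psi> * \<phi> * \<phi>m ^ 2 * dil 2 \<phi> ^ 2)"
    by (simp add: gen_E_t8 power2_eq_square dil_mult mult_ac)
  also have "\<dots> = dil 4 \<psi> * \<phi> * \<phi>m ^ 2 * dil 2 \<phi> ^ 2" by (simp add: phi_inverse)
  also have "\<dots> = H"
  proof -
    \<comment> \<open>\<open>K\<close> collects the denominators of the product formulas of all the
      theta factors.\<close>
    define K where "K = Eu 4 * (Eu 1 ^ 2 * Eu 4 ^ 2) * Eu 2 ^ 2 * (Eu 2 ^ 2 * Eu 8 ^ 2) ^ 2"
    have "(dil 4 \<psi> * \<phi> * \<phi>m ^ 2 * dil 2 \<phi> ^ 2) * K =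
       (dil 4 \<psi> * Eu 4) * (\<phi> * (Eu 1 ^ 2 * Eu 4 ^ 2)) * (\<phi>m * Eu 2) ^ 2 * (dil 2 \<phi> * (Eu 2 ^ 2 * Eu 8 ^ 2)) ^ 2"
      by (simp only: K_def power_mult_distrib mult_ac)
    also have "\<dots> = (H * (Eu 2 * Eu 8 ^ 2)) * (Eu 1 ^ 2 * Eu 2 ^ 5 * Eu 4 ^ 3 * Eu 8 ^ 2)"
      unfolding dil_products phi_prod phim_prod H by algebra
    also have "\<dots> = H * K" unfolding K_def by algebra
    finally show ?thesis by (simp add: K_def)
  qed
  finally show "H = dil 4 \<psi> * inverse \<phi> * (Abs_fps (\<lambda>n. of_int (C_seq E n)) oo t8) * (\<phi>m ^ 2 * dil 2 (\<phi> ^ 2))"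
    by (simp add: gen_def)
qed simp

section \<open>Level 4\<close>

text \<open>The binomial series of \<open>(1 - 16 x)^(-1/2)\<close>. At
  \<open>x = t (1 - 4 t)\<close> the radicand is the square \<open>(1 - 8 t)^2\<close>, so
  composition makes it rational in \<open>t8\<close>.\<close>

definition cbin :: "complex fps" where "cbin = Abs_fps (\<lambda>n. of_nat ((2 * n) choose n) * 4 ^ n)"

text \<open>The recurrence of the central binomials gives the first order equation
  \<open>ode\<close>, by which the left-hand side has derivative 0.\<close>

lemma cbin_square: "cbin ^ 2 * (1 - 16 * fps_X) = 1"
proof -
  have ode: "\<theta> cbin * (1 - 16 * fps_X) = 8 * fps_X * cbin"
  proof (rule fps_ext)
    fix n
    show "(\<theta> cbin * (1 - 16 * fps_X)) $ n = (8 * fps_X * cbin) $ n"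
    proof (cases n)
      case (Suc k)
      have "of_nat (k + 1) * of_nat ((2 * (k + 1)) choose (k + 1)) * 4 ^ (k + 1) =
        2 * (2 * of_nat k + 1) * (of_nat ((2 * k) choose k) :: complex) * 4 ^ (k + 1)"
        by (simp only: central_binomial_Suc)
      moreover have "(\<theta> cbin * (1 - 16 * fps_X)) $ n = of_nat (k + 1) * of_nat ((2 * (k + 1)) choose (k + 1)) * 4 ^ (k + 1)
          - 16 * (of_nat k * (of_nat ((2 * k) choose k) * 4 ^ k))"
      proof -
        have "\<theta> cbin * (1 - 16 * fps_X) = \<theta> cbin - 16 * (fps_X * \<theta> cbin)" by (simp add: algebra_simps)
        thus ?thesis by (simp add: Suc \<theta>_nth cbin_def numeral_fps_const)
      qed
      moreover have "(8 * fps_X * cbin) $ n = 8 * (of_nat ((2 * k) choose k) * 4 ^ k)"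
        by (simp add: Suc cbin_def numeral_fps_const mult.assoc)
      ultimately show ?thesis by (simp add: algebra_simps)
    qed (simp add: \<theta>_nth)
  qed
  have X: "\<theta> fps_X = fps_X" by (simp add: \<theta>_def)
  have "\<theta> (cbin ^ 2 * (1 - 16 * fps_X)) = 2 * cbin * (\<theta> cbin * (1 - 16 * fps_X)) - 16 * fps_X * cbin ^ 2"
    by (simp add: \<theta>_mult \<theta>_power2 \<theta>_diff X algebra_simps)
  also have "\<dots> = 0" unfolding ode by (simp add: algebra_simps power2_eq_square)
  finally have "of_nat n * (cbin ^ 2 * (1 - 16 * fps_X)) $ n = 0" for n
    using \<theta>_nth[of "cbin ^ 2 * (1 - 16 * fps_X)" n] by simp
  hence 0: "(cbin ^ 2 * (1 - 16 * fps_X)) $ n = 0" if "n > 0" for n using that by (metis mult_eq_0_iff of_nat_eq_0_iff less_numeral_extra(3))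
  have "cbin $ 0 = 1" by (simp add: cbin_def)
  thus ?thesis
    by (intro fps_ext, case_tac "n = 0") (simp_all add: 0 fps_power_zeroth)
qed

lemma fps_square_eq_1: "f ^ 2 = (1 :: complex fps) \<Longrightarrow> f $ 0 = 1 \<Longrightarrow> f = 1"
  by (metis power2_eq_1_iff fps_neg_nth fps_one_nth one_neq_neg_one)

text \<open>The coefficients of \<open>F2 * cbin\<close>. It stands in for both
  \<open>C_seq B\<close> and \<open>C_seq D\<close>, to which it is only congruent modulo
  \<open>p\<close> at \<open>n = (p - 1) div 2\<close>.\<close>

definition seq_D :: "nat \<Rightarrow> int" where
  "seq_D n = (\<Sum>k=0..n. int ((2 * k) choose k) ^ 2 * (int ((2 * (n - k)) choose (n - k)) * 4 ^ (n - k)))"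

text \<open>The uniformizer is \<open>y = t8 (1 - 4 t8)\<close>. By \<open>t8_4\<close> the new
  factor is the square of \<open>\<phi>(q^2) / \<phi>(q)\<close>, so \<open>y\<close> is again
  \<open>q\<close> times a square; by \<open>t8_4\<close> and \<open>t8_8\<close> its logarithmic
  derivative simplifies to \<open>\<phi>(-q)^4\<close>.\<close>

theorem eta_quotient_cong_D:
  assumes p: "prime p" "odd p" and z: "(Eu 2 ^ 6) $ ((p - 1) div 2) = of_int z"
  shows "[seq_D ((p - 1) div 2) = z] (mod int p)"
proof -
  define u where "u = dil 4 \<psi> * dil 2 \<phi> * inverse \<phi> ^ 2"
  define y where "y = t8 * (1 - 4 * t8)"
  have y0: "y $ 0 = 0" by (simp add: y_def)
  have phi2: "\<phi> ^ 2 \<noteq> 0" using fps_nonzeroI[OF phi_0(1)] by simp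
  have gD: "Abs_fps (\<lambda>n. of_int (seq_D n)) = F2 * cbin"
    by (rule fps_ext) (simp add: fps_mult_nth seq_D_def F2_def cbin_def)
  define q where "q = cbin oo y"
  have "(q * (1 - 8 * t8)) ^ 2 = 1"
  proof -
    have "(cbin ^ 2 * (1 - 16 * fps_X)) oo y = 1" by (simp add: cbin_square)
    hence "q ^ 2 * (1 - 16 * y) = 1"
      using y0 by (simp add: fps_compose_mult_distrib fps_compose_sub_distrib fps_compose_power[symmetric] q_def)
    thus ?thesis unfolding y_def by algebra
  qed
  hence q: "q * (1 - 8 * t8) = 1"
    by (rule fps_square_eq_1) (simp add: q_def cbin_def)
  have F2y: "F2 oo y = \<phi> ^ 2" using gen_E_t8 compose_gen_E1[of t8] by (simp add: y_def)
  show ?thesis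
  proof (rule coeff_cong_of_log_deriv[where t = y and L = "\<phi>m ^ 4", OF _ _ _ _ _ p z])
    show "int_fps u" unfolding u_def
      by (intro int_fps_mult int_fps_dil int_fps_inverse int_fps_power int_phi) simp_all
    show "u $ 0 = 1" by (simp add: u_def fps_power_zeroth)
    show "y = fps_X * u ^ 2"
    proof -
      have "\<phi> ^ 2 * (1 - 4 * t8) = dil 2 \<phi> ^ 2" using t8_4 by (simp add: dil_power mult_ac)
      hence "(1 - 4 * t8) = dil 2 \<phi> ^ 2 * inverse \<phi> ^ 2"
        using phi_inverse by algebra
      thus ?thesis unfolding y_def u_def by (simp add: t8_def power_mult_distrib mult_ac)
    qed
    show "fps_X * fps_deriv y = y * \<phi>m ^ 4"
    proof -
      have "\<theta> y = t8 * (1 - 8 * t8) * (\<phi>m ^ 2 * dil 2 (\<phi> ^ 2))"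
        unfolding y_def by (simp add: \<theta>_mult \<theta>_diff t8_log_deriv algebra_simps)
      hence "\<phi> ^ 2 * \<theta> y = \<phi> ^ 2 * (y * \<phi>m ^ 4)"
        unfolding y_def using t8_4 t8_8 by algebra
      thus ?thesis using phi2 by (simp add: \<theta>_def)
    qed
    have c: "(Abs_fps (\<lambda>n. of_int (seq_D n)) oo y) = \<phi> ^ 2 * q"
      unfolding gD using y0 by (simp add: fps_compose_mult_distrib F2y q_def)
    have "u * (\<phi> ^ 2 * q) * \<phi>m ^ 4 = dil 4 \<psi> * dil 2 \<phi> * \<phi> ^ 2 * \<phi>m ^ 2"
      unfolding u_def using q t8_8 phi_inverse by algebra
    also have "\<dots> = Eu 2 ^ 6"
    proof -
      define K where "K = Eu 4 * (Eu 2 ^ 2 * Eu 8 ^ 2) * (Eu 1 ^ 2 * Eu 4 ^ 2) ^ 2 * Eu 2 ^ 2"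
      have "(dil 4 \<psi> * dil 2 \<phi> * \<phi> ^ 2 * \<phi>m ^ 2) * K =
        (dil 4 \<psi> * Eu 4) * (dil 2 \<phi> * (Eu 2 ^ 2 * Eu 8 ^ 2)) * (\<phi> * (Eu 1 ^ 2 * Eu 4 ^ 2)) ^ 2 * (\<phi>m * Eu 2) ^ 2"
        by (simp only: K_def power_mult_distrib mult_ac)
      also have "\<dots> = Eu 2 ^ 6 * K"
        unfolding dil_products phi_prod phim_prod K_def by algebra
      finally show ?thesis by (simp add: K_def)
    qed
    finally show "Eu 2 ^ 6 = u * (Abs_fps (\<lambda>n. of_int (seq_D n)) oo y) * \<phi>m ^ 4"
      by (simp only: c)
  qed
qed

section \<open>Level 6\<close>

lemma cube_root_exists: "\<exists>w :: complex. w ^ 2 + w + 1 = 0"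
  by (rule exI[of _ "Complex (- 1 / 2) (sqrt 3 / 2)"]) (simp add: complex_eq_iff power2_eq_square)

lemma sc_dil3: "w ^ 2 + w + 1 = 0 \<Longrightarrow> sc w (dil 3 f) = dil 3 f"
  by (rule sc_dil) (simp_all add: cube_root_of_unity)

lemma sc_square: "sc (w ^ 2) f = sc w (sc w f)"
  by (rule fps_ext) (simp add: sc_nth power_mult[symmetric] power_add[symmetric] mult_2 flip: mult.assoc)

text \<open>\<open>sc w\<close> fixes series in \<open>q^3\<close> and multiplies \<open>q\<close>
  by \<open>w\<close>, so the three factors are \<open>a + b\<close>, \<open>a + w b\<close>,
  \<open>a + w^2 b\<close> with product \<open>a^3 + b^3\<close>.\<close>

lemma cube_norm:
  assumes w: "w ^ 2 + w + 1 = 0"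
  shows "(dil 3 f + fps_const d * fps_X * dil 3 g) * sc w (dil 3 f + fps_const d * fps_X * dil 3 g)
     * sc (w ^ 2) (dil 3 f + fps_const d * fps_X * dil 3 g) = dil 3 (f ^ 3 + fps_const d ^ 3 * fps_X * g ^ 3)"
proof -
  define v where "v = fps_const w"
  have v: "v ^ 2 + v + 1 = 0"
    using w unfolding v_def by (simp flip: fps_const_1_eq_1)
  define a b where "a = dil 3 f" and "b = fps_const d * fps_X * dil 3 g"
  have 1: "sc w (a + b) = a + v * b"
    by (simp add: a_def b_def sc_add sc_mult sc_dil3[OF w] sc_X v_def mult_ac del: fps_const_mult)
  have "sc w (v * b) = v * (v * b)"
    by (simp add: v_def b_def sc_mult sc_dil3[OF w] sc_X mult_ac del: fps_const_mult)
  moreover have "sc (w ^ 2) (a + b) = sc w a + sc w (v * b)" by (simp only: sc_square 1 flip: sc_add)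
  ultimately have 2: "sc (w ^ 2) (a + b) = a + v * (v * b)"
    by (simp add: a_def sc_dil3[OF w])
  have "(a + b) * (a + v * b) * (a + v * (v * b)) = a ^ 3 + b ^ 3"
    using v by algebra
  also have "\<dots> = dil 3 (f ^ 3 + fps_const d ^ 3 * fps_X * g ^ 3)"
    by (simp only: a_def b_def dil_add dil_mult dil_power dil_X dil_const power_mult_distrib zero_less_numeral mult_ac)
  finally have "(a + b) * sc w (a + b) * sc (w ^ 2) (a + b) = dil 3 (f ^ 3 + fps_const d ^ 3 * fps_X * g ^ 3)"
    unfolding 1 2 .
  thus ?thesis by (simp only: a_def b_def)
qed

lemma dil3_products:
  "dil 3 \<psi> * Eu 3 = Eu 6 ^ 2" "dil 9 \<psi> * Eu 9 = Eu 18 ^ 2" "dil 3 \<phi>m * Eu 6 = Eu 3 ^ 2" "dil 9 \<phi>m * Eu 18 = Eu 9 ^ 2"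
  using arg_cong[OF psi_prod, of "dil 3"] arg_cong[OF psi_prod, of "dil 9"]
    arg_cong[OF phim_prod, of "dil 3"] arg_cong[OF phim_prod, of "dil 9"]
  by (simp_all add: dil_mult dil_power)

text \<open>The norm of \<open>\<psi>\<close> is computed twice: from its dissection by
  \<open>cube_norm\<close>, and from its product formula by \<open>Eu_cube_root_norm\<close>. Both
  results are series in \<open>q^3\<close>, so \<open>dil 3\<close> can be cancelled.\<close>

lemma psi_cubic: "(\<alpha> ^ 3 + fps_X * dil 3 \<psi> ^ 3) * dil 3 \<psi> = \<psi> ^ 4"
proof (rule dil_inj[of 3, OF zero_less_numeral])
  obtain w :: complex where w: "w ^ 2 + w + 1 = 0" using cube_root_exists by blast
  have d: "\<psi> = dil 3 \<alpha> + fps_const 1 * fps_X * dil 3 (dil 3 \<psi>)"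
    using psi_dissect by (simp add: dil_dil)
  define N where "N = \<psi> * sc w \<psi> * sc (w ^ 2) \<psi>"
  have N: "N = dil 3 (\<alpha> ^ 3 + fps_X * dil 3 \<psi> ^ 3)"
    unfolding N_def using cube_norm[OF w, of \<alpha> 1 "dil 3 \<psi>"] unfolding d[symmetric] by simp
  define N1 where "N1 = Eu 1 * sc w (Eu 1) * sc (w ^ 2) (Eu 1)"
  define N2 where "N2 = Eu 2 * sc w (Eu 2) * sc (w ^ 2) (Eu 2)"
  have E: "N1 * Eu 9 = Eu 3 ^ 4" "N2 * Eu 18 = Eu 6 ^ 4"
    using Eu_cube_root_norm[OF w, of 1] Eu_cube_root_norm[OF w, of 2] by (simp_all add: N1_def N2_def)
  have "N * N1 = (\<psi> * Eu 1) * sc w (\<psi> * Eu 1) * sc (w ^ 2) (\<psi> * Eu 1)"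
    unfolding N_def N1_def sc_mult by (simp only: mult_ac)
  also have "\<dots> = N2 ^ 2" unfolding psi_prod N2_def by (simp only: sc_power power_mult_distrib)
  finally have NN: "N * N1 = N2 ^ 2" .
  have "(N * dil 9 \<psi>) * (Eu 9 * Eu 3 ^ 4) = (N * N1) * (dil 9 \<psi> * Eu 9) * Eu 9"
    unfolding E[symmetric] by (simp only: mult_ac)
  also have "\<dots> = (N2 * Eu 18) ^ 2 * Eu 9" unfolding NN dil3_products by (simp only: power_mult_distrib mult_ac)
  also have "\<dots> = (dil 3 \<psi> * Eu 3) ^ 4 * Eu 9" unfolding E dil3_products by (simp flip: power_mult)
  also have "\<dots> = dil 3 \<psi> ^ 4 * (Eu 9 * Eu 3 ^ 4)" by (simp only: power_mult_distrib mult_ac)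
  finally have "N * dil 9 \<psi> = dil 3 \<psi> ^ 4" by simp
  thus "dil 3 ((\<alpha> ^ 3 + fps_X * dil 3 \<psi> ^ 3) * dil 3 \<psi>) = dil 3 (\<psi> ^ 4)"
    unfolding N by (simp only: dil_mult dil_power dil_dil zero_less_numeral) simp
qed

text \<open>The same double computation for \<open>\<phi>m\<close>; \<open>Eu 1\<close> and
  \<open>Eu 2\<close> exchange roles in the product formula.\<close>

lemma phim_cubic: "(dil 3 \<phi>m ^ 3 - 8 * fps_X * \<omega> ^ 3) * dil 3 \<phi>m = \<phi>m ^ 4"
proof (rule dil_inj[of 3, OF zero_less_numeral])
  obtain w :: complex where w: "w ^ 2 + w + 1 = 0" using cube_root_exists by blast
  have m2: "fps_const (- 2) = (- 2 :: complex fps)" by (simp add: numeral_fps_const flip: fps_const_neg)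
  have d: "\<phi>m = dil 3 (dil 3 \<phi>m) + fps_const (- 2) * fps_X * dil 3 \<omega>"
    unfolding m2 using phim_dissect by (simp add: dil_dil)
  define N where "N = \<phi>m * sc w \<phi>m * sc (w ^ 2) \<phi>m"
  have N: "N = dil 3 (dil 3 \<phi>m ^ 3 - 8 * fps_X * \<omega> ^ 3)"
    unfolding N_def using cube_norm[OF w, of "dil 3 \<phi>m" "-2" \<omega>] unfolding d[symmetric] unfolding m2 by simp
  define N1 where "N1 = Eu 1 * sc w (Eu 1) * sc (w ^ 2) (Eu 1)"
  define N2 where "N2 = Eu 2 * sc w (Eu 2) * sc (w ^ 2) (Eu 2)"
  have E: "N1 * Eu 9 = Eu 3 ^ 4" "N2 * Eu 18 = Eu 6 ^ 4"
    using Eu_cube_root_norm[OF w, of 1] Eu_cube_root_norm[OF w, of 2] by (simp_all add: N1_def N2_def)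
  have "N * N2 = (\<phi>m * Eu 2) * sc w (\<phi>m * Eu 2) * sc (w ^ 2) (\<phi>m * Eu 2)"
    unfolding N_def N2_def sc_mult by (simp only: mult_ac)
  also have "\<dots> = N1 ^ 2" unfolding phim_prod N1_def by (simp only: sc_power power_mult_distrib)
  finally have NN: "N * N2 = N1 ^ 2" .
  have "(N * dil 9 \<phi>m) * (Eu 18 * Eu 6 ^ 4) = (N * N2) * (dil 9 \<phi>m * Eu 18) * Eu 18"
    unfolding E[symmetric] by (simp only: mult_ac)
  also have "\<dots> = (N1 * Eu 9) ^ 2 * Eu 18" unfolding NN dil3_products by (simp only: power_mult_distrib mult_ac)
  also have "\<dots> = (dil 3 \<phi>m * Eu 6) ^ 4 * Eu 18" unfolding E dil3_products by (simp flip: power_mult)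
  also have "\<dots> = dil 3 \<phi>m ^ 4 * (Eu 18 * Eu 6 ^ 4)" by (simp only: power_mult_distrib mult_ac)
  finally have "N * dil 9 \<phi>m = dil 3 \<phi>m ^ 4" by simp
  thus "dil 3 ((dil 3 \<phi>m ^ 3 - 8 * fps_X * \<omega> ^ 3) * dil 3 \<phi>m) = dil 3 (\<phi>m ^ 4)"
    unfolding N by (simp only: dil_mult dil_power dil_dil zero_less_numeral) simp
qed

definition t6 :: "complex fps" where "t6 = fps_X * (dil 3 \<psi> ^ 2 * inverse \<psi> ^ 2) ^ 2"
text \<open>An eta quotient of weight one; its exponents make \<open>(1 - 9 t6) Z6^3\<close> and
  \<open>t6^2 (1 - t6) Z6^3\<close> series in \<open>q^2\<close> alone.\<close>

definition Z6 :: "complex fps" where "Z6 = Eu 2 ^ 6 * Eu 3 * inverse (Eu 1 ^ 3 * Eu 6 ^ 2)"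

lemma psi_inverse: "\<psi> * inverse \<psi> = 1"
  by (rule inverse_mult_eq_1') simp

lemma t6_0 [simp]: "t6 $ 0 = 0" and Z6_0 [simp]: "Z6 $ 0 = 1"
  by (simp_all add: t6_def Z6_def fps_power_zeroth)

lemma Z6_prod: "Z6 * (Eu 1 ^ 3 * Eu 6 ^ 2) = Eu 2 ^ 6 * Eu 3"
  unfolding Z6_def mult.assoc
  by (subst inverse_mult_eq_1) (simp_all add: fps_power_zeroth)

lemma t6_psi: "t6 * \<psi> ^ 4 = fps_X * dil 3 \<psi> ^ 4"
proof -
  have "t6 * \<psi> ^ 4 = fps_X * dil 3 \<psi> ^ 4 * (\<psi> * inverse \<psi>) ^ 4"
    unfolding t6_def by algebra
  thus ?thesis by (simp add: psi_inverse)
qed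

lemma t6_prod: "t6 * (Eu 2 ^ 8 * Eu 3 ^ 4) = fps_X * (Eu 6 ^ 8 * Eu 1 ^ 4)"
proof -
  have "t6 * (Eu 2 ^ 8 * Eu 3 ^ 4) = (t6 * \<psi> ^ 4) * (Eu 1 ^ 4 * Eu 3 ^ 4)"
    using psi_prod by algebra
  also have "\<dots> = fps_X * Eu 1 ^ 4 * (dil 3 \<psi> * Eu 3) ^ 4"
    unfolding t6_psi by algebra
  also have "\<dots> = fps_X * (Eu 6 ^ 8 * Eu 1 ^ 4)"
    unfolding dil3_products by algebra
  finally show ?thesis .
qed

text \<open>By \<open>psi_cubic\<close>, \<open>1 - t6\<close> is
  \<open>\<alpha>^3 \<psi>(q^3) / \<psi>^4\<close>; the rest is conversion into products.\<close>

lemma t6_1: "(1 - t6) * (Eu 2 ^ 5 * Eu 6) = Eu 3 ^ 5 * Eu 1"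
proof -
  have "(1 - t6) * \<psi> ^ 4 = \<alpha> ^ 3 * dil 3 \<psi>"
    using t6_psi psi_cubic by algebra
  hence "((1 - t6) * \<psi> ^ 4) * (Eu 1 ^ 4 * Eu 6 ^ 3 * Eu 3) = (\<alpha> * (Eu 1 * Eu 6)) ^ 3 * (dil 3 \<psi> * Eu 3) * Eu 1"
    by algebra
  hence "(1 - t6) * (\<psi> * Eu 1) ^ 4 * (Eu 6 ^ 3 * Eu 3) = (\<alpha> * (Eu 1 * Eu 6)) ^ 3 * (dil 3 \<psi> * Eu 3) * Eu 1"
    by (simp only: power_mult_distrib mult_ac)
  hence "(Eu 2 ^ 3 * Eu 6 ^ 2 * Eu 3) * ((1 - t6) * (Eu 2 ^ 5 * Eu 6)) = (Eu 2 ^ 3 * Eu 6 ^ 2 * Eu 3) * (Eu 3 ^ 5 * Eu 1)"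
    unfolding psi_prod alpha_prod dil3_products by algebra
  thus ?thesis by simp
qed

text \<open>Write \<open>1 - 9 t = (1 - t) - 8 t\<close>. With \<open>t6_1\<close> and
  \<open>t6_prod\<close> the identity becomes \<open>phim_cubic\<close> in terms of
  \<open>Eu\<close>.\<close>

lemma t6_9: "(1 - 9 * t6) * (Eu 2 ^ 9 * Eu 3 ^ 3) = Eu 1 ^ 9 * Eu 6 ^ 3"
proof -
  have "(\<phi>m * Eu 2) ^ 4 * (Eu 6 ^ 4 * Eu 3 ^ 3) = \<phi>m ^ 4 * (Eu 2 ^ 4 * Eu 6 ^ 4 * Eu 3 ^ 3)"
    by algebra
  also have "\<dots> = (dil 3 \<phi>m * Eu 6) ^ 4 * (Eu 2 ^ 4 * Eu 3 ^ 3)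
      - 8 * fps_X * (\<omega> * (Eu 2 * Eu 3)) ^ 3 * (dil 3 \<phi>m * Eu 6) * (Eu 6 ^ 3 * Eu 2)"
    unfolding phim_cubic[symmetric] by algebra
  finally have "Eu 3 ^ 2 * (Eu 1 ^ 8 * Eu 6 ^ 4 * Eu 3) =
      Eu 3 ^ 2 * (Eu 3 ^ 9 * Eu 2 ^ 4 - 8 * fps_X * Eu 1 ^ 3 * Eu 6 ^ 9 * Eu 2)"
    unfolding phim_prod dil3_products omega_prod by algebra
  hence *: "Eu 1 ^ 8 * Eu 6 ^ 4 * Eu 3 = Eu 3 ^ 9 * Eu 2 ^ 4 - 8 * fps_X * Eu 1 ^ 3 * Eu 6 ^ 9 * Eu 2"
    by (subst (asm) mult_cancel_left) simp
  have "(Eu 6 * Eu 3) * ((1 - 9 * t6) * (Eu 2 ^ 9 * Eu 3 ^ 3)) =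
     ((1 - t6) * (Eu 2 ^ 5 * Eu 6)) * (Eu 2 ^ 4 * Eu 3 ^ 4) - 8 * (t6 * (Eu 2 ^ 8 * Eu 3 ^ 4)) * (Eu 2 * Eu 6)"
    by algebra
  also have "\<dots> = Eu 1 * (Eu 3 ^ 9 * Eu 2 ^ 4 - 8 * fps_X * Eu 1 ^ 3 * Eu 6 ^ 9 * Eu 2)"
    unfolding t6_1 t6_prod by algebra
  also have "\<dots> = (Eu 6 * Eu 3) * (Eu 1 ^ 9 * Eu 6 ^ 3)"
    unfolding *[symmetric] by algebra
  finally show ?thesis by simp
qed

text \<open>The quotient \<open>Eu 2 ^ 9 / Eu 6 ^ 3\<close> is \<open>b(q^2)^3\<close> for the
  Borwein function \<open>b\<close>. It depends on \<open>q^2\<close> only and can also be expressed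
  by \<open>t6\<close> and \<open>Z6\<close> at \<open>q^2\<close>, which is
  \<open>t6_b_dil\<close>.\<close>

lemma t6_b: "(1 - 9 * t6) * Z6 ^ 3 * Eu 6 ^ 3 = Eu 2 ^ 9"
proof -
  have "(Eu 2 ^ 9 * Eu 3 ^ 3 * Eu 1 ^ 9 * Eu 6 ^ 3) * ((1 - 9 * t6) * Z6 ^ 3 * Eu 6 ^ 3) =
      ((1 - 9 * t6) * (Eu 2 ^ 9 * Eu 3 ^ 3)) * (Z6 * (Eu 1 ^ 3 * Eu 6 ^ 2)) ^ 3"
    by algebra
  also have "\<dots> = (Eu 2 ^ 9 * Eu 3 ^ 3 * Eu 1 ^ 9 * Eu 6 ^ 3) * Eu 2 ^ 9"
    unfolding t6_9 Z6_prod by algebra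
  finally show ?thesis by simp
qed

lemma t6_dil_products:
  "dil 2 Z6 * (Eu 2 ^ 3 * Eu 12 ^ 2) = Eu 4 ^ 6 * Eu 6"
  "dil 2 t6 * (Eu 4 ^ 8 * Eu 6 ^ 4) = fps_X ^ 2 * (Eu 12 ^ 8 * Eu 2 ^ 4)"
  "(1 - dil 2 t6) * (Eu 4 ^ 5 * Eu 12) = Eu 6 ^ 5 * Eu 2"
  "(1 - 9 * dil 2 t6) * (Eu 4 ^ 9 * Eu 6 ^ 3) = Eu 2 ^ 9 * Eu 12 ^ 3"
  using arg_cong[OF Z6_prod, of "dil 2"] arg_cong[OF t6_prod, of "dil 2"]
    arg_cong[OF t6_1, of "dil 2"] arg_cong[OF t6_9, of "dil 2"]
  by (simp_all add: dil_mult dil_power dil_diff dil_X)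

lemma t6_b_dil: "(1 - 9 * dil 2 t6) ^ 2 * dil 2 Z6 ^ 3 = (1 - 9 * t6) * Z6 ^ 3"
proof -
  define T Z2 where "T = dil 2 t6" and "Z2 = dil 2 Z6"
  have "(Eu 4 ^ 18 * Eu 6 ^ 3 * Eu 2 ^ 9 * Eu 12 ^ 6) * ((1 - 9 * T) ^ 2 * Z2 ^ 3 * Eu 6 ^ 3) =
      ((1 - 9 * T) * (Eu 4 ^ 9 * Eu 6 ^ 3)) ^ 2 * (Z2 * (Eu 2 ^ 3 * Eu 12 ^ 2)) ^ 3"
    by algebra
  also have "\<dots> = (Eu 4 ^ 18 * Eu 6 ^ 3 * Eu 2 ^ 9 * Eu 12 ^ 6) * Eu 2 ^ 9"
    unfolding T_def Z2_def t6_dil_products by algebra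
  finally have "(1 - 9 * T) ^ 2 * Z2 ^ 3 * Eu 6 ^ 3 = Eu 2 ^ 9" by simp
  hence "((1 - 9 * T) ^ 2 * Z2 ^ 3) * Eu 6 ^ 3 = ((1 - 9 * t6) * Z6 ^ 3) * Eu 6 ^ 3"
    by (simp only: t6_b)
  thus ?thesis by (simp add: T_def Z2_def)
qed

text \<open>Both sides are \<open>q^2 Eu 6 ^ 9 / Eu 2 ^ 3\<close>, which is
  \<open>c(q^2)^3 / 27\<close> for the Borwein function \<open>c\<close>.\<close>

lemma t6_c_dil: "dil 2 t6 * (1 - dil 2 t6) ^ 2 * dil 2 Z6 ^ 3 = t6 ^ 2 * (1 - t6) * Z6 ^ 3"
proof -
  define T Z2 where "T = dil 2 t6" and "Z2 = dil 2 Z6"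
  have "(Eu 4 ^ 18 * Eu 6 ^ 4 * Eu 12 ^ 8 * Eu 2 ^ 6) * (T * (1 - T) ^ 2 * Z2 ^ 3 * Eu 2 ^ 3) =
      (T * (Eu 4 ^ 8 * Eu 6 ^ 4)) * ((1 - T) * (Eu 4 ^ 5 * Eu 12)) ^ 2 * (Z2 * (Eu 2 ^ 3 * Eu 12 ^ 2)) ^ 3"
    by algebra
  also have "\<dots> = (Eu 4 ^ 18 * Eu 6 ^ 4 * Eu 12 ^ 8 * Eu 2 ^ 6) * (fps_X ^ 2 * Eu 6 ^ 9)"
    unfolding T_def Z2_def t6_dil_products by algebra
  finally have 1: "T * (1 - T) ^ 2 * Z2 ^ 3 * Eu 2 ^ 3 = fps_X ^ 2 * Eu 6 ^ 9" by simp
  have "(Eu 2 ^ 18 * Eu 3 ^ 8 * Eu 6 ^ 7 * Eu 1 ^ 9) * (t6 ^ 2 * (1 - t6) * Z6 ^ 3 * Eu 2 ^ 3) =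
      (t6 * (Eu 2 ^ 8 * Eu 3 ^ 4)) ^ 2 * ((1 - t6) * (Eu 2 ^ 5 * Eu 6)) * (Z6 * (Eu 1 ^ 3 * Eu 6 ^ 2)) ^ 3"
    by algebra
  also have "\<dots> = (Eu 2 ^ 18 * Eu 3 ^ 8 * Eu 6 ^ 7 * Eu 1 ^ 9) * (fps_X ^ 2 * Eu 6 ^ 9)"
    unfolding t6_1 t6_prod Z6_prod by algebra
  finally have 2: "t6 ^ 2 * (1 - t6) * Z6 ^ 3 * Eu 2 ^ 3 = fps_X ^ 2 * Eu 6 ^ 9" by simp
  from 1 2 have "(T * (1 - T) ^ 2 * Z2 ^ 3) * Eu 2 ^ 3 = (t6 ^ 2 * (1 - t6) * Z6 ^ 3) * Eu 2 ^ 3" by simp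
  thus ?thesis by (simp add: T_def Z2_def)
qed

lemma fps_cube_inj:
  fixes f g :: "complex fps"
  assumes "f ^ 3 = g ^ 3" "f $ 0 = 1" "g $ 0 = 1"
  shows "f = g"
proof -
  have "(f - g) * (f ^ 2 + f * g + g ^ 2) = 0" using assms(1) by algebra
  moreover have "(f ^ 2 + f * g + g ^ 2) $ 0 \<noteq> 0" using assms(2,3) by (simp add: fps_power_zeroth)
  hence "f ^ 2 + f * g + g ^ 2 \<noteq> 0" by (metis fps_zero_nth)
  ultimately show ?thesis by simp
qed

text \<open>The cubes of both sides are \<open>b^3 + c^3\<close> at \<open>q^2\<close>, by the
  identities \<open>(1 + 3T)^3 = (1 - 9T)^2 + 27 T (1 - T)^2\<close> and
  \<open>(1 - 3t)^3 = (1 - 9t) + 27 t^2 (1 - t)\<close>.\<close>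

lemma Z6_dil: "(1 + 3 * dil 2 t6) * dil 2 Z6 = (1 - 3 * t6) * Z6"
proof (rule fps_cube_inj)
  define T Z2 where "T = dil 2 t6" and "Z2 = dil 2 Z6"
  have "((1 + 3 * T) * Z2) ^ 3 = (1 - 9 * T) ^ 2 * Z2 ^ 3 + 27 * (T * (1 - T) ^ 2 * Z2 ^ 3)"
    by algebra
  also have "\<dots> = (1 - 9 * t6) * Z6 ^ 3 + 27 * (t6 ^ 2 * (1 - t6) * Z6 ^ 3)"
    unfolding T_def Z2_def t6_b_dil t6_c_dil ..
  also have "\<dots> = ((1 - 3 * t6) * Z6) ^ 3" by algebra
  finally show "((1 + 3 * dil 2 t6) * dil 2 Z6) ^ 3 = ((1 - 3 * t6) * Z6) ^ 3"
    by (simp only: T_def Z2_def)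
qed (simp_all add: t6_def Z6_def fps_power_zeroth)

text \<open>Dividing \<open>t6_c_dil\<close> by the cube of \<open>Z6_dil\<close> eliminates
  \<open>Z6\<close>. The result says that the map of \<open>gen_C_compose1\<close> at
  \<open>q^2\<close> agrees with that of \<open>gen_C_compose2\<close> at \<open>q\<close>.\<close>

lemma t6_modular: "dil 2 t6 * (1 - dil 2 t6) ^ 2 * (1 - 3 * t6) ^ 3 = t6 ^ 2 * (1 - t6) * (1 + 3 * dil 2 t6) ^ 3"
proof -
  define T Z2 where "T = dil 2 t6" and "Z2 = dil 2 Z6"
  have "Z6 ^ 3 * (T * (1 - T) ^ 2 * (1 - 3 * t6) ^ 3) = T * (1 - T) ^ 2 * ((1 - 3 * t6) * Z6) ^ 3"
    by algebra
  also have "\<dots> = (T * (1 - T) ^ 2 * Z2 ^ 3) * (1 + 3 * T) ^ 3"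
    unfolding Z6_dil[symmetric] T_def Z2_def by algebra
  also have "\<dots> = Z6 ^ 3 * (t6 ^ 2 * (1 - t6) * (1 + 3 * T) ^ 3)"
    unfolding T_def Z2_def t6_c_dil by (simp only: mult_ac)
  finally show ?thesis using fps_nonzeroI[OF Z6_0] by (simp add: T_def)
qed

text \<open>As in level 8, the derivative of the modular equation gives a functional equation for
  \<open>L\<close>; \<open>Z6_dil\<close> and \<open>t6_b_dil\<close> show that \<open>L0\<close>
  solves it too.\<close>

lemma t6_log_deriv: "\<theta> t6 = t6 * (Z6 ^ 2 * (1 - t6) * (1 - 9 * t6))"
proof -
  obtain L where L: "\<theta> t6 = t6 * L" "L $ 0 = 1"
    using log_deriv_exists[of "(dil 3 \<psi> ^ 2 * inverse \<psi> ^ 2) ^ 2"] by (auto simp: t6_def fps_power_zeroth)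
  define T where "T = dil 2 t6"
  define L2 where "L2 = dil 2 L"
  have T: "\<theta> T = 2 * T * L2" unfolding T_def \<theta>_dil2 L by (simp add: dil_mult L2_def)
  have t0: "t6 \<noteq> 0"
    using t6_psi fps_nonzeroI[of "dil 3 \<psi>"] by auto
  have nz: "T \<noteq> 0" "1 - T \<noteq> 0" "1 - 3 * t6 \<noteq> 0"
  proof -
    show "T \<noteq> 0" unfolding T_def using t0 dil_inj[of 2 t6 0] by (auto simp: dil_def)
    show "1 - T \<noteq> 0" by (rule fps_nonzeroI) (simp add: T_def)
    show "1 - 3 * t6 \<noteq> 0" by (rule fps_nonzeroI) simp
  qed
  define R where "R = T * (1 - T) ^ 2 * (1 - 3 * t6) ^ 3"
  have m: "T * (1 - T) ^ 2 * (1 - 3 * t6) ^ 3 = t6 ^ 2 * (1 - t6) * (1 + 3 * T) ^ 3"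
    unfolding T_def by (rule t6_modular)
  have R2: "t6 ^ 2 * (1 - t6) * (1 + 3 * T) ^ 3 = R" by (simp only: R_def m)
  have "\<theta> (T * (1 - T) ^ 2 * (1 - 3 * t6) ^ 3) = \<theta> (t6 ^ 2 * (1 - t6) * (1 + 3 * T) ^ 3)" by (simp only: m)
  hence d: "(2 * T * L2 * (1 - T) ^ 2 + T * (2 * (1 - T) * (- (2 * T * L2)))) * (1 - 3 * t6) ^ 3 +
      T * (1 - T) ^ 2 * (3 * (1 - 3 * t6) ^ 2 * (- (3 * (t6 * L)))) =
      (2 * t6 * (t6 * L) * (1 - t6) + t6 ^ 2 * (- (t6 * L))) * (1 + 3 * T) ^ 3 +
      t6 ^ 2 * (1 - t6) * (3 * (1 + 3 * T) ^ 2 * (3 * (2 * T * L2)))"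
    by (simp only: \<theta>_mult \<theta>_diff \<theta>_add \<theta>_power2 \<theta>_power3 \<theta>_1 \<theta>_numeral L(1) T diff_0 mult_zero_left add_0_left)
  \<comment> \<open>The extra factor clears denominators: each side becomes the common value
    \<open>R\<close> times its logarithmic derivative.\<close>
  have "((2 * T * L2 * (1 - T) ^ 2 + T * (2 * (1 - T) * (- (2 * T * L2)))) * (1 - 3 * t6) ^ 3 +
      T * (1 - T) ^ 2 * (3 * (1 - 3 * t6) ^ 2 * (- (3 * (t6 * L))))) * ((1 - T) * (1 + 3 * T) * (1 - t6) * (1 - 3 * t6)) =
      ((2 * t6 * (t6 * L) * (1 - t6) + t6 ^ 2 * (- (t6 * L))) * (1 + 3 * T) ^ 3 +
      t6 ^ 2 * (1 - t6) * (3 * (1 + 3 * T) ^ 2 * (3 * (2 * T * L2)))) * ((1 - T) * (1 + 3 * T) * (1 - t6) * (1 - 3 * t6))"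
    by (simp only: d)
  hence "(T * (1 - T) ^ 2 * (1 - 3 * t6) ^ 3) * (2 * L2 * (1 - 3 * T) * (1 + 3 * T) * (1 - t6) * (1 - 3 * t6)
         - 9 * t6 * L * (1 - T) * (1 + 3 * T) * (1 - t6)) =
      (t6 ^ 2 * (1 - t6) * (1 + 3 * T) ^ 3) * (L * (2 - 3 * t6) * (1 - T) * (1 + 3 * T) * (1 - 3 * t6)
         + 18 * T * L2 * (1 - T) * (1 - t6) * (1 - 3 * t6))"
    by algebra
  hence "R * (2 * L2 * (1 - 3 * T) * (1 + 3 * T) * (1 - t6) * (1 - 3 * t6)
         - 9 * t6 * L * (1 - T) * (1 + 3 * T) * (1 - t6)) =
      R * (L * (2 - 3 * t6) * (1 - T) * (1 + 3 * T) * (1 - 3 * t6)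
         + 18 * T * L2 * (1 - T) * (1 - t6) * (1 - 3 * t6))"
    by (simp only: R2) (simp only: R_def)
  \<comment> \<open>Collecting terms uses \<open>(2 - 3t) (1 - 3t) + 9t (1 - t) = 2\<close> for
    \<open>L\<close> and \<open>2 (1 - 3T) (1 + 3T) - 18T (1 - T) = 2 (1 - 9T)\<close> for
    \<open>L2\<close>.\<close>
  hence "(2 * R) * (L * ((1 - T) * (1 + 3 * T))) = (2 * R) * (((1 - 9 * T) * (1 - t6) * (1 - 3 * t6)) * L2)"
    by algebra
  moreover have "2 * R \<noteq> 0" using nz by (simp add: R_def)
  ultimately have LT: "L * ((1 - T) * (1 + 3 * T)) = ((1 - 9 * T) * (1 - t6) * (1 - 3 * t6)) * L2"
    by (subst (asm) mult_cancel_left) auto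
  define L0 where "L0 = Z6 ^ 2 * (1 - t6) * (1 - 9 * t6)"
  define Z2 where "Z2 = dil 2 Z6"
  have d0: "dil 2 L0 = Z2 ^ 2 * (1 - T) * (1 - 9 * T)"
    by (simp add: L0_def dil_mult dil_diff dil_power Z2_def T_def)
  have "Z2 * (L0 * ((1 - T) * (1 + 3 * T))) = Z6 ^ 2 * (1 - t6) * (1 - 9 * t6) * (1 - T) * ((1 + 3 * T) * Z2)"
    unfolding L0_def by (simp only: mult_ac)
  also have "\<dots> = ((1 - 9 * t6) * Z6 ^ 3) * ((1 - t6) * (1 - T) * (1 - 3 * t6))"
    unfolding T_def Z2_def Z6_dil by algebra
  also have "\<dots> = Z2 * (((1 - 9 * T) * (1 - t6) * (1 - 3 * t6)) * dil 2 L0)"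
    unfolding d0 unfolding T_def Z2_def t6_b_dil[symmetric] by algebra
  finally have L0T: "L0 * ((1 - T) * (1 + 3 * T)) = ((1 - 9 * T) * (1 - t6) * (1 - 3 * t6)) * dil 2 L0"
    using fps_nonzeroI[of Z2] by (simp add: Z2_def)
  have "L = L0"
    by (rule fps_eq_of_dil'[OF LT[unfolded L2_def] L0T]) (simp_all add: T_def L L0_def fps_power_zeroth)
  thus ?thesis using L(1) by (simp add: L0_def)
qed

lemma compose_gen_C1:
  "t $ 0 = 0 \<Longrightarrow> gen C oo t = inverse (1 + 3 * t) * (F3 oo (t * (1 - t) ^ 2 * inverse (1 + 3 * t) ^ 3))"
  unfolding gen_C_compose1
  by (simp add: fps_compose_mult_distrib fps_compose_assoc[symmetric] fps_compose_sub_distrib fps_compose_add_distrib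
     fps_inverse_compose fps_compose_power[symmetric])

lemma compose_gen_C2:
  "t $ 0 = 0 \<Longrightarrow> gen C oo t = inverse (1 - 3 * t) * (F3 oo (t ^ 2 * (1 - t) * inverse (1 - 3 * t) ^ 3))"
  unfolding gen_C_compose2
  by (simp add: fps_compose_mult_distrib fps_compose_assoc[symmetric] fps_compose_sub_distrib
     fps_inverse_compose fps_compose_power[symmetric] power2_eq_square)

lemma gen_C_t6: "gen C oo t6 = Z6"
proof -
  define T where "T = dil 2 t6"
  define i where "i = inverse (1 - 3 * t6)"
  define j where "j = inverse (1 + 3 * T)"
  have i: "(1 - 3 * t6) * i = 1" unfolding i_def by (rule inverse_mult_eq_1') simp
  have j: "(1 + 3 * T) * j = 1" unfolding j_def by (rule inverse_mult_eq_1') (simp add: T_def)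
  have m: "T * (1 - T) ^ 2 * (1 - 3 * t6) ^ 3 = t6 ^ 2 * (1 - t6) * (1 + 3 * T) ^ 3"
    unfolding T_def by (rule t6_modular)
  have "T * (1 - T) ^ 2 * j ^ 3 = (T * (1 - T) ^ 2 * (1 - 3 * t6) ^ 3) * (j ^ 3 * i ^ 3)"
  proof -
    have "((1 - 3 * t6) * i) ^ 3 = 1" by (simp add: i)
    thus ?thesis by (simp add: power_mult_distrib mult_ac)
  qed
  also have "\<dots> = t6 ^ 2 * (1 - t6) * i ^ 3"
  proof -
    have "((1 + 3 * T) * j) ^ 3 = 1" by (simp add: j)
    thus ?thesis unfolding m by (simp add: power_mult_distrib mult_ac)
  qed
  finally have h: "T * (1 - T) ^ 2 * j ^ 3 = t6 ^ 2 * (1 - t6) * i ^ 3" .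
  have "dil 2 (gen C oo t6) = gen C oo T" by (simp add: dil_compose T_def)
  also have "\<dots> = j * (F3 oo (t6 ^ 2 * (1 - t6) * i ^ 3))"
    using compose_gen_C1[of T] by (simp add: T_def[symmetric] j_def[symmetric] h) (simp add: T_def)
  finally have 1: "dil 2 (gen C oo t6) = \<dots>" .
  have 2: "gen C oo t6 = i * (F3 oo (t6 ^ 2 * (1 - t6) * i ^ 3))"
    using compose_gen_C2[of t6] by (simp add: i_def)
  have "(gen C oo t6) * (1 - 3 * t6) = ((1 - 3 * t6) * i) * (F3 oo (t6 ^ 2 * (1 - t6) * i ^ 3))"
    by (subst 2) (simp only: mult_ac)
  also have "\<dots> = (1 + 3 * T) * dil 2 (gen C oo t6)"
    by (simp only: 1 i mult_1_left mult.assoc[symmetric] j)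
  finally have "(gen C oo t6) * (1 - 3 * t6) = (1 + 3 * T) * dil 2 (gen C oo t6)" .
  moreover have "Z6 * (1 - 3 * t6) = (1 + 3 * T) * dil 2 Z6"
    using Z6_dil by (simp add: T_def mult_ac)
  ultimately show ?thesis by (rule fps_eq_of_dil') simp_all
qed

text \<open>In \<open>u Z6^3 (1 - t6) (1 - 9 t6)\<close> the factors are exactly those evaluated by
  \<open>t6_1\<close> and \<open>t6_b\<close>. The product is the series whose image under
  \<open>q -> q^2\<close> is \<open>f_C / q\<close>.\<close>

theorem eta_quotient_cong_C:
  assumes p: "prime p" "odd p" and z: "(Eu 1 ^ 3 * Eu 3 ^ 3) $ ((p - 1) div 2) = of_int z"
  shows "[C_seq C ((p - 1) div 2) = z] (mod int p)"
proof (rule coeff_cong_of_log_deriv[OF _ _ t6_def _ _ p z])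
  define u where "u = dil 3 \<psi> ^ 2 * inverse \<psi> ^ 2"
  show "int_fps (dil 3 \<psi> ^ 2 * inverse \<psi> ^ 2)"
    by (intro int_fps_mult int_fps_power int_fps_dil int_fps_inverse int_phi) simp_all
  show "fps_X * fps_deriv t6 = t6 * (Z6 ^ 2 * (1 - t6) * (1 - 9 * t6))"
    using t6_log_deriv by (simp add: \<theta>_def)
  have "u * \<psi> ^ 2 = dil 3 \<psi> ^ 2"
    unfolding u_def using psi_inverse by algebra
  hence u: "u * (Eu 2 ^ 4 * Eu 3 ^ 2) = Eu 6 ^ 4 * Eu 1 ^ 2"
    using psi_prod dil3_products(1) by algebra
  have "(Eu 6 ^ 4 * Eu 2 ^ 9 * Eu 3 ^ 2) * (u * Z6 * (Z6 ^ 2 * (1 - t6) * (1 - 9 * t6))) =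
      (u * (Eu 2 ^ 4 * Eu 3 ^ 2)) * ((1 - t6) * (Eu 2 ^ 5 * Eu 6)) * ((1 - 9 * t6) * Z6 ^ 3 * Eu 6 ^ 3)"
    by algebra
  also have "\<dots> = (Eu 6 ^ 4 * Eu 2 ^ 9 * Eu 3 ^ 2) * (Eu 1 ^ 3 * Eu 3 ^ 3)"
    unfolding u t6_1 t6_b by algebra
  finally have "u * Z6 * (Z6 ^ 2 * (1 - t6) * (1 - 9 * t6)) = Eu 1 ^ 3 * Eu 3 ^ 3" by simp
  thus "Eu 1 ^ 3 * Eu 3 ^ 3 = dil 3 \<psi> ^ 2 * inverse \<psi> ^ 2 * (Abs_fps (\<lambda>n. of_int (C_seq C n)) oo t6) * (Z6 ^ 2 * (1 - t6) * (1 - 9 * t6))"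
    using gen_C_t6 by (simp add: gen_def u_def)
qed (simp_all add: fps_power_zeroth)

section \<open>Binomial congruences\<close>

lemma Suc_times_binomial_eq_int:
  "(int k + 1) * int (n choose (k + 1)) = (int n - int k) * int (n choose k)"
proof (cases "k \<le> n")
  case True
  have "Suc k * (n choose Suc k) = (n - k) * (n choose k)"
    by (simp only: binomial_absorption binomial_absorb_comp)
  hence "int (Suc k * (n choose Suc k)) = int ((n - k) * (n choose k))" by (simp only:)
  hence "int (Suc k) * int (n choose Suc k) = int (n - k) * int (n choose k)" by (simp only: of_nat_mult)
  moreover have "int (Suc k) = int k + 1" "Suc k = k + 1" "int (n - k) = int n - int k"
    using True by (simp_all add: of_nat_diff)
  ultimately show ?thesis by (simp only:)
qed (simp add: binomial_eq_0)

lemma cong_cancel_Suc: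
  assumes "prime p" "k + 1 < p" "[(int k + 1) * a = (int k + 1) * b] (mod int p)"
  shows "[a = b] (mod int p)"
proof -
  have "\<not> p dvd k + 1" using assms(2) by (auto dest: dvd_imp_le)
  hence "coprime p (k + 1)" using assms(1) by (simp add: prime_imp_coprime)
  hence "coprime (int (k + 1)) (int p)" by (metis coprime_commute coprime_int_iff)
  moreover have "int (k + 1) = int k + 1" by simp
  ultimately show ?thesis using assms(3) by (metis cong_mult_lcancel)
qed

text \<open>\<open>(2k choose k)\<close> is \<open>(-4)^k\<close> times the binomial coefficient of
  -1/2 over \<open>k\<close>, and -1/2 is congruent to \<open>n\<close> modulo
  \<open>p = 2n + 1\<close>. The range includes \<open>n < k < p\<close>, where both sides are 0
  modulo \<open>p\<close>.\<close>

lemma central_binomial_cong: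
  assumes p: "prime p" "p = 2 * n + 1" and k: "k < p"
  shows "[int ((2 * k) choose k) = (-4) ^ k * int (n choose k)] (mod int p)"
  using k
proof (induction k)
  case (Suc k)
  have "(int k + 1) * int ((2 * (k + 1)) choose (k + 1)) = 2 * (2 * int k + 1) * int ((2 * k) choose k)"
  proof -
    have "(of_nat (k + 1) * of_nat ((2 * (k + 1)) choose (k + 1)) :: rat) = 2 * (2 * of_nat k + 1) * of_nat ((2 * k) choose k)"
      by (rule central_binomial_Suc)
    hence "(of_int (int (k + 1) * int ((2 * (k + 1)) choose (k + 1))) :: rat) = of_int (2 * (2 * int k + 1) * int ((2 * k) choose k))"
      by (simp only: of_int_mult of_int_add of_int_of_nat_eq of_int_numeral of_int_1)
    hence "int (k + 1) * int ((2 * (k + 1)) choose (k + 1)) = 2 * (2 * int k + 1) * int ((2 * k) choose k)"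
      by (simp only: of_int_eq_iff)
    moreover have "int (k + 1) = int k + 1" by simp
    ultimately show ?thesis by (simp only:)
  qed
  also have "[2 * (2 * int k + 1) * int ((2 * k) choose k) = (4 * (int k - int n)) * ((-4) ^ k * int (n choose k))] (mod int p)"
  proof (rule cong_mult)
    have "2 * (2 * int k + 1) - 4 * (int k - int n) = 2 * int p" using p by simp
    thus "[2 * (2 * int k + 1) = 4 * (int k - int n)] (mod int p)"
      by (metis cong_iff_dvd_diff dvd_triv_right)
  qed (use Suc in simp)
  also have "(4 * (int k - int n)) * ((-4) ^ k * int (n choose k)) = (-4) ^ (k + 1) * ((int n - int k) * int (n choose k))"
    by (simp add: algebra_simps)
  also have "\<dots> = (int k + 1) * ((-4) ^ (k + 1) * int (n choose (k + 1)))"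
    unfolding Suc_times_binomial_eq_int[symmetric] by (simp only: mult_ac)
  finally show ?case using cong_cancel_Suc[OF p(1), of k] Suc.prems by simp
qed simp

text \<open>\<open>(n + k choose k)\<close> is \<open>(-1)^k\<close> times the binomial coefficient
  of \<open>-n - 1\<close> over \<open>k\<close>, and \<open>-n - 1\<close> is congruent to
  \<open>n\<close>.\<close>

lemma binomial_reflect_cong:
  assumes p: "prime p" "p = 2 * n + 1" and k: "k < p"
  shows "[int ((n + k) choose k) = (-1) ^ k * int (n choose k)] (mod int p)"
  using k
proof (induction k)
  case (Suc k)
  have "Suc k * ((n + Suc k) choose Suc k) = (n + Suc k) * ((n + k) choose k)"
    using Suc_times_binomial_eq[of "n + k" k] by (simp add: mult.commute)
  hence "(int k + 1) * int ((n + Suc k) choose Suc k) = (int n + int k + 1) * int ((n + k) choose k)"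
  proof -
    assume "Suc k * ((n + Suc k) choose Suc k) = (n + Suc k) * ((n + k) choose k)"
    hence "int (Suc k * ((n + Suc k) choose Suc k)) = int ((n + Suc k) * ((n + k) choose k))" by (simp only:)
    hence "int (Suc k) * int ((n + Suc k) choose Suc k) = int (n + Suc k) * int ((n + k) choose k)" by (simp only: of_nat_mult)
    moreover have "int (Suc k) = int k + 1" "int (n + Suc k) = int n + int k + 1" by simp_all
    ultimately show ?thesis by (simp only:)
  qed
  also have "[(int n + int k + 1) * int ((n + k) choose k) = (int k - int n) * ((-1) ^ k * int (n choose k))] (mod int p)"
  proof (rule cong_mult)
    have "(int n + int k + 1) - (int k - int n) = int p" using p by simp
    thus "[int n + int k + 1 = int k - int n] (mod int p)"
      by (metis cong_iff_dvd_diff dvd_refl)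
  qed (use Suc in simp)
  also have "(int k - int n) * ((-1) ^ k * int (n choose k)) = (-1) ^ (k + 1) * ((int n - int k) * int (n choose k))"
    by (simp add: algebra_simps)
  also have "\<dots> = (int k + 1) * ((-1) ^ (k + 1) * int (n choose (k + 1)))"
    unfolding Suc_times_binomial_eq_int[symmetric] by (simp only: mult_ac)
  finally show ?case using cong_cancel_Suc[OF p(1), of k] Suc.prems by simp
qed simp

text \<open>Fermat's theorem for 2, obtained by evaluating \<open>(2n choose n)\<close> with both
  preceding congruences at \<open>k = n\<close>.\<close>

lemma four_power_cong:
  assumes p: "prime p" "p = 2 * n + 1"
  shows "[4 ^ n = (1 :: int)] (mod int p)"
proof -
  have n: "n < p" using p(2) by simp
  have 1: "[int ((2 * n) choose n) = (-4) ^ n] (mod int p)"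
    using central_binomial_cong[OF p n] by (simp only: binomial_n_n of_nat_1 mult_1_right)
  have 2: "[int ((2 * n) choose n) = (-1) ^ n] (mod int p)"
    using binomial_reflect_cong[OF p n] by (simp only: binomial_n_n of_nat_1 mult_1_right mult_2)
  have "[(-4) ^ n = (-1 :: int) ^ n] (mod int p)" by (rule cong_trans[OF cong_sym[OF 1] 2])
  hence "[(-1) ^ n * (-4) ^ n = (-1) ^ n * (-1 :: int) ^ n] (mod int p)"
    by (rule cong_mult[OF cong_refl])
  thus ?thesis by (simp flip: power_mult_distrib)
qed

text \<open>The two central binomials in \<open>C_seq E\<close> contribute \<open>(-4)^k\<close> and
  \<open>(-4)^(n-k)\<close>, hence a constant \<open>(-4)^n\<close>, and \<open>4^n\<close> is 1
  modulo \<open>p\<close>.\<close>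

theorem C_seq_A_cong_E:
  assumes p: "prime p" "p = 2 * n + 1"
  shows "[C_seq A n = (-1) ^ n * C_seq E n] (mod int p)"
proof -
  have "[C_seq E n = (\<Sum>k=0..n. int (n choose k) * ((-4) ^ k * int (n choose k)) * ((-4) ^ (n - k) * int (n choose (n - k))))] (mod int p)"
    unfolding C_seq.simps by (intro cong_sum cong_mult cong_refl central_binomial_cong p) (use p in auto)
  also have "(\<Sum>k=0..n. int (n choose k) * ((-4) ^ k * int (n choose k)) * ((-4) ^ (n - k) * int (n choose (n - k)))) = (-4) ^ n * C_seq A n"
    unfolding C_seq.simps sum_distrib_left
  proof (intro sum.cong refl)
    fix k assume "k \<in> {0..n}"
    hence "(-4 :: int) ^ n = (-4) ^ k * (-4) ^ (n - k)" "n choose (n - k) = n choose k"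
      by (simp_all add: power_add[symmetric] binomial_symmetric[symmetric])
    thus "int (n choose k) * ((-4) ^ k * int (n choose k)) * ((-4) ^ (n - k) * int (n choose (n - k))) = (-4) ^ n * int (n choose k) ^ 3"
      by (simp add: power3_eq_cube)
  qed
  finally have "[(-1) ^ n * C_seq E n = (-1) ^ n * ((-4) ^ n * C_seq A n)] (mod int p)"
    by (intro cong_mult cong_refl)
  also have "(-1) ^ n * ((-4) ^ n * C_seq A n) = 4 ^ n * C_seq A n"
    by (simp only: mult.assoc[symmetric] power_mult_distrib[symmetric]) simp
  also have "[4 ^ n * C_seq A n = 1 * C_seq A n] (mod int p)"
    by (intro cong_mult cong_refl four_power_cong p)
  finally show ?thesis by (simp only: mult_1_left cong_sym)
qed

text \<open>The common residue of \<open>C_seq B\<close>, \<open>C_seq D\<close> and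
  \<open>seq_D\<close> at \<open>n = (p - 1) div 2\<close>.\<close>

definition alt_cubes :: "nat \<Rightarrow> int" where
  "alt_cubes n = (\<Sum>k\<le>n. (-1) ^ k * int (n choose k) ^ 3)"

lemma C_seq_D_cong:
  assumes p: "prime p" "p = 2 * n + 1"
  shows "[C_seq D n = alt_cubes n] (mod int p)"
proof -
  have "[C_seq D n = (\<Sum>k=0..n. int (n choose k) ^ 2 * ((-1) ^ k * int (n choose k)))] (mod int p)"
    unfolding C_seq.simps by (intro cong_sum cong_mult cong_refl binomial_reflect_cong p) (use p in auto)
  thus ?thesis by (simp only: alt_cubes_def atMost_atLeast0 power2_eq_square power3_eq_cube mult_ac)
qed

lemma seq_D_cong:
  assumes p: "prime p" "p = 2 * n + 1"
  shows "[seq_D n = alt_cubes n] (mod int p)"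
proof -
  have "[seq_D n = (\<Sum>k=0..n. ((-4) ^ k * int (n choose k)) ^ 2 * (((-4) ^ (n - k) * int (n choose (n - k))) * 4 ^ (n - k)))] (mod int p)"
    unfolding seq_D_def by (intro cong_sum cong_mult cong_pow cong_refl central_binomial_cong p) (use p in auto)
  also have "(\<Sum>k=0..n. ((-4) ^ k * int (n choose k)) ^ 2 * (((-4) ^ (n - k) * int (n choose (n - k))) * 4 ^ (n - k)))
     = (\<Sum>k\<le>n. (4 ^ n) ^ 2 * ((-1) ^ (n - k) * int (n choose (n - k)) ^ 3))"
    unfolding atMost_atLeast0
  proof (intro sum.cong refl)
    fix k assume "k \<in> {0..n}"
    hence 1: "(4 :: int) ^ n = 4 ^ k * 4 ^ (n - k)" and 2: "n choose (n - k) = n choose k"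
      by (simp_all add: power_add[symmetric] binomial_symmetric[symmetric])
    have 3: "(-4 :: int) ^ j = (-1) ^ j * 4 ^ j" for j by (simp add: power_mult_distrib[symmetric])
    have 4: "((-1 :: int) ^ k) ^ 2 = 1" by (simp add: power_mult[symmetric] mult.commute)
    show "((-4) ^ k * int (n choose k)) ^ 2 * (((-4) ^ (n - k) * int (n choose (n - k))) * 4 ^ (n - k)) =
       (4 ^ n) ^ 2 * ((-1) ^ (n - k) * int (n choose (n - k)) ^ 3)"
      unfolding 1 2 3 power_mult_distrib 4 by (simp add: power2_eq_square power3_eq_cube)
  qed
  also have "\<dots> = (4 ^ n) ^ 2 * alt_cubes n"
    unfolding alt_cubes_def sum_distrib_left[symmetric]
    by (intro arg_cong[of _ _ "(*) ((4 ^ n)\<^sup>2)"] sum.reindex_bij_witness[of _ "\<lambda>k. n - k" "\<lambda>k. n - k"]) auto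
  also have "[(4 ^ n) ^ 2 * alt_cubes n = 1 ^ 2 * alt_cubes n] (mod int p)"
    by (intro cong_mult cong_pow cong_refl four_power_cong p)
  finally show ?thesis by simp
qed

text \<open>Setting \<open>1/m!\<close> to zero for negative \<open>m\<close> makes \<open>1/(m-1)! = m/m!\<close> valid for all integers.\<close>
definition rf :: "int \<Rightarrow> rat" where
  "rf m = (if m < 0 then 0 else 1 / fact (nat m))"

lemma rf_minus_1: "rf (m - 1) = of_int m * rf m"
proof (cases "m > 0")
  case True
  then obtain k where "m = int (Suc k)" by (metis zero_less_imp_eq_int gr0_implies_Suc)
  thus ?thesis by (simp add: rf_def nat_add_distrib)
qed (auto simp: rf_def)

lemma rf_minus_2: "rf (m - 2) = of_int (m - 1) * (of_int m * rf m)"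
  using rf_minus_1[of m] rf_minus_1[of "m - 1"] by simp

text \<open>The summand of \<open>central_binomial_cube\<close> with its factorials cancelled;
  \<open>rf\<close> makes it vanish for \<open>2 k > n\<close>.\<close>

definition cube_term :: "nat \<Rightarrow> nat \<Rightarrow> rat" where
  "cube_term n k = 4 ^ n / 16 ^ k * fact (2 * (n + k)) / (fact (n + k) * fact k ^ 3) * rf (int n - 2 * int k)"

text \<open>Again \<open>G\<close> is a certificate found by Zeilberger's algorithm, for a recurrence of order one.\<close>
lemma central_binomial_cube_rat:
  assumes "2 * K > n"
  shows "(\<Sum>k<K. cube_term n k) = of_nat ((2 * n) choose n) ^ 3"
  using assms
proof (induction n arbitrary: K)
  case 0
  have "(\<Sum>k<K. cube_term 0 k) = (\<Sum>k<K. if k = 0 then 1 else 0)"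
    by (intro sum.cong) (auto simp: cube_term_def rf_def)
  thus ?case using 0 by simp
next
  case (Suc n)
  define N :: rat where "N = of_nat n"
  \<comment> \<open>A common factor: both summands and the certificate at \<open>k\<close> and at
    \<open>k + 1\<close> are polynomial multiples of \<open>d k\<close>.\<close>
  define d where "d k = 4 ^ n / 16 ^ k * fact (2 * (n + k)) / (fact (n + k) * fact k ^ 3) * rf (int n + 1 - 2 * int k)" for k
  define G where "G k = - 64 * (3 * N + 2) * of_nat k ^ 3 * d k" for k
  have s0: "cube_term n k = (N + 1 - 2 * of_nat k) * d k" for k
  proof -
    have r: "rf (int n - 2 * int k) = (N + 1 - 2 * of_nat k) * rf (int n + 1 - 2 * int k)"
      using rf_minus_1[of "int n + 1 - 2 * int k"] by (simp add: N_def)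
    show ?thesis unfolding cube_term_def d_def r by simp
  qed
  have s1: "cube_term (Suc n) k = 8 * (2 * N + 2 * of_nat k + 1) * d k" for k
  proof -
    have nz: "(1 + of_nat n + of_nat k :: rat) \<noteq> 0" by (metis of_nat_Suc of_nat_add add.assoc of_nat_neq_0)
    have "fact (2 * (Suc n + k)) = (2 * of_nat (n + k) + 2) * (2 * of_nat (n + k) + 1) * (fact (2 * (n + k)) :: rat)"
      using fact_double_Suc[of "n + k", where 'a = rat] by simp
    moreover have "fact (Suc n + k) = (1 + of_nat n + of_nat k) * (fact (n + k) :: rat)" by simp
    moreover have "int (Suc n) - 2 * int k = int n + 1 - 2 * int k" by simp
    ultimately show ?thesis unfolding cube_term_def d_def using nz
      by (simp add: divide_simps N_def) (simp add: algebra_simps)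
  qed
  have s2: "G (Suc k) = - 8 * (3 * N + 2) * (2 * N + 2 * of_nat k + 1) * (N - 2 * of_nat k) * (N + 1 - 2 * of_nat k) * d k" for k
  proof -
    have nz: "(1 + of_nat n + of_nat k :: rat) \<noteq> 0" by (metis of_nat_Suc of_nat_add add.assoc of_nat_neq_0)
    have nz': "(1 + of_nat k :: rat) \<noteq> 0" by (metis of_nat_Suc of_nat_neq_0)
    have 1: "fact (2 * (n + Suc k)) = (2 * of_nat (n + k) + 2) * (2 * of_nat (n + k) + 1) * (fact (2 * (n + k)) :: rat)"
      using fact_double_Suc[of "n + k", where 'a = rat] by simp
    have 2: "fact (n + Suc k) = (1 + of_nat n + of_nat k) * (fact (n + k) :: rat)" by simp
    have 3: "rf (int n + 1 - 2 * int (Suc k)) = (N - 2 * of_nat k) * ((N + 1 - 2 * of_nat k) * rf (int n + 1 - 2 * int k))"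
      using rf_minus_2[of "int n + 1 - 2 * int k"] by (simp add: N_def algebra_simps)
    have "of_nat (Suc k) ^ 3 * (a * ((2 * of_nat (n + k) + 2) * y * z) / (((1 + of_nat n + of_nat k) * w) * fact (Suc k) ^ 3) * v)
        = 2 * y * v * (a * z / (w * fact k ^ 3))" for a y z w v :: rat
    proof -
      have "fact (Suc k) ^ 3 = of_nat (Suc k) ^ 3 * (fact k ^ 3 :: rat)" by (simp add: power_mult_distrib)
      moreover have "(2 * of_nat (n + k) + 2 :: rat) = 2 * (1 + of_nat n + of_nat k)" by simp
      ultimately show ?thesis using nz nz' by (simp only:) (simp add: divide_simps)
    qed
    note key = this
    have "of_nat (Suc k) ^ 3 * d (Suc k) = 2 * (2 * of_nat (n + k) + 1) * ((N - 2 * of_nat k) * ((N + 1 - 2 * of_nat k) * rf (int n + 1 - 2 * int k)))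
        * (4 ^ n / 16 ^ Suc k * fact (2 * (n + k)) / (fact (n + k) * fact k ^ 3))"
      unfolding d_def 1 2 3 by (rule key)
    also have "\<dots> = (2 * N + 2 * of_nat k + 1) * (N - 2 * of_nat k) * (N + 1 - 2 * of_nat k) * d k / 8"
    proof -
      have "2 * of_nat (n + k) + 1 = 2 * N + 2 * of_nat k + 1" by (simp add: N_def)
      moreover have "2 * M * (a * (b * r)) * (c / (16 * s) * f / (g * h)) = M * a * b * (c / s * f / (g * h) * r) / 8"
        for M a b r c s f g h :: rat by (simp add: mult_ac)
      ultimately show ?thesis unfolding d_def power_Suc by (simp only:)
    qed
    finally have "of_nat (Suc k) ^ 3 * d (Suc k) = \<dots>" .
    thus ?thesis unfolding G_def mult.assoc by (simp only:)
  qed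
  have "(N + 1) ^ 3 * cube_term (Suc n) k - 8 * (2 * N + 1) ^ 3 * cube_term n k = G (Suc k) - G k" for k
    unfolding s0 s1 s2 unfolding G_def by algebra
  hence "(N + 1) ^ 3 * (\<Sum>k<K. cube_term (Suc n) k) - 8 * (2 * N + 1) ^ 3 * (\<Sum>k<K. cube_term n k) = (\<Sum>k<K. G (Suc k) - G k)"
    by (simp add: sum_distrib_left sum_subtractf[symmetric])
  also have "\<dots> = G K - G 0" by (rule sum_lessThan_telescope)
  also have "\<dots> = 0" using Suc.prems by (simp add: G_def d_def rf_def)
  finally have diff0: "(N + 1) ^ 3 * (\<Sum>k<K. cube_term (Suc n) k) - 8 * (2 * N + 1) ^ 3 * (\<Sum>k<K. cube_term n k) = 0" .
  have IH: "(\<Sum>k<K. cube_term n k) = of_nat ((2 * n) choose n) ^ 3" using Suc.IH[of K] Suc.prems by simp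
  have "(N + 1) ^ 3 * (\<Sum>k<K. cube_term (Suc n) k) = (2 * (2 * N + 1) * of_nat ((2 * n) choose n)) ^ 3"
    using diff0 unfolding IH by algebra
  also have "\<dots> = (N + 1) ^ 3 * of_nat ((2 * Suc n) choose (Suc n)) ^ 3"
  proof -
    have "(N + 1) * of_nat ((2 * Suc n) choose (Suc n)) = 2 * (2 * N + 1) * of_nat ((2 * n) choose n)"
      using central_binomial_Suc[of n, where 'a = rat] by (simp only: N_def of_nat_add of_nat_1 Suc_eq_plus1)
    thus ?thesis by (simp only: power_mult_distrib[symmetric])
  qed
  finally have "(N + 1) ^ 3 * (\<Sum>k<K. cube_term (Suc n) k) = (N + 1) ^ 3 * of_nat ((2 * Suc n) choose (Suc n)) ^ 3" .
  moreover have "(N + 1) ^ 3 \<noteq> 0" using of_nat_neq_0[of n, where 'a = rat] by (simp add: N_def add.commute)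
  ultimately show ?case by (subst (asm) mult_cancel_left) blast
qed

definition tri_coeff :: "nat \<Rightarrow> nat" where
  "tri_coeff k = ((2 * k) choose k) * ((3 * k) choose k)"

text \<open>For \<open>2 k > n\<close> the factor \<open>(n + k) choose (3 * k)\<close> is 0, so the
  truncated exponent \<open>n - 2 * k\<close> does no harm. The form is chosen to match the inner
  sum that \<open>C_seq_B_cong\<close> produces.\<close>

lemma central_binomial_cube:
  "int ((2 * n) choose n) ^ 3 =
     (\<Sum>k\<le>n. 4 ^ (n - 2 * k) * int ((2 * (n + k)) choose (n + k)) * int ((n + k) choose (3 * k)) * int (tri_coeff k))"
proof -
  let ?f = "\<lambda>k. 4 ^ (n - 2 * k) * int ((2 * (n + k)) choose (n + k)) * int ((n + k) choose (3 * k)) * int (tri_coeff k)"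
  have "rat_of_int (\<Sum>k\<le>n. ?f k)
     = (\<Sum>k<Suc n. cube_term n k)"
    unfolding of_int_sum lessThan_Suc_atMost
  proof (intro sum.cong refl)
    fix k
    show "rat_of_int (?f k) = cube_term n k"
    proof (cases "2 * k \<le> n")
      case True
      have 1: "(4 :: rat) ^ (n - 2 * k) = 4 ^ n / 16 ^ k"
        using True by (simp add: power_diff power_mult)
      have 2: "rat_of_nat ((n + k) choose (3 * k)) = fact (n + k) / (fact (3 * k) * fact (n - 2 * k))"
      proof -
        have "n + k - 3 * k = n - 2 * k" using True by simp
        thus ?thesis using binomial_fact[of "3 * k" "n + k", where 'a = rat] True by simp
      qed
      have 3: "rf (int n - 2 * int k) = 1 / fact (n - 2 * k)"
        using True by (simp add: rf_def nat_diff_distrib nat_mult_distrib)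
      have 4: "rat_of_nat (tri_coeff k) = fact (3 * k) / fact k ^ 3"
        by (simp add: tri_coeff_def trinomial_fact)
      have "rat_of_int (?f k) =
        (4 ^ n / 16 ^ k) * (fact (2 * (n + k)) / fact (n + k) ^ 2) * (fact (n + k) / (fact (3 * k) * fact (n - 2 * k))) * (fact (3 * k) / fact k ^ 3)"
        by (simp only: of_int_mult of_int_power of_int_numeral of_int_of_nat_eq 1 2 4 central_binomial_fact)
      also have "\<dots> = cube_term n k"
        by (simp add: cube_term_def 3 power2_eq_square)
      finally show ?thesis .
    qed (simp add: cube_term_def rf_def binomial_eq_0)
  qed
  also have "\<dots> = rat_of_int (int ((2 * n) choose n) ^ 3)"
    by (subst central_binomial_cube_rat) simp_all
  finally show ?thesis by (simp only: of_int_eq_iff)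
qed

text \<open>Expand \<open>3 = -1 + 4\<close> binomially and put \<open>N = j + 2k\<close>; then
  \<open>(n choose 3k) (n - 3k choose j) = (n choose N + k) (N + k choose 3k)\<close>.\<close>

lemma three_power_binomial:
  "3 ^ (n - 3 * k) * int (n choose (3 * k)) =
     (\<Sum>N\<le>n. (-1) ^ N * 4 ^ (n - N - k) * int (n choose (N + k)) * int ((N + k) choose (3 * k)))"
proof (cases "3 * k \<le> n")
  case True
  define m where "m = n - 3 * k"
  have "(3 :: int) ^ m = (- 1 + 4) ^ m" by simp
  also have "\<dots> = (\<Sum>j\<le>m. int (m choose j) * (- 1) ^ j * 4 ^ (m - j))" by (rule binomial_ring)
  finally have "3 ^ m * int (n choose (3 * k)) = (\<Sum>j\<le>m. int (m choose j) * (- 1) ^ j * 4 ^ (m - j) * int (n choose (3 * k)))"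
    by (simp add: sum_distrib_right)
  also have "\<dots> = (\<Sum>N\<in>{2 * k..n - k}. (-1) ^ N * 4 ^ (n - N - k) * int (n choose (N + k)) * int ((N + k) choose (3 * k)))"
  proof (rule sum.reindex_bij_witness[of _ "\<lambda>N. N - 2 * k" "\<lambda>j. j + 2 * k"])
    fix j assume j: "j \<in> {..m}"
    show "j + 2 * k \<in> {2 * k..n - k}" using j True by (auto simp: m_def)
    have "(n choose (j + 3 * k)) * ((j + 3 * k) choose (3 * k)) = (n choose (3 * k)) * ((n - 3 * k) choose j)"
      using choose_mult[of "3 * k" "j + 3 * k" n] j True by (simp add: m_def)
    hence "int (n choose (j + 3 * k)) * int ((j + 3 * k) choose (3 * k)) = int (n choose (3 * k)) * int (m choose j)"
      unfolding m_def by (metis of_nat_mult)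
    note pr = this
    have e: "j + 2 * k + k = j + 3 * k" "n - (j + 2 * k) - k = m - j" by (simp_all add: m_def)
    have e': "(-1 :: int) ^ (j + 2 * k) = (-1) ^ j" by (simp add: power_add power_mult)
    show "(-1) ^ (j + 2 * k) * 4 ^ (n - (j + 2 * k) - k) * int (n choose (j + 2 * k + k)) * int ((j + 2 * k + k) choose (3 * k)) =
        int (m choose j) * (- 1) ^ j * 4 ^ (m - j) * int (n choose (3 * k))"
      unfolding e e' mult.assoc pr by (simp only: mult_ac)
  qed (auto simp: m_def)
  also have "\<dots> = (\<Sum>N\<le>n. (-1) ^ N * 4 ^ (n - N - k) * int (n choose (N + k)) * int ((N + k) choose (3 * k)))"
  proof (rule sum.mono_neutral_left)
    show "\<forall>i\<in>{..n} - {2 * k..n - k}. (-1) ^ i * 4 ^ (n - i - k) * int (n choose (i + k)) * int ((i + k) choose (3 * k)) = 0"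
    proof
      fix i assume "i \<in> {..n} - {2 * k..n - k}"
      hence "i + k < 3 * k \<or> n < i + k" using True by auto
      thus "(-1) ^ i * 4 ^ (n - i - k) * int (n choose (i + k)) * int ((i + k) choose (3 * k)) = 0"
        by (auto simp: binomial_eq_0)
    qed
  qed auto
  finally show ?thesis by (simp add: m_def)
next
  case False
  have "int (n choose (i + k)) * int ((i + k) choose (3 * k)) = 0" for i
    using False by (cases "i + k \<le> n") (auto simp: binomial_eq_0)
  note z = this
  have "n choose (3 * k) = 0" using False by (simp add: binomial_eq_0)
  thus ?thesis by (simp only: mult.assoc z mult_zero_right sum.neutral_const of_nat_0)
qed

lemma C_seq_B_double_sum:
  "C_seq B n = (\<Sum>N\<le>n. \<Sum>k\<le>n. ((-1) ^ (N + k) * 4 ^ (n - (N + k)) * int (n choose (N + k))) * (int ((N + k) choose (3 * k)) * int (tri_coeff k)))"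
proof -
  have tk: "fact (3 * k) div fact k ^ 3 = int (tri_coeff k)" for k
  proof -
    have "rat_of_int (fact (3 * k)) = rat_of_int (int (tri_coeff k) * fact k ^ 3)"
      using trinomial_fact[of k, where 'a = rat] by (simp add: tri_coeff_def)
    hence "(fact (3 * k) :: int) = int (tri_coeff k) * fact k ^ 3" by (simp only: of_int_eq_iff)
    thus ?thesis by simp
  qed
  have "C_seq B n = (\<Sum>k=0..n div 3. (-1) ^ k * (3 ^ (n - 3 * k) * int (n choose (3 * k))) * int (tri_coeff k))"
    by (simp add: tk mult.assoc)
  also have "\<dots> = (\<Sum>k\<le>n. (-1) ^ k * (3 ^ (n - 3 * k) * int (n choose (3 * k))) * int (tri_coeff k))"
    by (rule sum.mono_neutral_left) (auto simp: binomial_eq_0)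
  also have "\<dots> = (\<Sum>k\<le>n. \<Sum>N\<le>n. ((-1) ^ (N + k) * 4 ^ (n - (N + k)) * int (n choose (N + k))) * (int ((N + k) choose (3 * k)) * int (tri_coeff k)))"
    unfolding three_power_binomial sum_distrib_left sum_distrib_right
    by (intro sum.cong refl) (simp add: power_add mult_ac)
  finally show ?thesis by (subst sum.swap)
qed

text \<open>The first group of factors in \<open>C_seq_B_double_sum\<close> depends only on
  \<open>j = N + k\<close>. Modulo \<open>p\<close> it can be traded for a power of 4 times
  \<open>(2j choose j)\<close>; then the inner sum over \<open>k\<close> is that of
  \<open>central_binomial_cube\<close>, and cubing \<open>central_binomial_cong\<close>
  finishes.\<close>

lemma C_seq_B_cong:
  assumes p: "prime p" "p = 2 * n + 1"
  shows "[C_seq B n = alt_cubes n] (mod int p)"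
proof -
  have f: "[4 ^ n = (1 :: int)] (mod int p)" by (rule four_power_cong[OF p])
  \<comment> \<open>The bound holds for \<open>j = N + k\<close> because the terms that count have
    \<open>2k <= N <= n\<close>. It also gives \<open>j < p\<close>, and for \<open>n < j\<close>
    both sides are 0 modulo \<open>p\<close>.\<close>
  have main: "[(-1) ^ j * 4 ^ (n - j) * int (n choose j) = 4 ^ (3 * n - 2 * j) * int ((2 * j) choose j)] (mod int p)"
    if j: "2 * j \<le> 3 * n" for j
  proof (cases "j \<le> n")
    case True
    have "[1 ^ 2 * ((-1) ^ j * 4 ^ (n - j) * int (n choose j)) = (4 ^ n) ^ 2 * ((-1) ^ j * 4 ^ (n - j) * int (n choose j))] (mod int p)"
      by (intro cong_mult cong_pow cong_refl cong_sym[OF f])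
    also have "(4 ^ n) ^ 2 * ((-1) ^ j * 4 ^ (n - j) * int (n choose j)) = 4 ^ (3 * n - 2 * j) * ((-4) ^ j * int (n choose j))"
    proof -
      have "n * 2 + (n - j) = (3 * n - 2 * j) + j" using True by simp
      hence "((4 :: int) ^ n) ^ 2 * 4 ^ (n - j) = 4 ^ (3 * n - 2 * j) * 4 ^ j"
        by (simp only: power_mult[symmetric] power_add[symmetric])
      moreover have "(-4 :: int) ^ j = (-1) ^ j * 4 ^ j" by (simp add: power_mult_distrib[symmetric])
      ultimately show ?thesis by (simp add: mult_ac)
    qed
    also have "[4 ^ (3 * n - 2 * j) * ((-4) ^ j * int (n choose j)) = 4 ^ (3 * n - 2 * j) * int ((2 * j) choose j)] (mod int p)"
      by (intro cong_mult cong_refl cong_sym[OF central_binomial_cong[OF p]]) (use True p in simp)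
    finally show ?thesis by simp
  next
    case False
    have "[int ((2 * j) choose j) = (-4) ^ j * int (n choose j)] (mod int p)"
      by (rule central_binomial_cong[OF p]) (use j p False in simp)
    hence "[4 ^ (3 * n - 2 * j) * int ((2 * j) choose j) = 4 ^ (3 * n - 2 * j) * 0] (mod int p)"
      using False by (intro cong_mult cong_refl) (simp add: binomial_eq_0)
    thus ?thesis using False by (simp add: binomial_eq_0 cong_sym)
  qed
  let ?f = "\<lambda>N k. (4 ^ (3 * n - 2 * (N + k)) * int ((2 * (N + k)) choose (N + k))) * (int ((N + k) choose (3 * k)) * int (tri_coeff k))"
  have "[C_seq B n = (\<Sum>N\<le>n. \<Sum>k\<le>n. ?f N k)] (mod int p)"
    unfolding C_seq_B_double_sum
  proof (intro cong_sum)
    fix N k assume "N \<in> {..n}" "k \<in> {..n}"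
    show "[((-1) ^ (N + k) * 4 ^ (n - (N + k)) * int (n choose (N + k))) * (int ((N + k) choose (3 * k)) * int (tri_coeff k)) =
       ?f N k] (mod int p)"
    proof (cases "2 * k \<le> N")
      case True
      thus ?thesis using \<open>N \<in> {..n}\<close> by (intro cong_mult cong_refl main) auto
    qed (simp add: binomial_eq_0)
  qed
  also have "(\<Sum>N\<le>n. \<Sum>k\<le>n. ?f N k) =
     (\<Sum>N\<le>n. 4 ^ (3 * n - 3 * N) * int ((2 * N) choose N) ^ 3)"
  proof (rule sum.cong[OF refl])
    fix N assume N: "N \<in> {..n}"
    have "(\<Sum>k\<le>n. ?f N k) =
       (\<Sum>k\<le>N. ?f N k)"
      by (rule sum.mono_neutral_right) (use N in \<open>auto simp: binomial_eq_0\<close>)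
    also have "\<dots> = (\<Sum>k\<le>N. 4 ^ (3 * n - 3 * N) * (4 ^ (N - 2 * k) * int ((2 * (N + k)) choose (N + k)) * int ((N + k) choose (3 * k)) * int (tri_coeff k)))"
    proof (rule sum.cong[OF refl])
      fix k
      show "?f N k =
         4 ^ (3 * n - 3 * N) * (4 ^ (N - 2 * k) * int ((2 * (N + k)) choose (N + k)) * int ((N + k) choose (3 * k)) * int (tri_coeff k))"
      proof (cases "2 * k \<le> N")
        case True
        hence "3 * n - 2 * (N + k) = (3 * n - 3 * N) + (N - 2 * k)" using N by auto
        thus ?thesis by (simp only: power_add mult_ac)
      qed (simp add: binomial_eq_0)
    qed
    also have "\<dots> = 4 ^ (3 * n - 3 * N) * int ((2 * N) choose N) ^ 3"
      by (simp only: central_binomial_cube sum_distrib_left)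
    finally show "(\<Sum>k\<le>n. ?f N k) = \<dots>" .
  qed
  also have "[(\<Sum>N\<le>n. 4 ^ (3 * n - 3 * N) * int ((2 * N) choose N) ^ 3) = (\<Sum>N\<le>n. 4 ^ (3 * n - 3 * N) * ((-4) ^ N * int (n choose N)) ^ 3)] (mod int p)"
    by (intro cong_sum cong_mult cong_pow cong_refl central_binomial_cong p) (use p in auto)
  also have "(\<Sum>N\<le>n. 4 ^ (3 * n - 3 * N) * ((-4) ^ N * int (n choose N)) ^ 3) = (\<Sum>N\<le>n. (4 ^ n) ^ 3 * ((-1) ^ N * int (n choose N) ^ 3))"
  proof (rule sum.cong[OF refl])
    fix N assume N: "N \<in> {..n}"
    have "(3 * n - 3 * N) + N * 3 = n * 3" using N by auto
    hence "(4 :: int) ^ (3 * n - 3 * N) * (4 ^ N) ^ 3 = (4 ^ n) ^ 3"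
      by (simp only: power_mult[symmetric] power_add[symmetric])
    moreover have "(-4 :: int) ^ N = (-1) ^ N * 4 ^ N" by (simp add: power_mult_distrib[symmetric])
    moreover have "((-1 :: int) ^ N) ^ 3 = (-1) ^ N" by (cases "even N") auto
    ultimately show "4 ^ (3 * n - 3 * N) * ((-4) ^ N * int (n choose N)) ^ 3 = (4 ^ n) ^ 3 * ((-1) ^ N * int (n choose N) ^ 3)"
      by (simp add: power_mult_distrib mult_ac)
  qed
  also have "\<dots> = (4 ^ n) ^ 3 * alt_cubes n" by (simp only: alt_cubes_def sum_distrib_left)
  also have "[(4 ^ n) ^ 3 * alt_cubes n = 1 ^ 3 * alt_cubes n] (mod int p)"
    by (intro cong_mult cong_pow cong_refl f)
  finally show ?thesis by simp
qed

section \<open>Fourier coefficients of the eta quotients\<close>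

definition euler_prod :: "complex \<Rightarrow> complex" where
  "euler_prod z = (\<Prod>n. 1 - z ^ Suc n)"

lemma euler_factor_nonzero: "norm (z :: complex) < 1 \<Longrightarrow> 1 - z ^ Suc n \<noteq> 0"
proof
  assume z: "norm z < 1" and "1 - z ^ Suc n = 0"
  hence "norm (z ^ Suc n) = 1" by simp
  moreover have "norm z ^ Suc n < 1" using z by (simp add: power_less_one_iff del: power_Suc)
  ultimately show False by (simp only: norm_power)
qed

lemma euler_prod_convergent:
  assumes "norm (z :: complex) < 1"
  shows "convergent_prod (\<lambda>n. 1 - z ^ Suc n)"
proof (rule abs_convergent_prod_imp_convergent_prod)
  have "summable (\<lambda>n. norm z * norm z ^ n)" using assms by (intro summable_mult summable_geometric) simp
  thus "abs_convergent_prod (\<lambda>n. 1 - z ^ Suc n)"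
    by (simp add: abs_convergent_prod_conv_summable norm_mult norm_power)
qed

lemma euler_prod_nonzero: "norm z < 1 \<Longrightarrow> euler_prod z \<noteq> 0"
  unfolding euler_prod_def by (intro prodinf_nonzero euler_prod_convergent euler_factor_nonzero)

lemma euler_prod_uniform_limit:
  assumes "r < 1"
  shows "uniform_limit (cball 0 r) (\<lambda>N z. \<Prod>n<N. 1 - z ^ Suc n) euler_prod sequentially"
proof -
  have "uniformly_convergent_on (cball 0 r) (\<lambda>N z :: complex. \<Prod>n<N. 1 - z ^ Suc n)"
  proof (rule uniformly_convergent_on_prod')
    show "uniformly_convergent_on (cball 0 r) (\<lambda>N z :: complex. \<Sum>n<N. norm (1 - z ^ Suc n - 1))"
    proof (rule Weierstrass_m_test'[where M = "\<lambda>n. max 0 r * max 0 r ^ n"])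
      show "summable (\<lambda>n. max 0 r * max 0 r ^ n)" using assms
        by (intro summable_mult summable_geometric) auto
      fix n and z :: complex assume z: "z \<in> cball 0 r"
      have "norm z ^ Suc n \<le> max 0 r ^ Suc n" using z by (intro power_mono) auto
      thus "norm (norm (1 - z ^ Suc n - 1)) \<le> max 0 r * max 0 r ^ n"
        by (simp add: norm_mult norm_power)
    qed
  qed (auto intro!: continuous_intros)
  then obtain g :: "complex \<Rightarrow> complex" where g: "uniform_limit (cball 0 r) (\<lambda>N z. \<Prod>n<N. 1 - z ^ Suc n) g sequentially"
    unfolding uniformly_convergent_on_def by blast
  have "g z = euler_prod z" if z: "z \<in> cball 0 r" for z
  proof -
    have "(\<lambda>N. \<Prod>n<N. 1 - z ^ Suc n) \<longlonglongrightarrow> g z" by (rule tendsto_uniform_limitI[OF g z])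
    moreover have "(\<lambda>N. \<Prod>n\<le>N. 1 - z ^ Suc n) \<longlonglongrightarrow> euler_prod z"
      unfolding euler_prod_def using z assms by (intro convergent_prod_LIMSEQ euler_prod_convergent) auto
    hence "(\<lambda>N. \<Prod>n<N. 1 - z ^ Suc n) \<longlonglongrightarrow> euler_prod z"
      by (simp add: LIMSEQ_lessThan_iff_atMost)
    ultimately show ?thesis by (rule LIMSEQ_unique)
  qed
  with g show ?thesis by (auto elim!: uniform_limit_cong'[THEN iffD1, rotated -1])
qed

lemma euler_prod_holomorphic: "euler_prod holomorphic_on ball 0 1"
proof (rule holomorphic_uniform_sequence)
  fix z :: complex assume z: "z \<in> ball 0 1"
  define r where "r = (1 + norm z) / 2"
  have r: "norm z < r" "r < 1" using z by (auto simp: r_def)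
  have sub: "cball z (r - norm z) \<subseteq> cball 0 r"
  proof
    fix w assume "w \<in> cball z (r - norm z)"
    hence "norm (w - z) \<le> r - norm z" by (simp add: dist_norm norm_minus_commute)
    thus "w \<in> cball 0 r" using norm_triangle_ineq[of "w - z" z] by simp
  qed
  have "uniform_limit (cball z (r - norm z)) (\<lambda>N z. \<Prod>n<N. 1 - z ^ Suc n) euler_prod sequentially"
    by (rule uniform_limit_on_subset[OF euler_prod_uniform_limit[OF r(2)] sub])
  moreover have "cball z (r - norm z) \<subseteq> ball 0 1" using sub r by auto
  ultimately show "\<exists>d>0. cball z d \<subseteq> ball 0 1 \<and> uniform_limit (cball z d) (\<lambda>N z. \<Prod>n<N. 1 - z ^ Suc n) euler_prod sequentially"
    using r by (intro exI[of _ "r - norm z"]) auto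
qed (auto intro!: holomorphic_intros)

text \<open>Locally uniform limits of holomorphic functions commute with derivatives, so the Taylor
  coefficients are limits of those of the partial products, which are eventually constant by
  \<open>eqX_eprod\<close>.\<close>

lemma euler_prod_has_fps_expansion: "euler_prod has_fps_expansion Eu 1"
proof -
  have ex: "euler_prod has_fps_expansion fps_expansion euler_prod 0"
    by (rule has_fps_expansion_fps_expansion[OF _ _ euler_prod_holomorphic]) auto
  define P where "P N = (\<Prod>n<N. 1 - fps_X ^ Suc n :: complex fps)" for N
  have P: "(\<lambda>z. \<Prod>n<N. 1 - z ^ Suc n) has_fps_expansion P N" for N
    unfolding P_def by (intro has_fps_expansion_prod has_fps_expansion_diff has_fps_expansion_1 has_fps_expansion_fps_X_power)
  have PE: "P N = (\<Prod>i=1..N. 1 - fps_const 1 * fps_X ^ i)" for N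
    unfolding P_def by (rule prod.reindex_bij_witness[of _ "\<lambda>i. i - 1" Suc]) auto
  have "fps_expansion euler_prod 0 $ n = Eu 1 $ n" for n
  proof -
    have "(\<lambda>N. (deriv ^^ n) (\<lambda>z. \<Prod>n<N. 1 - z ^ Suc n) 0) \<longlonglongrightarrow> (deriv ^^ n) euler_prod 0"
    proof (rule higher_deriv_complex_uniform_limit)
      show "uniform_limit (ball 0 (1/2)) (\<lambda>N z. \<Prod>n<N. 1 - z ^ Suc n) euler_prod sequentially"
        by (rule uniform_limit_on_subset[OF euler_prod_uniform_limit[of "1/2"]]) auto
    qed (auto intro!: holomorphic_intros always_eventually)
    hence "(\<lambda>N. (deriv ^^ n) (\<lambda>z. \<Prod>n<N. 1 - z ^ Suc n) 0 / fact n) \<longlonglongrightarrow> (deriv ^^ n) euler_prod 0 / fact n"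
      by (intro tendsto_divide) auto
    hence "(\<lambda>N. P N $ n) \<longlonglongrightarrow> fps_expansion euler_prod 0 $ n"
      by (simp add: fps_nth_fps_expansion[OF P] fps_nth_fps_expansion[OF ex])
    moreover have "eventually (\<lambda>N. P N $ n = Eu 1 $ n) sequentially"
      using eventually_ge_at_top[of n]
    proof eventually_elim
      case (elim N)
      thus ?case using eqX_eprod[OF elim, of "\<lambda>_. 1"] by (simp add: PE Eu_def eqX_iff)
    qed
    hence "(\<lambda>N. P N $ n) \<longlonglongrightarrow> Eu 1 $ n" by (rule tendsto_eventually)
    ultimately show ?thesis by (rule LIMSEQ_unique)
  qed
  hence "fps_expansion euler_prod 0 = Eu 1" by (rule fps_ext)
  with ex show ?thesis by simp
qed

lemma euler_prod_power_has_fps_expansion: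
  assumes "k > 0"
  shows "(\<lambda>z. euler_prod (z ^ k)) has_fps_expansion Eu k"
proof -
  have "(euler_prod \<circ> (\<lambda>z. z ^ k)) has_fps_expansion (Eu 1 oo fps_X ^ k)"
    by (rule has_fps_expansion_compose[OF euler_prod_has_fps_expansion has_fps_expansion_fps_X_power])
       (use assms in simp)
  moreover have "Eu 1 oo fps_X ^ k = Eu k"
    using dil_Eu[OF assms, of 1] by (simp add: dil_def)
  ultimately show ?thesis by (simp add: o_def)
qed

lemma norm_power_less_one: "norm (z :: complex) < 1 \<Longrightarrow> k > 0 \<Longrightarrow> norm (z ^ k) < 1"
  by (simp add: norm_power power_less_one_iff)

lemma euler_prod_power_nonzero: "norm z < 1 \<Longrightarrow> k > 0 \<Longrightarrow> euler_prod (z ^ k) \<noteq> 0"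
  by (rule euler_prod_nonzero) (rule norm_power_less_one)

lemma euler_prod_power_holomorphic:
  assumes "k > 0"
  shows "(\<lambda>z. euler_prod (z ^ k)) holomorphic_on ball 0 1"
proof -
  have "(euler_prod \<circ> (\<lambda>z. z ^ k)) holomorphic_on ball 0 1"
    by (rule holomorphic_on_compose_gen[OF _ euler_prod_holomorphic])
       (auto intro!: holomorphic_intros simp: norm_power_less_one[OF _ assms])
  thus ?thesis by (simp add: o_def)
qed

section \<open>From functions of tau to power series in q\<close>

lemma norm_to_q: "norm (to_q \<tau>) = exp (- 2 * pi * Im \<tau>)"
  by (simp add: to_q_def norm_exp)

lemma to_q_norm_less_1: "Im \<tau> > 0 \<Longrightarrow> norm (to_q \<tau>) < 1"
  by (simp add: norm_to_q)

lemma to_q_surj: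
  assumes "z \<noteq> 0" "norm z < 1"
  shows "\<exists>\<tau>. Im \<tau> > 0 \<and> to_q \<tau> = z"
proof (intro exI[of _ "Ln z / (2 * of_real pi * \<i>)"] conjI)
  show q: "to_q (Ln z / (2 * of_real pi * \<i>)) = z" using assms by (simp add: to_q_def)
  have "exp (- 2 * pi * Im (Ln z / (2 * of_real pi * \<i>))) < 1"
    using assms(2) norm_to_q[of "Ln z / (2 * of_real pi * \<i>)"] unfolding q by simp
  thus "Im (Ln z / (2 * of_real pi * \<i>)) > 0" by (simp add: zero_less_mult_iff)
qed

text \<open>For uniqueness of the expansion, \<open>f\<close> is turned into a function of
  \<open>q\<close>. The choice of \<open>\<tau>\<close> over \<open>z\<close> is immaterial, since
  \<open>f \<tau>\<close> is the sum of a series in \<open>z\<close>; the clause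
  \<open>c 0 = 0\<close> matches the value 0 put at \<open>z = 0\<close>.\<close>

lemma q_expansion_has_fps_expansion:
  assumes "has_q_expansion f c"
  shows "(\<lambda>z. if z = 0 then 0 else f (SOME \<tau>. Im \<tau> > 0 \<and> to_q \<tau> = z)) has_fps_expansion Abs_fps (\<lambda>n. of_int (c n))"
proof -
  define g where "g z = (if z = 0 then 0 else f (SOME \<tau>. Im \<tau> > 0 \<and> to_q \<tau> = z))" for z
  have s: "(\<lambda>n. of_int (c n) * z ^ n) sums g z" if z: "norm z < 1" for z
  proof (cases "z = 0")
    case True
    have "(\<lambda>n. of_int (c n) * 0 ^ n :: complex) sums of_int (c 0)" using powser_sums_zero[of "\<lambda>n. of_int (c n) :: complex"] by simp
    thus ?thesis using assms True by (simp add: g_def has_q_expansion_def)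
  next
    case False
    define \<tau> where "\<tau> = (SOME \<tau>. Im \<tau> > 0 \<and> to_q \<tau> = z)"
    have "Im \<tau> > 0 \<and> to_q \<tau> = z"
      unfolding \<tau>_def by (rule someI_ex) (rule to_q_surj[OF False z])
    thus ?thesis using assms False by (auto simp: g_def has_q_expansion_def \<tau>_def[symmetric])
  qed
  have "ereal (norm (1 / 2 :: complex)) \<le> fps_conv_radius (Abs_fps (\<lambda>n. of_int (c n) :: complex))"
    unfolding fps_conv_radius_def
    by (rule conv_radius_geI) (use s[of "1/2"] in \<open>auto simp: sums_iff\<close>)
  hence r: "fps_conv_radius (Abs_fps (\<lambda>n. of_int (c n) :: complex)) > 0"
    by (rule less_le_trans[rotated]) simp
  have "eventually (\<lambda>z :: complex. z \<in> ball 0 1) (nhds 0)"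
    by (rule eventually_nhds_in_open) auto
  hence "eventually (\<lambda>z. eval_fps (Abs_fps (\<lambda>n. of_int (c n))) z = g z) (nhds 0)"
    by eventually_elim (use s in \<open>auto simp: eval_fps_def sums_iff\<close>)
  with r show ?thesis by (simp add: has_fps_expansion_def g_def)
qed

lemma q_expansion_unique:
  assumes "has_q_expansion f c" "has_q_expansion f c'"
  shows "c = c'"
proof -
  have "Abs_fps (\<lambda>n. of_int (c n) :: complex) = Abs_fps (\<lambda>n. of_int (c' n))"
    using fps_expansion_eqI[OF q_expansion_has_fps_expansion[OF assms(1)]]
      fps_expansion_eqI[OF q_expansion_has_fps_expansion[OF assms(2)]] by simp
  hence "of_int (c n) = (of_int (c' n) :: complex)" for n
    by (simp add: fps_eq_iff)
  thus ?thesis by (intro ext) simp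
qed

text \<open>This discharges the description operator: holomorphy on the whole disc gives convergence
  of the expansion, \<open>int_fps\<close> gives integrality, and \<open>q_expansion_unique\<close>
  uniqueness. The index shift comes from the factor \<open>q\<close>.\<close>

lemma gamma_coeff_eq:
  assumes h: "h has_fps_expansion H" "h holomorphic_on ball 0 1" and H: "int_fps H"
    and f: "\<And>\<tau>. Im \<tau> > 0 \<Longrightarrow> f_form L \<tau> = to_q \<tau> * h (to_q \<tau>)"
  shows "of_int (gamma_coeff L (Suc n)) = H $ n"
proof -
  have "int_fps (fps_X * H)" using H by auto
  hence "\<forall>n. \<exists>k. (fps_X * H) $ n = of_int k"
    unfolding int_fps_def by (blast elim: Ints_cases)
  hence "\<exists>c. \<forall>n. (fps_X * H) $ n = of_int (c n)" by (rule choice)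
  then obtain c where c: "\<And>n. (fps_X * H) $ n = of_int (c n)" by blast
  have "has_q_expansion (f_form L) c"
    unfolding has_q_expansion_def
  proof (intro conjI allI impI)
    show "c 0 = 0" using c[of 0] by simp
    fix \<tau> assume \<tau>: "Im \<tau> > 0"
    have e: "(\<lambda>z. z * h z) has_fps_expansion fps_X * H"
      by (intro has_fps_expansion_mult has_fps_expansion_fps_X h)
    have "(\<lambda>n. (fps_X * H) $ n * to_q \<tau> ^ n) sums (to_q \<tau> * h (to_q \<tau>))"
      by (rule has_fps_expansion_imp_sums_complex[OF e, where r = 1])
         (use h(2) to_q_norm_less_1[OF \<tau>] in \<open>auto simp: one_ereal_def intro!: holomorphic_intros\<close>)
    thus "(\<lambda>n. of_int (c n) * to_q \<tau> ^ n) sums f_form L \<tau>"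
      by (simp only: c f[OF \<tau>])
  qed
  hence "gamma_coeff L = c"
    unfolding gamma_coeff_def
    by (intro the_equality[where P = "has_q_expansion (f_form L)"]) (auto intro: q_expansion_unique)
  thus ?thesis using c[of "Suc n"] by simp
qed

text \<open>The 24th root of \<open>q\<close> fixed by the definition of eta. In each of the eta
  quotients its exponents add up to 24, which gives the factor \<open>to_q \<tau>\<close>.\<close>

definition q24 :: "complex \<Rightarrow> complex" where
  "q24 \<tau> = exp (2 * of_real pi * \<i> * \<tau> / 24)"

lemma q24_power: "q24 \<tau> ^ 24 = to_q \<tau>"
  unfolding q24_def to_q_def exp_of_nat_mult[symmetric] by (rule arg_cong[of _ _ exp]) simp

lemma dedekind_eta_of_nat: "dedekind_eta (of_nat k * \<tau>) = q24 \<tau> ^ k * euler_prod (to_q \<tau> ^ k)"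
proof -
  have "2 * of_real pi * \<i> * (of_nat k * \<tau>) / 24 = of_nat k * (2 * of_real pi * \<i> * \<tau> / 24)"
    "2 * of_real pi * \<i> * (of_nat k * \<tau>) = of_nat k * (2 * of_real pi * \<i> * \<tau>)"
    by (simp_all add: mult_ac)
  thus ?thesis
    by (simp only: dedekind_eta_def to_q_def exp_of_nat_mult q24_def euler_prod_def)
qed

lemma dedekind_eta_numeral:
  "dedekind_eta (numeral k * \<tau>) = q24 \<tau> ^ numeral k * euler_prod (to_q \<tau> ^ numeral k)"
  using dedekind_eta_of_nat[of "numeral k" \<tau>] by simp

lemma dedekind_eta_1: "dedekind_eta \<tau> = q24 \<tau> * euler_prod (to_q \<tau>)"
  using dedekind_eta_of_nat[of 1 \<tau>] by simp

lemma gamma_A: "of_int (gamma_coeff A (Suc n)) = (Eu 4 ^ 5 * Eu 8 ^ 5 * inverse (Eu 2 ^ 2 * Eu 16 ^ 2)) $ n"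
proof (rule gamma_coeff_eq)
  define h where "h z = euler_prod (z ^ 4) ^ 5 * euler_prod (z ^ 8) ^ 5 * inverse (euler_prod (z ^ 2) ^ 2 * euler_prod (z ^ 16) ^ 2)" for z
  show "h has_fps_expansion Eu 4 ^ 5 * Eu 8 ^ 5 * inverse (Eu 2 ^ 2 * Eu 16 ^ 2)"
    unfolding h_def by (intro has_fps_expansion_mult has_fps_expansion_power has_fps_expansion_inverse euler_prod_power_has_fps_expansion)
      (simp_all add: fps_power_zeroth)
  show "h holomorphic_on ball 0 1"
    unfolding h_def by (intro holomorphic_intros euler_prod_power_holomorphic) (simp_all add: euler_prod_power_nonzero)
  show "int_fps (Eu 4 ^ 5 * Eu 8 ^ 5 * inverse (Eu 2 ^ 2 * Eu 16 ^ 2))"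
    by (intro int_fps_mult int_fps_power int_fps_inverse int_Eu) (simp add: fps_power_zeroth)
  fix \<tau> assume "Im \<tau> > 0"
  define e where "e = q24 \<tau>"
  define a where "a k = euler_prod (to_q \<tau> ^ k)" for k
  have nz: "e \<noteq> 0" "a 2 \<noteq> 0" "a 16 \<noteq> 0"
    using euler_prod_power_nonzero[OF to_q_norm_less_1[OF \<open>Im \<tau> > 0\<close>]] by (simp_all add: e_def a_def q24_def)
  have "f_form A \<tau> = (e ^ 4 * a 4) ^ 5 * (e ^ 8 * a 8) ^ 5 / ((e ^ 2 * a 2) ^ 2 * (e ^ 16 * a 16) ^ 2)"
    by (simp add: dedekind_eta_numeral e_def a_def)
  also have "\<dots> = e ^ 24 * (a 4 ^ 5 * a 8 ^ 5 * inverse (a 2 ^ 2 * a 16 ^ 2))"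
    using nz by (simp add: power_mult_distrib field_simps flip: power_mult power_add)
  finally show "f_form A \<tau> = to_q \<tau> * h (to_q \<tau>)"
    unfolding e_def q24_power by (simp add: h_def a_def)
qed

lemma gamma_BD:
  assumes "L = B \<or> L = D"
  shows "of_int (gamma_coeff L (Suc n)) = (Eu 4 ^ 6) $ n"
proof (rule gamma_coeff_eq)
  define h where "h z = euler_prod (z ^ 4) ^ 6" for z
  show "h has_fps_expansion Eu 4 ^ 6"
    unfolding h_def by (intro has_fps_expansion_power euler_prod_power_has_fps_expansion) simp
  show "h holomorphic_on ball 0 1"
    unfolding h_def by (intro holomorphic_intros euler_prod_power_holomorphic) simp
  fix \<tau> assume "Im \<tau> > 0"
  define e where "e = q24 \<tau>"
  have "f_form L \<tau> = (e ^ 4 * euler_prod (to_q \<tau> ^ 4)) ^ 6"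
    using assms by (auto simp: dedekind_eta_numeral e_def)
  also have "\<dots> = e ^ 24 * h (to_q \<tau>)"
    by (simp add: power_mult_distrib h_def flip: power_mult)
  finally show "f_form L \<tau> = to_q \<tau> * h (to_q \<tau>)" unfolding e_def q24_power .
qed auto

lemma gamma_C: "of_int (gamma_coeff C (Suc n)) = (Eu 2 ^ 3 * Eu 6 ^ 3) $ n"
proof (rule gamma_coeff_eq)
  define h where "h z = euler_prod (z ^ 2) ^ 3 * euler_prod (z ^ 6) ^ 3" for z
  show "h has_fps_expansion Eu 2 ^ 3 * Eu 6 ^ 3"
    unfolding h_def by (intro has_fps_expansion_mult has_fps_expansion_power euler_prod_power_has_fps_expansion) simp_all
  show "h holomorphic_on ball 0 1"
    unfolding h_def by (intro holomorphic_intros euler_prod_power_holomorphic) simp_all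
  fix \<tau> assume "Im \<tau> > 0"
  define e where "e = q24 \<tau>"
  have "f_form C \<tau> = (e ^ 2 * euler_prod (to_q \<tau> ^ 2)) ^ 3 * (e ^ 6 * euler_prod (to_q \<tau> ^ 6)) ^ 3"
    by (simp add: dedekind_eta_numeral e_def)
  also have "\<dots> = e ^ 24 * h (to_q \<tau>)"
    unfolding h_def by algebra
  finally show "f_form C \<tau> = to_q \<tau> * h (to_q \<tau>)" unfolding e_def q24_power .
qed auto

lemma gamma_E: "of_int (gamma_coeff E (Suc n)) = (Eu 1 ^ 2 * Eu 2 * Eu 4 * Eu 8 ^ 2) $ n"
proof (rule gamma_coeff_eq)
  define h where "h z = euler_prod (z ^ 1) ^ 2 * euler_prod (z ^ 2) * euler_prod (z ^ 4) * euler_prod (z ^ 8) ^ 2" for z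
  show "h has_fps_expansion Eu 1 ^ 2 * Eu 2 * Eu 4 * Eu 8 ^ 2"
    unfolding h_def by (intro has_fps_expansion_mult has_fps_expansion_power euler_prod_power_has_fps_expansion) simp_all
  show "h holomorphic_on ball 0 1"
    unfolding h_def by (intro holomorphic_intros euler_prod_power_holomorphic) simp_all
  fix \<tau> assume "Im \<tau> > 0"
  define e where "e = q24 \<tau>"
  have "f_form E \<tau> = (e * euler_prod (to_q \<tau> ^ 1)) ^ 2 * (e ^ 2 * euler_prod (to_q \<tau> ^ 2)) * (e ^ 4 * euler_prod (to_q \<tau> ^ 4)) * (e ^ 8 * euler_prod (to_q \<tau> ^ 8)) ^ 2"
    by (simp add: dedekind_eta_numeral dedekind_eta_1[of \<tau>] e_def)
  also have "\<dots> = e ^ 24 * h (to_q \<tau>)"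
    unfolding h_def by algebra
  finally show "f_form E \<tau> = to_q \<tau> * h (to_q \<tau>)" unfolding e_def q24_power .
qed (intro int_fps_mult int_fps_power int_Eu)

definition H8 :: "complex fps" where
  "H8 = Eu 1 ^ 2 * Eu 4 ^ 7 * inverse (Eu 2 * Eu 8 ^ 2)"

lemma H8_prod: "H8 * (Eu 2 * Eu 8 ^ 2) = Eu 1 ^ 2 * Eu 4 ^ 7"
  unfolding H8_def mult.assoc by (subst inverse_mult_eq_1) (simp_all add: fps_power_zeroth)

text \<open>In \<open>f_E / q\<close> only \<open>Eu 1 ^ 2 = \<phi>m * Eu 2\<close> is not a series
  in \<open>q^2\<close>. Its dissection isolates the even part, with \<open>dil 4 \<phi>\<close> in
  place of \<open>\<phi>m\<close>.\<close>

lemma gamma_E_odd: "of_int (gamma_coeff E (Suc (2 * n))) = H8 $ n"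
proof -
  have "(Eu 1 ^ 2 * Eu 2 * Eu 4 * Eu 8 ^ 2) = \<phi>m * (Eu 2 ^ 2 * Eu 4 * Eu 8 ^ 2)"
    unfolding phim_prod[symmetric] by (simp only: power2_eq_square mult_ac)
  also have "\<phi>m = dil 4 \<phi> - 2 * fps_X * dil 8 \<psi>" by (rule phim_dissect2)
  also have "(dil 4 \<phi> - 2 * fps_X * dil 8 \<psi>) * (Eu 2 ^ 2 * Eu 4 * Eu 8 ^ 2) =
     dil 2 (dil 2 \<phi> * (Eu 1 ^ 2 * Eu 2 * Eu 4 ^ 2)) - 2 * (fps_X * dil 2 (dil 4 \<psi> * (Eu 1 ^ 2 * Eu 2 * Eu 4 ^ 2)))"
    by (simp add: dil_mult dil_power dil_dil left_diff_distrib mult.assoc)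
  finally have e: "(Eu 1 ^ 2 * Eu 2 * Eu 4 * Eu 8 ^ 2) = \<dots>" .
  have "dil 2 \<phi> * (Eu 1 ^ 2 * Eu 2 * Eu 4 ^ 2) * (Eu 2 * Eu 8 ^ 2) = H8 * (Eu 2 * Eu 8 ^ 2)"
    unfolding H8_prod using dil_products(1) by algebra
  hence H: "dil 2 \<phi> * (Eu 1 ^ 2 * Eu 2 * Eu 4 ^ 2) = H8" by simp
  have odd0: "(2 * (fps_X * dil 2 g)) $ (2 * n) = 0" for g
    by (cases n) (simp_all add: dil_nth numeral_fps_const)
  show ?thesis unfolding gamma_E e H by (simp add: odd0 dil_nth del: mult_2)
qed

text \<open>\<open>f_A / q\<close> is a series in \<open>q^2\<close>, and its half \<open>K\<close>
  is \<open>H8\<close> at \<open>-q\<close>: the twist that \<open>C_seq_A_cong_E\<close> shows on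
  the side of the sequences.\<close>

lemma gamma_A_odd: "of_int (gamma_coeff A (Suc (2 * n))) = (-1) ^ n * H8 $ n"
proof -
  define K where "K = Eu 2 ^ 5 * Eu 4 ^ 5 * inverse (Eu 1 ^ 2 * Eu 8 ^ 2)"
  have K: "K * (Eu 1 ^ 2 * Eu 8 ^ 2) = Eu 2 ^ 5 * Eu 4 ^ 5"
    unfolding K_def mult.assoc by (subst inverse_mult_eq_1) (simp_all add: fps_power_zeroth)
  have "Eu 4 ^ 5 * Eu 8 ^ 5 * inverse (Eu 2 ^ 2 * Eu 16 ^ 2) = dil 2 K"
    by (simp add: K_def dil_mult dil_power dil_inverse fps_power_zeroth)
  hence "of_int (gamma_coeff A (Suc (2 * n))) = K $ n"
    unfolding gamma_A by (simp add: dil_nth)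
  also have "K = sc (-1) H8"
  proof -
    define s where "s = sc (-1) (Eu 1)"
    have s: "s * (Eu 1 * Eu 4) = Eu 2 ^ 3" unfolding s_def by (rule sc_minus1_Eu1)
    have "sc (-1) H8 * (Eu 2 * Eu 8 ^ 2) = s ^ 2 * Eu 4 ^ 7"
      using arg_cong[OF H8_prod, of "sc (-1)"] by (simp add: sc_mult sc_power sc_Eu_dvd s_def)
    hence "sc (-1) H8 * (Eu 2 * Eu 8 ^ 2 * Eu 1 ^ 2) = (s * (Eu 1 * Eu 4)) ^ 2 * Eu 4 ^ 5"
      by algebra
    also have "\<dots> = K * (Eu 2 * Eu 8 ^ 2 * Eu 1 ^ 2)"
      unfolding s using K by algebra
    finally show ?thesis by simp
  qed
  finally show ?thesis by (simp add: sc_nth)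
qed

lemma gamma_BD_odd: "L = B \<or> L = D \<Longrightarrow> of_int (gamma_coeff L (Suc (2 * n))) = (Eu 2 ^ 6) $ n"
proof -
  have "Eu 4 ^ 6 = dil 2 (Eu 2 ^ 6)" by (simp add: dil_power)
  thus "L = B \<or> L = D \<Longrightarrow> ?thesis" by (simp add: gamma_BD dil_nth)
qed

lemma gamma_C_odd: "of_int (gamma_coeff C (Suc (2 * n))) = (Eu 1 ^ 3 * Eu 3 ^ 3) $ n"
proof -
  have "Eu 2 ^ 3 * Eu 6 ^ 3 = dil 2 (Eu 1 ^ 3 * Eu 3 ^ 3)" by (simp add: dil_power dil_mult)
  thus ?thesis by (simp add: gamma_C dil_nth)
qed

theorem theorem2p1:
  fixes L :: label and p :: nat
  assumes "prime p" and "p > 2"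
  shows "[C_seq L ((p - 1) div 2) = gamma_coeff L p] (mod (int p))"
proof -
  define n where "n = (p - 1) div 2"
  have odd: "odd p" using assms by (rule prime_odd_nat)
  hence p: "p = 2 * n + 1" by (auto simp: n_def elim!: oddE)
  hence p': "p = Suc (2 * n)" by simp
  note pp = assms(1) odd
  have BD: "[seq_D n = gamma_coeff L p] (mod int p)" if "L = B \<or> L = D"
    using eta_quotient_cong_D[OF pp, of "gamma_coeff L p"] gamma_BD_odd[OF that, of n]
    unfolding n_def[symmetric] p'[symmetric] by simp
  have CE: "[C_seq E n = gamma_coeff E p] (mod int p)"
    using eta_quotient_cong_E[OF H8_prod pp, of "gamma_coeff E p"] gamma_E_odd[of n]
    unfolding n_def[symmetric] p'[symmetric] by (simp del: C_seq.simps)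
  have "[C_seq L n = gamma_coeff L p] (mod int p)"
  proof (cases L)
    case A
    have "(of_int (gamma_coeff label.A p) :: complex) = of_int ((-1) ^ n * gamma_coeff E p)"
      using gamma_A_odd[of n] gamma_E_odd[of n] unfolding p'[symmetric] by simp
    hence "gamma_coeff label.A p = (-1) ^ n * gamma_coeff E p" by (simp only: of_int_eq_iff)
    moreover have "[(-1) ^ n * C_seq E n = (-1) ^ n * gamma_coeff E p] (mod int p)"
      by (rule cong_mult[OF cong_refl CE])
    ultimately show ?thesis
      using cong_trans[OF C_seq_A_cong_E[OF assms(1) p]] unfolding A by (simp only:)
  next
    case B
    have "[C_seq label.B n = seq_D n] (mod int p)"
      using C_seq_B_cong[OF assms(1) p] seq_D_cong[OF assms(1) p] by (metis cong_sym cong_trans)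
    thus ?thesis using BD B by (metis cong_trans)
  next
    case C
    show ?thesis
      using eta_quotient_cong_C[OF pp, of "gamma_coeff label.C p"] gamma_C_odd[of n]
      unfolding n_def[symmetric] p'[symmetric] C by (simp del: C_seq.simps)
  next
    case D
    have "[C_seq label.D n = seq_D n] (mod int p)"
      using C_seq_D_cong[OF assms(1) p] seq_D_cong[OF assms(1) p] by (metis cong_sym cong_trans)
    thus ?thesis using BD D by (metis cong_trans)
  next
    case E
    thus ?thesis using CE by simp
  qed
  thus ?thesis by (simp only: n_def)
qed

end
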